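(* Suppose that $\mathcal{K}$ is a function defined on $\{x\in\mathbb{R}^3: x_1x_2x_3\neq 0\}$ which satisfies, with a constant $C$ and exponents $0<\theta_1\le 1$, $0<\theta_2<1$, the regularity condition (R) and the cancellation conditions (C1.a), (C1.b), (C1.c), (C1.d) stated in the context. For $\epsilon=(\epsilon_1,\epsilon_2,\epsilon_3)$ and $N=(N_1,N_2,N_3)$ with $0<\epsilon_i\le N_i<\infty$ ($i=1,2,3$), set $\mathcal{K}_\epsilon^N(x_1,x_2,x_3)=\mathcal{K}(x_1,x_2,x_3)$ if $\epsilon_1\le|x_1|\le N_1$, $\epsilon_2\le|x_2|\le N_2$ and $\epsilon_3\le|x_3|\le N_3$, and $\mathcal{K}_\epsilon^N(x_1,x_2,x_3)=0$ otherwise. Then the operator $f\mapsto \mathcal{K}_\epsilon^N * f$ is bounded on $L^2(\mathbb{R}^3)$ and, moreover, $$\|\mathcal{K}_\epsilon^N * f\|_{L^2(\mathbb{R}^3)}\le A\|f\|_{L^2(\mathbb{R}^3)},$$ where the constant $A$ depends only on the constant $C$ (the exponents $\theta_1,\theta_2$ being fixed) but not on $\epsilon_1,\epsilon_2,\epsilon_3,N_1,N_2,N_3$.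
   Context: Fix $0<\theta_1\le1$, $0<\theta_2<1$ and a constant $C$. For $\alpha,\beta,\gamma\in\{0,1\}$ and $h_1,h_2,h_3\in\mathbb{R}$ define $\Delta^\alpha_{x_1,h_1}\mathcal{K}(x_1,x_2,x_3)=\alpha\mathcal{K}(x_1+h_1,x_2,x_3)-\mathcal{K}(x_1,x_2,x_3)$, $\Delta^\beta_{x_2,h_2}\mathcal{K}(x_1,x_2,x_3)=\beta\mathcal{K}(x_1,x_2+h_2,x_3)-\mathcal{K}(x_1,x_2,x_3)$, $\Delta^\gamma_{x_3,h_3}\mathcal{K}(x_1,x_2,x_3)=\gamma\mathcal{K}(x_1,x_2,x_3+h_3)-\mathcal{K}(x_1,x_2,x_3)$. (R): $$|\Delta^\alpha_{x_1,h_1}\Delta^\beta_{x_2,h_2}\Delta^\gamma_{x_3,h_3}\mathcal{K}(x_1,x_2,x_3)|\le \frac{C|h_1|^{\alpha\theta_1}|h_2|^{\beta\theta_1}|h_3|^{\gamma\theta_1}}{|x_1|^{\alpha\theta_1+1}|x_2|^{\beta\theta_1+1}|x_3|^{\gamma\theta_1+1}\big(|\frac{x_1x_2}{x_3}|+|\frac{x_3}{x_1x_2}|\big)^{\theta_2}}$$ for all $\alpha,\beta,\gamma\in\{0,1\}$ with ($0\le\alpha\le1$, $0\le\beta+\gamma\le1$) or ($0\le\alpha+\gamma\le1$, $0\le\beta\le1$), and all $|x_1|\ge2|h_1|>0$, $|x_2|\ge2|h_2|>0$, $|x_3|\ge2|h_3|>0$. (C1.a): $\Big|\int_{\delta_1\le|x_1|\le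 r_1}\int_{\delta_2\le|x_2|\le r_2}\int_{\delta_3\le|x_3|\le r_3}\mathcal{K}(x_1,x_2,x_3)\,dx_1dx_2dx_3\Big|\le C$ uniformly for all $\delta_1,\delta_2,\delta_3,r_1,r_2,r_3>0$. (C1.b): $\Big|\int_{\delta_1\le|x_1|\le r_1}\int_{\delta_2\le|x_2|\le r_2}\Delta^\gamma_{x_3,h_3}\mathcal{K}(x_1,x_2,x_3)\,dx_1dx_2\Big|\le \frac{C|h_3|^{\gamma\theta_1}}{|x_3|^{\gamma\theta_1+1}}$ uniformly for all $\delta_1,\delta_2,r_1,r_2>0$, $|x_3|\ge2|h_3|>0$, $\gamma\in\{0,1\}$. (C1.c): $\Big|\int_{\delta_2\le|x_2|\le r_2}\int_{\delta_3\le|x_3|\le r_3}\Delta^\alpha_{x_1,h_1}\mathcal{K}(x_1,x_2,x_3)\,dx_2dx_3\Big|\le \frac{C|h_1|^{\alpha\theta_1}}{|x_1|^{\alpha\theta_1+1}}$ uniformly for all $\delta_2,\delta_3,r_2,r_3>0$, $|x_1|\ge2|h_1|>0$, $\alpha\in\{0,1\}$. (C1.d): $\Big|\int_{\delta_1\le|x_1|\le r_1}\int_{\delta_3\le|x_3|\le r_3}\Delta^\beta_{x_2,h_2}\mathcal{K}(x_1,x_2,x_3)\,dx_3dx_1\Big|\le \frac{C|h_2|^{\beta\theta_1}}{|x_2|^{\beta\theta_1+1}}$ uniformly for all $\delta_1,\delta_3,r_1,r_3>0$, $|x_2|\ge2|h_2|>0$, $\beta\in\{0,1\}$. *)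

theory Defs
  imports "HOL-Analysis.Analysis"
begin

text \<open>
  \<open>\<real>\<^sup>3\<close> is represented by \<^typ>\<open>real \<times> real \<times> real\<close>.  A kernel is defined only where
  \<open>x\<^sub>1 x\<^sub>2 x\<^sub>3 \<noteq> 0\<close>; it is modelled by a total function whose values on the coordinate
  planes are never constrained and never used: all arguments below have nonzero coordinates
  (\<open>\<bar>x + h\<bar> \<ge> \<bar>x\<bar> / 2\<close> when \<open>\<bar>x\<bar> \<ge> 2 \<bar>h\<bar>\<close>), and the truncated kernel vanishes there.
\<close>

type_synonym kernel = "real \<times> real \<times> real \<Rightarrow> complex"

definition Delta1 :: "nat \<Rightarrow> real \<Rightarrow> kernel \<Rightarrow> kernel" where
  "Delta1 \<alpha> h K = (\<lambda>(x1, x2, x3). of_nat \<alpha> * K (x1 + h, x2, x3) - K (x1, x2, x3))"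

definition Delta2 :: "nat \<Rightarrow> real \<Rightarrow> kernel \<Rightarrow> kernel" where
  "Delta2 \<beta> h K = (\<lambda>(x1, x2, x3). of_nat \<beta> * K (x1, x2 + h, x3) - K (x1, x2, x3))"

definition Delta3 :: "nat \<Rightarrow> real \<Rightarrow> kernel \<Rightarrow> kernel" where
  "Delta3 \<gamma> h K = (\<lambda>(x1, x2, x3). of_nat \<gamma> * K (x1, x2, x3 + h) - K (x1, x2, x3))"

definition shell :: "real \<Rightarrow> real \<Rightarrow> real set" where
  "shell \<delta> r = {x. \<delta> \<le> \<bar>x\<bar> \<and> \<bar>x\<bar> \<le> r}"

definition regularity :: "real \<Rightarrow> real \<Rightarrow> real \<Rightarrow> kernel \<Rightarrow> bool" where
  "regularity C \<theta>1 \<theta>2 K \<longleftrightarrow>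
    (\<forall>\<alpha>\<in>{0, 1}. \<forall>\<beta>\<in>{0, 1}. \<forall>\<gamma>\<in>{0, 1}.
      (\<alpha> \<le> 1 \<and> \<beta> + \<gamma> \<le> 1) \<or> (\<alpha> + \<gamma> \<le> 1 \<and> \<beta> \<le> 1) \<longrightarrow>
      (\<forall>x1 x2 x3 h1 h2 h3.
        \<bar>x1\<bar> \<ge> 2 * \<bar>h1\<bar> \<and> 2 * \<bar>h1\<bar> > 0 \<and>
        \<bar>x2\<bar> \<ge> 2 * \<bar>h2\<bar> \<and> 2 * \<bar>h2\<bar> > 0 \<and>
        \<bar>x3\<bar> \<ge> 2 * \<bar>h3\<bar> \<and> 2 * \<bar>h3\<bar> > 0 \<longrightarrow>
        norm (Delta1 \<alpha> h1 (Delta2 \<beta> h2 (Delta3 \<gamma> h3 K)) (x1, x2, x3))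
        \<le> C * \<bar>h1\<bar> powr (real \<alpha> * \<theta>1) * \<bar>h2\<bar> powr (real \<beta> * \<theta>1) * \<bar>h3\<bar> powr (real \<gamma> * \<theta>1) /
          (\<bar>x1\<bar> powr (real \<alpha> * \<theta>1 + 1) * \<bar>x2\<bar> powr (real \<beta> * \<theta>1 + 1) * \<bar>x3\<bar> powr (real \<gamma> * \<theta>1 + 1) *
           (\<bar>x1 * x2 / x3\<bar> + \<bar>x3 / (x1 * x2)\<bar>) powr \<theta>2)))"

text \<open>
  The regularity condition makes a kernel locally Hoelder continuous in each variable, locally uniformly
  in the others, hence jointly continuous off the coordinate planes.  So the integrands in the
  cancellation conditions are continuous on compact sets, and iterated integrals agree with
  multiple integrals.
\<close>

definition cancellation_a :: "real \<Rightarrow> kernel \<Rightarrow> bool" where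
  "cancellation_a C K \<longleftrightarrow>
    (\<forall>\<delta>1 \<delta>2 \<delta>3 r1 r2 r3.
      \<delta>1 > 0 \<and> \<delta>2 > 0 \<and> \<delta>3 > 0 \<and> r1 > 0 \<and> r2 > 0 \<and> r3 > 0 \<longrightarrow>
      norm (LINT x1:shell \<delta>1 r1|lebesgue. LINT x2:shell \<delta>2 r2|lebesgue.
              LINT x3:shell \<delta>3 r3|lebesgue. K (x1, x2, x3)) \<le> C)"

definition cancellation_b :: "real \<Rightarrow> real \<Rightarrow> kernel \<Rightarrow> bool" where
  "cancellation_b C \<theta>1 K \<longleftrightarrow>
    (\<forall>\<gamma>\<in>{0, 1}. \<forall>\<delta>1 \<delta>2 r1 r2 x3 h3.
      \<delta>1 > 0 \<and> \<delta>2 > 0 \<and> r1 > 0 \<and> r2 > 0 \<and> \<bar>x3\<bar> \<ge> 2 * \<bar>h3\<bar> \<and> 2 * \<bar>h3\<bar> > 0 \<longrightarrow>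
      norm (LINT x1:shell \<delta>1 r1|lebesgue. LINT x2:shell \<delta>2 r2|lebesgue.
              Delta3 \<gamma> h3 K (x1, x2, x3))
      \<le> C * \<bar>h3\<bar> powr (real \<gamma> * \<theta>1) / \<bar>x3\<bar> powr (real \<gamma> * \<theta>1 + 1))"

definition cancellation_c :: "real \<Rightarrow> real \<Rightarrow> kernel \<Rightarrow> bool" where
  "cancellation_c C \<theta>1 K \<longleftrightarrow>
    (\<forall>\<alpha>\<in>{0, 1}. \<forall>\<delta>2 \<delta>3 r2 r3 x1 h1.
      \<delta>2 > 0 \<and> \<delta>3 > 0 \<and> r2 > 0 \<and> r3 > 0 \<and> \<bar>x1\<bar> \<ge> 2 * \<bar>h1\<bar> \<and> 2 * \<bar>h1\<bar> > 0 \<longrightarrow>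
      norm (LINT x2:shell \<delta>2 r2|lebesgue. LINT x3:shell \<delta>3 r3|lebesgue.
              Delta1 \<alpha> h1 K (x1, x2, x3))
      \<le> C * \<bar>h1\<bar> powr (real \<alpha> * \<theta>1) / \<bar>x1\<bar> powr (real \<alpha> * \<theta>1 + 1))"

definition cancellation_d :: "real \<Rightarrow> real \<Rightarrow> kernel \<Rightarrow> bool" where
  "cancellation_d C \<theta>1 K \<longleftrightarrow>
    (\<forall>\<beta>\<in>{0, 1}. \<forall>\<delta>1 \<delta>3 r1 r3 x2 h2.
      \<delta>1 > 0 \<and> \<delta>3 > 0 \<and> r1 > 0 \<and> r3 > 0 \<and> \<bar>x2\<bar> \<ge> 2 * \<bar>h2\<bar> \<and> 2 * \<bar>h2\<bar> > 0 \<longrightarrow>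
      norm (LINT x1:shell \<delta>1 r1|lebesgue. LINT x3:shell \<delta>3 r3|lebesgue.
              Delta2 \<beta> h2 K (x1, x2, x3))
      \<le> C * \<bar>h2\<bar> powr (real \<beta> * \<theta>1) / \<bar>x2\<bar> powr (real \<beta> * \<theta>1 + 1))"

definition truncated_kernel ::
    "real \<times> real \<times> real \<Rightarrow> real \<times> real \<times> real \<Rightarrow> kernel \<Rightarrow> kernel" where
  "truncated_kernel = (\<lambda>(\<epsilon>1, \<epsilon>2, \<epsilon>3) (N1, N2, N3) K (x1, x2, x3).
     if \<epsilon>1 \<le> \<bar>x1\<bar> \<and> \<bar>x1\<bar> \<le> N1 \<and> \<epsilon>2 \<le> \<bar>x2\<bar> \<and> \<bar>x2\<bar> \<le> N2 \<and> \<epsilon>3 \<le> \<bar>x3\<bar> \<and> \<bar>x3\<bar> \<le> N3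
     then K (x1, x2, x3) else 0)"

definition L2_fun :: "('a::euclidean_space \<Rightarrow> complex) \<Rightarrow> bool" where
  "L2_fun f \<longleftrightarrow> f \<in> borel_measurable lebesgue \<and> integrable lebesgue (\<lambda>x. (norm (f x))\<^sup>2)"

definition L2_norm :: "('a::euclidean_space \<Rightarrow> complex) \<Rightarrow> real" where
  "L2_norm f = sqrt (LINT x|lebesgue. (norm (f x))\<^sup>2)"

definition convolution ::
    "('a::euclidean_space \<Rightarrow> complex) \<Rightarrow> ('a \<Rightarrow> complex) \<Rightarrow> 'a \<Rightarrow> complex" where
  "convolution k f x = (LINT y|lebesgue. k (x - y) * f y)"

end

theory Submission
  imports "HOL-Probability.Characteristic_Functions" Defs
begin

text \<open>
  The truncated kernel \<open>k\<close> is bounded with compact support, so the operator is a convolution with an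
  integrable function, and its norm on \<open>L\<^sup>2\<close> is at most the supremum of \<open>\<bar>fourier k\<bar>\<close>.  The proof
  bounds this supremum by a constant depending on \<open>C\<close>, \<open>\<theta>1\<close> and \<open>\<theta>2\<close> only.

  In each variable the character on the shell, \<open>wave \<epsilon> N \<xi>\<close>, is split as \<open>core \<epsilon> N \<xi> + osc \<epsilon> N \<xi>\<close>, where
  the core is the constant 1 on the part of the shell on which the character has made at most one turn.
  The core is the indicator of a smaller shell, so it is the kind of weight for which the cancellation
  conditions speak.  The rest is controlled by regularity (\<open>osc_integral_bound\<close>): integrating \<open>osc\<close>
  against a function of size \<open>M / \<bar>x\<bar>\<close> with the matching Hoelder bound costs a constant times \<open>M\<close>.
  Where the character is close to 1 the factor \<open>cis (\<xi> * x) - 1\<close> is small, and elsewhere a shift by half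
  a period turns the integral into one of differences.

  Expanding the product of the three sums leaves three kinds of terms.  With three cores,
  \<open>cancellation_a\<close> bounds the integral.  With two cores, the other cancellation conditions say that
  the integral over these two variables is, in the third one, a function to which the one-variable
  bound applies.  With at least two oscillating factors, the third variable is integrated in absolute
  value; the factor with exponent \<open>\<theta>2\<close> makes this integral converge, uniformly in the other variables
  (\<open>log_integrable_integral\<close>), and the one-variable bound applies in the two oscillating variables one
  after the other (\<open>two_oscillations_bound\<close>).  This needs differences in two variables at a time, which
  is what the regularity condition provides: all triples \<open>(\<alpha>, \<beta>, \<gamma>)\<close> except \<open>(1, 1, 1)\<close>.

  The passage from multipliers to operators (\<open>L2_bound_of_fourier_bound\<close>) avoids an inversion theorem.
  For integrable and square integrable \<open>f\<close>, the integral of \<open>\<bar>fourier f\<bar>\<^sup>2\<close> against a wide Gaussian equals, up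
  to a factor not depending on \<open>f\<close>, the average of the autocorrelation of \<open>f\<close> against a narrow Gaussian.
  For every \<open>f\<close> this average is at most a constant times the squared norm, and it tends to that
  constant times the squared norm if \<open>f\<close> is bounded and continuous.  The convolution \<open>k * f\<close> is
  continuous because \<open>k\<close> is continuous almost everywhere.
\<close>

section \<open>The Fourier transform of a Gaussian\<close>

definition fourier :: "('a::euclidean_space \<Rightarrow> complex) \<Rightarrow> 'a \<Rightarrow> complex" where
  "fourier f \<xi> = (LINT x|lborel. cis (\<xi> \<bullet> x) * f x)"

lemma cis_measurable [measurable]: "cis \<in> borel_measurable borel"
  by (intro borel_measurable_continuous_onI continuous_intros)

lemma integrable_cis_mult:
  fixes f :: "'a::euclidean_space \<Rightarrow> complex"
  assumes "integrable lborel f"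
  shows "integrable lborel (\<lambda>x. cis (\<xi> \<bullet> x) * f x)"
proof (rule Bochner_Integration.integrable_bound[OF assms])
  have [measurable]: "f \<in> borel_measurable borel" using borel_measurable_integrable[OF assms] by simp
  show "(\<lambda>x. cis (\<xi> \<bullet> x) * f x) \<in> borel_measurable lborel" by measurable
qed (simp add: norm_mult)

lemma integrable_prod_lborel:
  fixes f :: "'a::euclidean_space \<Rightarrow> complex" and g :: "'b::euclidean_space \<Rightarrow> complex"
  assumes f: "integrable lborel f" and g: "integrable lborel g"
  shows "integrable (lborel \<Otimes>\<^sub>M lborel) (\<lambda>(x, y). f x * g y)"
proof -
  have [measurable]: "f \<in> borel_measurable borel" "g \<in> borel_measurable borel"
    using borel_measurable_integrable[OF f] borel_measurable_integrable[OF g] by simp_all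
  show ?thesis
  proof (rule lborel_pair.Fubini_integrable)
    show "(\<lambda>(x, y). f x * g y) \<in> borel_measurable (lborel \<Otimes>\<^sub>M lborel)" by measurable
    show "integrable lborel (\<lambda>x. LINT y|lborel. norm (case (x, y) of (x, y) \<Rightarrow> f x * g y))"
      using f by (simp add: norm_mult)
    show "AE x in lborel. integrable lborel (\<lambda>y. case (x, y) of (x, y) \<Rightarrow> f x * g y)"
      using g by simp
  qed
qed

lemma gaussian_real:
  fixes t :: real
  shows "integrable lborel (\<lambda>x::real. cis (x * t) * of_real (exp (- x\<^sup>2 / 2)))"
    and "(LINT x|lborel. cis (x * t) * of_real (exp (- x\<^sup>2 / 2))) = of_real (sqrt (2 * pi) * exp (- t\<^sup>2 / 2))"
proof -
  have eq: "exp (- x\<^sup>2 / 2) = sqrt (2 * pi) * std_normal_density x" for x :: real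
    by (simp add: normal_density_def)
  have "integrable lborel (\<lambda>x::real. complex_of_real (sqrt (2 * pi) * std_normal_density x))"
    by (intro integrable_of_real integrable_mult_right integrable_normal_density) auto
  from integrable_cis_mult[OF this, of t]
  show "integrable lborel (\<lambda>x::real. cis (x * t) * of_real (exp (- x\<^sup>2 / 2)))"
    unfolding eq by (simp add: mult.commute)
  have "complex_of_real (exp (- t\<^sup>2 / 2)) = char std_normal_distribution t"
    by (simp add: char_std_normal_distribution)
  also have "\<dots> = (LINT x|lborel. std_normal_density x *\<^sub>R iexp (t * x))"
    unfolding char_def by (subst integral_density) auto
  finally have "complex_of_real (sqrt (2 * pi)) * complex_of_real (exp (- t\<^sup>2 / 2)) =
     complex_of_real (sqrt (2 * pi)) * (LINT x|lborel. std_normal_density x *\<^sub>R iexp (t * x))" by simp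
  also have "\<dots> = (LINT x|lborel. cis (x * t) * of_real (exp (- x\<^sup>2 / 2)))"
    unfolding eq integral_mult_right_zero[symmetric]
    by (intro Bochner_Integration.integral_cong) (auto simp: cis_conv_exp scaleR_conv_of_real mult_ac)
  finally show "(LINT x|lborel. cis (x * t) * of_real (exp (- x\<^sup>2 / 2))) = of_real (sqrt (2 * pi) * exp (- t\<^sup>2 / 2))"
    by simp
qed

lemma cis_sum: "finite A \<Longrightarrow> cis (sum f A) = (\<Prod>a\<in>A. cis (f a))"
  by (induction A rule: finite_induct) (auto simp flip: cis_mult)

text \<open>
  Gaussian and character are both products over the coordinates, which reduces the integral to the
  characteristic function of the normal distribution on the line.
\<close>

lemma gaussian_fourier:
  fixes y :: "'a::euclidean_space"
  shows "integrable lborel (\<lambda>x::'a. exp (- (norm x)\<^sup>2 / 2))"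
    and "fourier (\<lambda>x. of_real (exp (- (norm x)\<^sup>2 / 2))) y =
      of_real (sqrt (2 * pi) ^ DIM('a) * exp (- (norm y)\<^sup>2 / 2))"
proof -
  interpret product_sigma_finite "\<lambda>b::'a. lborel :: real measure" ..
  define G where "G = (\<lambda>y x :: 'a. cis (y \<bullet> x) * complex_of_real (exp (- (norm x)\<^sup>2 / 2)))"
  have G: "G y x = (\<Prod>b\<in>Basis. cis ((x \<bullet> b) * (y \<bullet> b)) * of_real (exp (- (x \<bullet> b)\<^sup>2 / 2)))" for x y :: 'a
  proof -
    have "G y x = cis (\<Sum>b\<in>Basis. (x \<bullet> b) * (y \<bullet> b)) * of_real (exp (\<Sum>b\<in>Basis. - (x \<bullet> b)\<^sup>2 / 2))"
      unfolding G_def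
      by (subst euclidean_inner, subst power2_norm_eq_inner, subst (2) euclidean_inner)
         (simp add: sum_negf sum_divide_distrib power2_eq_square mult.commute)
    then show ?thesis by (simp add: exp_sum cis_sum prod.distrib)
  qed
  have [measurable]: "G y \<in> borel_measurable borel" for y
    unfolding G_def by measurable
  have int: "integrable lborel (G y)"
    and eq: "integral\<^sup>L lborel (G y) = of_real (sqrt (2 * pi) ^ DIM('a) * exp (- (norm y)\<^sup>2 / 2))" for y
  proof -
    show "integrable lborel (G y)"
    proof (subst lborel_eq, subst integrable_distr_eq)
      show "integrable (\<Pi>\<^sub>M b\<in>Basis. lborel) (\<lambda>f. G y (\<Sum>b\<in>Basis. f b *\<^sub>R b))"
      proof -
        have "integrable (\<Pi>\<^sub>M b\<in>Basis. lborel)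
          (\<lambda>f. \<Prod>b\<in>Basis. cis (f b * (y \<bullet> b)) * complex_of_real (exp (- (f b)\<^sup>2 / 2)))"
          by (rule product_integrable_prod) (use gaussian_real(1) in auto)
        then show ?thesis unfolding G by simp
      qed
    qed measurable
    have "integral\<^sup>L lborel (G y) = (LINT f|(\<Pi>\<^sub>M b\<in>Basis. lborel). G y (\<Sum>b\<in>Basis. f b *\<^sub>R b))"
      by (subst lborel_eq, subst integral_distr) measurable
    also have "\<dots> = (LINT f|(\<Pi>\<^sub>M b\<in>Basis. lborel). (\<Prod>b\<in>Basis. cis (f b * (y \<bullet> b)) * of_real (exp (- (f b)\<^sup>2 / 2))))"
      unfolding G by simp
    also have "\<dots> = (\<Prod>b\<in>Basis. of_real (sqrt (2 * pi) * exp (- (y \<bullet> b)\<^sup>2 / 2)))"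
      using gaussian_real by (subst product_integral_prod) auto
    also have "\<dots> = of_real (sqrt (2 * pi) ^ DIM('a) * exp (\<Sum>b\<in>Basis. - (y \<bullet> b)\<^sup>2 / 2))"
      by (simp add: prod.distrib exp_sum)
    also have "(\<Sum>b\<in>Basis. - (y \<bullet> b)\<^sup>2 / 2) = - (norm y)\<^sup>2 / 2"
      unfolding power2_norm_eq_inner by (subst euclidean_inner) (simp add: sum_negf sum_divide_distrib power2_eq_square)
    finally show "integral\<^sup>L lborel (G y) = of_real (sqrt (2 * pi) ^ DIM('a) * exp (- (norm y)\<^sup>2 / 2))" .
  qed
  show "integrable lborel (\<lambda>x::'a. exp (- (norm x)\<^sup>2 / 2))"
    using integrable_norm[OF int[of 0]] by (simp add: G_def norm_mult)
  show "fourier (\<lambda>x. of_real (exp (- (norm x)\<^sup>2 / 2))) y =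
      of_real (sqrt (2 * pi) ^ DIM('a) * exp (- (norm y)\<^sup>2 / 2))"
    using eq[of y] unfolding G_def fourier_def .
qed

lemma lborel_integral_reflect_scale:
  fixes f :: "'a::euclidean_space \<Rightarrow> complex" and e :: real
  assumes "e > 0" and [measurable]: "f \<in> borel_measurable borel"
  shows "(LINT y|lborel. f y) = e ^ DIM('a) *\<^sub>R (LINT z|lborel. f (x - e *\<^sub>R z))"
proof -
  have "lborel = density (distr lborel borel (\<lambda>z. x + (- e) *\<^sub>R z)) (\<lambda>_. \<bar>- e\<bar> ^ DIM('a))"
    using assms by (intro lborel_affine) auto
  then have "(LINT y|lborel. f y) = (LINT y|density (distr lborel borel (\<lambda>z. x + (- e) *\<^sub>R z)) (\<lambda>_. \<bar>- e\<bar> ^ DIM('a)). f y)"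
    by simp
  also have "\<dots> = e ^ DIM('a) *\<^sub>R (LINT z|lborel. f (x - e *\<^sub>R z))"
    using assms by (subst integral_density) (auto simp: integral_distr)
  finally show ?thesis .
qed

abbreviation gauss :: "'a::euclidean_space \<Rightarrow> real" where
  "gauss x \<equiv> exp (- (norm x)\<^sup>2 / 2)"

lemma cnj_measurable [measurable]: "cnj \<in> borel_measurable borel"
  by (intro borel_measurable_continuous_onI continuous_intros)

section \<open>Comparing norms by comparing Fourier transforms\<close>

definition autocorrelation :: "('a::euclidean_space \<Rightarrow> complex) \<Rightarrow> 'a \<Rightarrow> complex" where
  "autocorrelation f u = (LINT x|lborel. f x * cnj (f (x - u)))"

lemma fourier_measurable [measurable]:
  fixes f :: "'a::euclidean_space \<Rightarrow> complex"
  assumes [measurable]: "f \<in> borel_measurable borel"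
  shows "fourier f \<in> borel_measurable borel"
  unfolding fourier_def by measurable

lemma autocorrelation_measurable [measurable]:
  fixes f :: "'a::euclidean_space \<Rightarrow> complex"
  assumes [measurable]: "f \<in> borel_measurable borel"
  shows "autocorrelation f \<in> borel_measurable borel"
  unfolding autocorrelation_def by measurable

lemma norm_fourier_le:
  "norm (fourier f \<xi>) \<le> (LINT x|lborel. norm (f x))"
  unfolding fourier_def
  by (rule integral_norm_bound[THEN order_trans]) (simp add: norm_mult)

lemma fourier_gauss_scaled:
  fixes u :: "'a::euclidean_space"
  shows "(LINT \<eta>|lborel. gauss \<eta> * cis (((1 / e) *\<^sub>R \<eta>) \<bullet> u)) =
    of_real (sqrt (2 * pi) ^ DIM('a) * gauss ((1 / e) *\<^sub>R u))"
  using gaussian_fourier(2)[of "(1 / e) *\<^sub>R u"]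
  unfolding fourier_def by (simp add: inner_commute mult.commute)

lemma integrable_translate:
  fixes f :: "'a::euclidean_space \<Rightarrow> 'b::{banach, second_countable_topology}"
  assumes "integrable lborel f"
  shows "integrable lborel (\<lambda>x. f (x - u))" "(LINT x|lborel. f (x - u)) = (LINT x|lborel. f x)"
proof -
  have [measurable]: "f \<in> borel_measurable borel" using borel_measurable_integrable[OF assms] by simp
  have "integrable (distr lborel borel ((+) (-u))) f"
    unfolding lborel_distr_plus using assms .
  then show "integrable lborel (\<lambda>x. f (x - u))"
    by (subst (asm) integrable_distr_eq) auto
  have "(LINT x|lborel. f x) = (LINT x|distr lborel borel ((+) (-u)). f x)"
    unfolding lborel_distr_plus ..
  also have "\<dots> = (LINT x|lborel. f (x - u))"
    by (subst integral_distr) auto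
  finally show "(LINT x|lborel. f (x - u)) = (LINT x|lborel. f x)" ..
qed

lemma autocorrelation_bound:
  fixes f :: "'a::euclidean_space \<Rightarrow> complex"
  assumes [measurable]: "f \<in> borel_measurable borel"
    and f2: "integrable lborel (\<lambda>x. (norm (f x))\<^sup>2)"
  shows "integrable lborel (\<lambda>x. f x * cnj (f (x - u)))"
    and "(LINT x|lborel. norm (f x * cnj (f (x - u)))) \<le> (LINT x|lborel. (norm (f x))\<^sup>2)"
    and "norm (autocorrelation f u) \<le> (LINT x|lborel. (norm (f x))\<^sup>2)"
proof -
  note tr = integrable_translate[OF f2, of u]
  have le: "norm (f x * cnj (f (x - u))) \<le> (1 / 2) * ((norm (f x))\<^sup>2 + (norm (f (x - u)))\<^sup>2)" for x
    using sum_squares_bound[of "norm (f x)" "norm (f (x - u))"] by (simp add: norm_mult)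
  have int: "integrable lborel (\<lambda>x. (1 / 2) * ((norm (f x))\<^sup>2 + (norm (f (x - u)))\<^sup>2))"
    using f2 tr by auto
  show i: "integrable lborel (\<lambda>x. f x * cnj (f (x - u)))"
    by (rule Bochner_Integration.integrable_bound[OF int]) (use le in auto)
  have "(LINT x|lborel. norm (f x * cnj (f (x - u)))) \<le>
      (LINT x|lborel. (1 / 2) * ((norm (f x))\<^sup>2 + (norm (f (x - u)))\<^sup>2))"
    using integrable_norm[OF i] int le by (rule Bochner_Integration.integral_mono)
  also have "\<dots> = (LINT x|lborel. (norm (f x))\<^sup>2)"
    using f2 tr by simp
  finally show *: "(LINT x|lborel. norm (f x * cnj (f (x - u)))) \<le> (LINT x|lborel. (norm (f x))\<^sup>2)" .
  show "norm (autocorrelation f u) \<le> (LINT x|lborel. (norm (f x))\<^sup>2)"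
    unfolding autocorrelation_def by (rule integral_norm_bound[THEN order_trans, OF *])
qed

text \<open>
  Expanding the square gives a double integral of \<open>f x * cnj (f y)\<close> against the Fourier transform of
  the Gaussian at \<open>(x - y) / e\<close>, which is again a Gaussian; the substitution \<open>y = x - e z\<close> then produces
  the autocorrelation.
\<close>

lemma gaussian_energy:
  fixes f :: "'a::euclidean_space \<Rightarrow> complex"
  assumes f1: "integrable lborel f" and f2: "integrable lborel (\<lambda>x. (norm (f x))\<^sup>2)" and e: "e > 0"
  shows "of_real (LINT \<eta>|lborel. gauss \<eta> * (norm (fourier f ((1 / e) *\<^sub>R \<eta>)))\<^sup>2) =
    of_real ((sqrt (2 * pi) * e) ^ DIM('a)) * (LINT z|lborel. gauss z * autocorrelation f (e *\<^sub>R z))"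
proof -
  have [measurable]: "f \<in> borel_measurable borel" using borel_measurable_integrable[OF f1] by simp
  let ?c = "sqrt (2 * pi) ^ DIM('a)"
  have gint: "integrable lborel (\<lambda>x::'a. complex_of_real (gauss x))"
    using gaussian_fourier(1) by (intro integrable_of_real)
  have cf1: "integrable lborel (\<lambda>x. cnj (f x))" using f1 by simp
  have ff: "integrable (lborel \<Otimes>\<^sub>M lborel) (\<lambda>(x, y). f x * cnj (f y))"
    by (rule integrable_prod_lborel[OF f1 cf1])
  define H where "H = (\<lambda>(\<eta>::'a) (p :: 'a \<times> 'a). complex_of_real (gauss \<eta>) *
      (cis (((1 / e) *\<^sub>R \<eta>) \<bullet> (fst p - snd p)) * (f (fst p) * cnj (f (snd p)))))"
  have H0: "integrable (lborel \<Otimes>\<^sub>M lborel) (\<lambda>(\<eta>::'a, p). complex_of_real (gauss \<eta>) * (f (fst p) * cnj (f (snd p))))"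
    using integrable_prod_lborel[OF gint ff[unfolded lborel_prod]]
    by (simp add: case_prod_unfold)
  have [measurable]: "(fst :: 'a \<times> 'a \<Rightarrow> 'a) \<in> borel_measurable borel" "(snd :: 'a \<times> 'a \<Rightarrow> 'a) \<in> borel_measurable borel"
    by (intro borel_measurable_continuous_onI continuous_intros)+
  have Hm: "(\<lambda>(\<eta>, p). H \<eta> p) \<in> borel_measurable (lborel \<Otimes>\<^sub>M lborel)"
    unfolding H_def by measurable
  have Hint: "integrable (lborel \<Otimes>\<^sub>M lborel) (\<lambda>(\<eta>, p). H \<eta> p)"
    by (rule Bochner_Integration.integrable_bound[OF H0])
       (use Hm in \<open>auto simp: H_def norm_mult case_prod_unfold\<close>)
  \<comment> \<open>With all integrands collected in \<open>H\<close>, the integral over the frequency \<open>\<eta>\<close> can be taken first.\<close>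
  have sq: "complex_of_real (gauss \<eta> * (norm (fourier f ((1 / e) *\<^sub>R \<eta>)))\<^sup>2) = (LINT p|lborel. H \<eta> p)" for \<eta>
  proof -
    let ?\<xi> = "(1 / e) *\<^sub>R \<eta>"
    have i1: "integrable lborel (\<lambda>x. cis (?\<xi> \<bullet> x) * f x)" by (rule integrable_cis_mult[OF f1])
    then have i2: "integrable lborel (\<lambda>x. cnj (cis (?\<xi> \<bullet> x) * f x))" by (rule integrable_cnj)
    have char: "cis (?\<xi> \<bullet> x) * f x * cnj (cis (?\<xi> \<bullet> y) * f y) = cis (?\<xi> \<bullet> (x - y)) * (f x * cnj (f y))" for x y
      using cis_mult[of "?\<xi> \<bullet> x" "- (?\<xi> \<bullet> y)"]
      by (simp add: cis_cnj inner_diff_right diff_divide_distrib mult_ac)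
    have cnjF: "cnj (fourier f ?\<xi>) = (LINT y|lborel. cnj (cis (?\<xi> \<bullet> y) * f y))"
      unfolding fourier_def by (rule Bochner_Integration.integral_cnj[symmetric])
    have "complex_of_real ((norm (fourier f ?\<xi>))\<^sup>2) = fourier f ?\<xi> * cnj (fourier f ?\<xi>)"
      by (simp add: complex_norm_square[symmetric])
    also have "\<dots> = (LINT x|lborel. (LINT y|lborel. (cis (?\<xi> \<bullet> x) * f x) * cnj (cis (?\<xi> \<bullet> y) * f y)))"
      unfolding cnjF unfolding fourier_def by (simp only: integral_mult_left_zero integral_mult_right_zero)
    also have "\<dots> = (LINT p|(lborel \<Otimes>\<^sub>M lborel). (case p of (x, y) \<Rightarrow> (cis (?\<xi> \<bullet> x) * f x) * cnj (cis (?\<xi> \<bullet> y) * f y)))"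
      by (rule lborel_pair.integral_fst) (rule integrable_prod_lborel[OF i1 i2])
    also have "\<dots> = (LINT p|lborel. cis (?\<xi> \<bullet> (fst p - snd p)) * (f (fst p) * cnj (f (snd p))))"
      unfolding lborel_prod
      by (intro Bochner_Integration.integral_cong refl) (simp only: case_prod_unfold char)
    finally show ?thesis
      unfolding H_def by (simp add: of_real_mult)
  qed
  have "complex_of_real (LINT \<eta>|lborel. gauss \<eta> * (norm (fourier f ((1 / e) *\<^sub>R \<eta>)))\<^sup>2) =
      (LINT \<eta>|lborel. LINT p|lborel. H \<eta> p)"
    unfolding sq[symmetric] by (rule integral_complex_of_real[symmetric])
  also have "\<dots> = (LINT p|lborel. LINT \<eta>|lborel. H \<eta> p)"
    by (rule lborel_pair.Fubini_integral[symmetric]) (use Hint in simp)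
  also have "\<dots> = (LINT p|lborel. (LINT \<eta>|lborel. gauss \<eta> * cis (((1 / e) *\<^sub>R \<eta>) \<bullet> (fst p - snd p))) * (f (fst p) * cnj (f (snd p))))"
    unfolding H_def mult.assoc[symmetric] by (simp only: integral_mult_left_zero)
  also have "\<dots> = (LINT p|lborel. of_real ?c * (gauss ((1 / e) *\<^sub>R (fst p - snd p)) * (f (fst p) * cnj (f (snd p)))))"
    unfolding fourier_gauss_scaled by (simp add: mult_ac)
  also have "\<dots> = of_real ?c * (LINT p|lborel. gauss ((1 / e) *\<^sub>R (fst p - snd p)) * (f (fst p) * cnj (f (snd p))))"
    by simp
  also have "(LINT p|lborel. gauss ((1 / e) *\<^sub>R (fst p - snd p)) * (f (fst p) * cnj (f (snd p)))) =
      (LINT x|lborel. LINT y|lborel. gauss ((1 / e) *\<^sub>R (x - y)) * (f x * cnj (f y)))"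
  proof -
    have "integrable (lborel \<Otimes>\<^sub>M lborel) (\<lambda>(x, y). gauss ((1 / e) *\<^sub>R (x - y)) * (f x * cnj (f y)))"
      by (rule Bochner_Integration.integrable_bound[OF ff]) (auto simp: norm_mult mult_left_le_one_le)
    from lborel_pair.integral_fst[OF this] show ?thesis
      by (simp add: lborel_prod case_prod_unfold)
  qed
  also have "\<dots> = (LINT x|lborel. e ^ DIM('a) *\<^sub>R (LINT z|lborel. gauss z * (f x * cnj (f (x - e *\<^sub>R z)))))"
  proof (rule Bochner_Integration.integral_cong[OF refl])
    fix x
    show "(LINT y|lborel. gauss ((1 / e) *\<^sub>R (x - y)) * (f x * cnj (f y))) =
       e ^ DIM('a) *\<^sub>R (LINT z|lborel. gauss z * (f x * cnj (f (x - e *\<^sub>R z))))"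
      using e by (subst lborel_integral_reflect_scale[of e _ x]) auto
  qed
  also have "\<dots> = of_real (e ^ DIM('a)) * (LINT x|lborel. (LINT z|lborel. gauss z * (f x * cnj (f (x - e *\<^sub>R z)))))"
    by (simp add: scaleR_conv_of_real)
  also have "(LINT x|lborel. (LINT z|lborel. gauss z * (f x * cnj (f (x - e *\<^sub>R z))))) =
     (LINT z|lborel. (LINT x|lborel. gauss z * (f x * cnj (f (x - e *\<^sub>R z)))))"
  proof (rule lborel_pair.Fubini_integral)
    show "integrable (lborel \<Otimes>\<^sub>M lborel) (\<lambda>(z, x). complex_of_real (gauss z) * (f x * cnj (f (x - e *\<^sub>R z))))"
    proof (rule lborel_pair.Fubini_integrable)
      have *: "integrable lborel (\<lambda>z::'a. gauss z * (LINT x|lborel. (norm (f x))\<^sup>2))"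
        by (intro integrable_mult_left gaussian_fourier(1))
      show "integrable lborel (\<lambda>z. LINT x|lborel. norm (case (z, x) of (z, x) \<Rightarrow> complex_of_real (gauss z) * (f x * cnj (f (x - e *\<^sub>R z)))))"
      proof (rule Bochner_Integration.integrable_bound[OF *])
        show "(\<lambda>z. LINT x|lborel. norm (case (z, x) of (z, x) \<Rightarrow> complex_of_real (gauss z) * (f x * cnj (f (x - e *\<^sub>R z))))) \<in> borel_measurable lborel"
          by measurable
        show "AE z in lborel. norm (LINT x|lborel. norm (case (z, x) of (z, x) \<Rightarrow> complex_of_real (gauss z) * (f x * cnj (f (x - e *\<^sub>R z)))))
            \<le> norm (gauss z * (LINT x|lborel. (norm (f x))\<^sup>2))"
        proof (intro AE_I2)
          fix z
          have "(LINT x|lborel. norm (complex_of_real (gauss z) * (f x * cnj (f (x - e *\<^sub>R z))))) =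
             gauss z * (LINT x|lborel. norm (f x * cnj (f (x - e *\<^sub>R z))))"
            by (simp add: norm_mult)
          also have "\<dots> \<le> gauss z * (LINT x|lborel. (norm (f x))\<^sup>2)"
            by (intro mult_left_mono autocorrelation_bound f2) auto
          finally show "norm (LINT x|lborel. norm (case (z, x) of (z, x) \<Rightarrow> complex_of_real (gauss z) * (f x * cnj (f (x - e *\<^sub>R z)))))
            \<le> norm (gauss z * (LINT x|lborel. (norm (f x))\<^sup>2))"
            by (simp add: integral_nonneg_AE)
        qed
      qed
      show "AE z in lborel. integrable lborel (\<lambda>x. case (z, x) of (z, x) \<Rightarrow> complex_of_real (gauss z) * (f x * cnj (f (x - e *\<^sub>R z))))"
        using autocorrelation_bound(1)[OF _ f2] by simp
    qed measurable
  qed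
  also have "\<dots> = (LINT z|lborel. gauss z * autocorrelation f (e *\<^sub>R z))"
    unfolding autocorrelation_def by (simp only: integral_mult_right_zero)
  finally show ?thesis by (simp add: power_mult_distrib mult.assoc)
qed

text \<open>
  Both sides of \<open>gaussian_energy\<close> are compared for \<open>f\<close> and \<open>F\<close> at the same \<open>e\<close>.  For \<open>f\<close> the bound of the
  autocorrelation by the squared norm is enough; continuity of \<open>F\<close> is what turns the limit \<open>e \<rightarrow> 0\<close>
  into the full squared norm of \<open>F\<close>.
\<close>

lemma L2_bound_of_fourier_bound:
  fixes f F :: "'a::euclidean_space \<Rightarrow> complex"
  assumes f1: "integrable lborel f" and f2: "integrable lborel (\<lambda>x. (norm (f x))\<^sup>2)"
    and F1: "integrable lborel F" and Fb: "\<And>x. norm (F x) \<le> B" and Fc: "continuous_on UNIV F"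
    and le: "\<And>\<xi>. norm (fourier F \<xi>) \<le> A * norm (fourier f \<xi>)"
  shows "integrable lborel (\<lambda>x. (norm (F x))\<^sup>2)"
    and "(LINT x|lborel. (norm (F x))\<^sup>2) \<le> A\<^sup>2 * (LINT x|lborel. (norm (f x))\<^sup>2)"
proof -
  have [measurable]: "f \<in> borel_measurable borel" "F \<in> borel_measurable borel"
    using borel_measurable_integrable[OF f1] borel_measurable_integrable[OF F1] by simp_all
  have FF: "norm (F x * F y) \<le> B * norm (F x)" for x y
    using mult_right_mono[OF Fb[of y], of "norm (F x)"] by (simp add: norm_mult mult.commute)
  have BF: "integrable lborel (\<lambda>x. B * norm (F x))" using F1 by simp
  show F2: "integrable lborel (\<lambda>x. (norm (F x))\<^sup>2)"
    by (rule Bochner_Integration.integrable_bound[OF BF])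
       (auto simp: power2_eq_square norm_mult abs_mult intro!: mult_right_mono Fb order_trans[OF Fb])
  define S where "S = (LINT x|lborel. (norm (f x))\<^sup>2)"
  define G where "G = (LINT x::'a|lborel. gauss x)"
  have gint: "integrable lborel (gauss :: 'a \<Rightarrow> real)" by (rule gaussian_fourier(1))
  have G: "G > 0"
  proof -
    have "fourier (\<lambda>x::'a. of_real (gauss x)) 0 = of_real G"
      unfolding fourier_def G_def by (simp add: integral_complex_of_real)
    then have "complex_of_real G = of_real (sqrt (2 * pi) ^ DIM('a))"
      unfolding gaussian_fourier(2) by simp
    then have "G = sqrt (2 * pi) ^ DIM('a)" using of_real_eq_iff by blast
    then show ?thesis by simp
  qed
  have gauss_auto: "integrable lborel (\<lambda>z. gauss z * autocorrelation h (e *\<^sub>R z))"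
    if [measurable]: "h \<in> borel_measurable borel" and "integrable lborel (\<lambda>x. (norm (h x))\<^sup>2)"
    for h :: "'a \<Rightarrow> complex" and e
    by (rule Bochner_Integration.integrable_bound
          [OF integrable_mult_left[OF gint, of "LINT x|lborel. (norm (h x))\<^sup>2"]])
       (auto simp: norm_mult abs_mult intro!: mult_left_mono order_trans[OF autocorrelation_bound(3)] that)
  have fbd: "integrable lborel (\<lambda>\<eta>. gauss \<eta> * (norm (fourier h ((1 / e) *\<^sub>R \<eta>)))\<^sup>2)"
    if h: "integrable lborel h" for h :: "'a \<Rightarrow> complex" and e
  proof -
    have [measurable]: "h \<in> borel_measurable borel"
      using borel_measurable_integrable[OF h] by simp
    show ?thesis
      by (rule Bochner_Integration.integrable_bound
          [OF integrable_mult_left[OF gint, of "(LINT x|lborel. norm (h x))\<^sup>2"]])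
         (auto simp: abs_mult intro!: mult_left_mono power_mono norm_fourier_le h)
  qed
  have step: "norm (LINT z|lborel. gauss z * autocorrelation F (e *\<^sub>R z)) \<le> A\<^sup>2 * S * G" if e: "e > 0" for e
  proof -
    let ?k = "(sqrt (2 * pi) * e) ^ DIM('a)"
    have k: "?k > 0" using e by simp
    then have nk: "norm (complex_of_real ?k) = ?k" unfolding norm_of_real by linarith
    have "?k * norm (LINT z|lborel. gauss z * autocorrelation F (e *\<^sub>R z)) =
       norm (complex_of_real (LINT \<eta>|lborel. gauss \<eta> * (norm (fourier F ((1 / e) *\<^sub>R \<eta>)))\<^sup>2))"
      unfolding gaussian_energy[OF F1 F2 e] norm_mult nk ..
    also have "\<dots> = (LINT \<eta>|lborel. gauss \<eta> * (norm (fourier F ((1 / e) *\<^sub>R \<eta>)))\<^sup>2)"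
      by (simp add: integral_nonneg_AE)
    also have "\<dots> \<le> (LINT \<eta>|lborel. A\<^sup>2 * (gauss \<eta> * (norm (fourier f ((1 / e) *\<^sub>R \<eta>)))\<^sup>2))"
    proof (intro Bochner_Integration.integral_mono integrable_mult_right fbd f1 F1)
      fix \<eta> :: 'a
      have "(norm (fourier F ((1 / e) *\<^sub>R \<eta>)))\<^sup>2 \<le> (A * norm (fourier f ((1 / e) *\<^sub>R \<eta>)))\<^sup>2"
        by (intro power_mono le) auto
      then show "gauss \<eta> * (norm (fourier F ((1 / e) *\<^sub>R \<eta>)))\<^sup>2 \<le> A\<^sup>2 * (gauss \<eta> * (norm (fourier f ((1 / e) *\<^sub>R \<eta>)))\<^sup>2)"
        by (simp add: power_mult_distrib mult.left_commute)
    qed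
    also have "\<dots> = A\<^sup>2 * norm (complex_of_real (LINT \<eta>|lborel. gauss \<eta> * (norm (fourier f ((1 / e) *\<^sub>R \<eta>)))\<^sup>2))"
      by (simp add: integral_nonneg_AE)
    also have "\<dots> = ?k * (A\<^sup>2 * norm (LINT z|lborel. gauss z * autocorrelation f (e *\<^sub>R z)))"
      unfolding gaussian_energy[OF f1 f2 e] norm_mult nk by simp
    finally have "norm (LINT z|lborel. gauss z * autocorrelation F (e *\<^sub>R z)) \<le>
        A\<^sup>2 * norm (LINT z|lborel. gauss z * autocorrelation f (e *\<^sub>R z))"
      using k by simp
    also have "norm (LINT z|lborel. gauss z * autocorrelation f (e *\<^sub>R z)) \<le> (LINT z::'a|lborel. gauss z * S)"
      by (rule order_trans[OF integral_norm_bound],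
          rule Bochner_Integration.integral_mono[OF integrable_norm[OF gauss_auto] integrable_mult_left[OF gint]])
         (auto simp: norm_mult f2 S_def gint intro!: autocorrelation_bound)
    also have "(LINT z::'a|lborel. gauss z * S) = S * G"
      by (simp add: G_def)
    finally show ?thesis by (simp add: mult_left_mono mult.assoc)
  qed
  have "(\<lambda>n. LINT z|lborel. gauss z * autocorrelation F ((1 / Suc n) *\<^sub>R z)) \<longlonglongrightarrow>
      (LINT z::'a|lborel. gauss z * autocorrelation F 0)"
  proof (rule integral_dominated_convergence)
    show "integrable lborel (\<lambda>z::'a. gauss z * (LINT x|lborel. (norm (F x))\<^sup>2))"
      using gint by simp
    show "AE z in lborel. (\<lambda>n. gauss z * autocorrelation F ((1 / Suc n) *\<^sub>R z)) \<longlonglongrightarrow> gauss z * autocorrelation F (0 :: 'a)"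
    proof (intro AE_I2 tendsto_intros)
      fix z :: 'a
      show "(\<lambda>n. autocorrelation F ((1 / Suc n) *\<^sub>R z)) \<longlonglongrightarrow> autocorrelation F 0"
        unfolding autocorrelation_def
      proof (rule integral_dominated_convergence)
        show "AE x in lborel. norm (F x * cnj (F (x - (1 / Suc n) *\<^sub>R z))) \<le> B * norm (F x)" for n
          using FF by (simp add: norm_mult)
        show "AE x in lborel. (\<lambda>n. F x * cnj (F (x - (1 / Suc n) *\<^sub>R z))) \<longlonglongrightarrow> F x * cnj (F (x - 0))"
        proof (intro AE_I2 tendsto_intros)
          fix x
          have "(\<lambda>n. x - (1 / Suc n) *\<^sub>R z) \<longlonglongrightarrow> x - 0 *\<^sub>R z"
            by (intro tendsto_intros LIMSEQ_Suc[OF lim_1_over_n])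
          then have "(\<lambda>n. x - (1 / Suc n) *\<^sub>R z) \<longlonglongrightarrow> x - 0" by simp
          moreover have "isCont F (x - 0)" using Fc by (simp add: continuous_on_eq_continuous_at)
          ultimately show "(\<lambda>n. F (x - (1 / Suc n) *\<^sub>R z)) \<longlonglongrightarrow> F (x - 0)"
            by (rule isCont_tendsto_compose[rotated])
        qed
      qed (use BF in auto)
    qed
    show "AE z in lborel. norm (gauss z * autocorrelation F ((1 / Suc n) *\<^sub>R z)) \<le> gauss z * (LINT x|lborel. (norm (F x))\<^sup>2)" for n
      by (intro AE_I2) (auto simp: norm_mult intro!: autocorrelation_bound F2)
  qed auto
  then have lim: "norm (LINT z::'a|lborel. gauss z * autocorrelation F 0) \<le> A\<^sup>2 * S * G"
    by (rule LIMSEQ_le_const2[OF tendsto_norm]) (use step in auto)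
  have "(LINT z::'a|lborel. gauss z * autocorrelation F 0) = of_real (G * (LINT x|lborel. (norm (F x))\<^sup>2))"
  proof -
    have "autocorrelation F 0 = of_real (LINT x|lborel. (norm (F x))\<^sup>2)"
      unfolding autocorrelation_def integral_complex_of_real[symmetric]
      by (intro Bochner_Integration.integral_cong) (auto simp: complex_norm_square[symmetric])
    then show ?thesis by (simp add: G_def integral_complex_of_real)
  qed
  from lim[unfolded this norm_of_real] have "G * (LINT x|lborel. (norm (F x))\<^sup>2) \<le> G * (A\<^sup>2 * S)"
    by (simp only: abs_le_iff mult.commute)
  then show "(LINT x|lborel. (norm (F x))\<^sup>2) \<le> A\<^sup>2 * (LINT x|lborel. (norm (f x))\<^sup>2)"
    using G unfolding S_def by simp
qed

section \<open>Convolution with a bounded kernel of compact support\<close>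

lemma distr_lborel_reflect:
  fixes x :: "'a::euclidean_space"
  shows "distr lborel borel (\<lambda>y. x - y) = lborel"
proof -
  have "lborel = density (distr lborel borel (\<lambda>y. x + (- 1) *\<^sub>R y)) (\<lambda>_. \<bar>- 1 :: real\<bar> ^ DIM('a))"
    by (rule lborel_affine) auto
  then show ?thesis by (simp add: density_1)
qed

lemma AE_lborel_reflect:
  fixes x :: "'a::euclidean_space"
  assumes "AE u in lborel. P u"
  shows "AE y in lborel. P (x - y)"
proof -
  obtain N where N: "N \<in> null_sets lborel" "{u \<in> space lborel. \<not> P u} \<subseteq> N"
    using assms by (auto simp: eventually_ae_filter)
  have "emeasure lborel N = emeasure (distr lborel borel (\<lambda>y. x - y)) N"
    by (simp add: distr_lborel_reflect)
  also have "\<dots> = emeasure lborel ((\<lambda>y. x - y) -` N)"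
    using N(1) by (subst emeasure_distr) auto
  finally have "(\<lambda>y. x - y) -` N \<in> null_sets lborel"
    using N(1) measurable_sets_borel[of "\<lambda>y. x - y" borel N] by (auto simp: null_sets_def)
  then show ?thesis
    by (rule AE_I') (use N(2) in auto)
qed

lemma integrable_reflect:
  fixes f :: "'a::euclidean_space \<Rightarrow> 'b::{banach, second_countable_topology}"
  assumes "integrable lborel f"
  shows "integrable lborel (\<lambda>y. f (x - y))"
proof -
  have [measurable]: "f \<in> borel_measurable borel" using borel_measurable_integrable[OF assms] by simp
  have "integrable (distr lborel borel (\<lambda>y. x - y)) f"
    unfolding distr_lborel_reflect using assms .
  then show ?thesis by (subst (asm) integrable_distr_eq) auto
qed

lemma convolution_integrable_fourier:
  fixes k f :: "'a::euclidean_space \<Rightarrow> complex"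
  assumes k: "integrable lborel k" and f: "integrable lborel f"
  shows "integrable lborel (\<lambda>x. LINT y|lborel. k (x - y) * f y)"
    and "fourier (\<lambda>x. LINT y|lborel. k (x - y) * f y) \<xi> = fourier k \<xi> * fourier f \<xi>"
proof -
  have [measurable]: "f \<in> borel_measurable borel" "k \<in> borel_measurable borel"
    using borel_measurable_integrable[OF f] borel_measurable_integrable[OF k] by simp_all
  have int: "integrable (lborel \<Otimes>\<^sub>M lborel) (\<lambda>(y, x). k (x - y) * f y)"
  proof (rule lborel_pair.Fubini_integrable)
    have "(LINT x|lborel. norm (k (x - y) * f y)) = (LINT x|lborel. norm (k x)) * norm (f y)" for y
      using integrable_translate(2)[OF integrable_norm[OF k], of y] by (simp add: norm_mult)
    then show "integrable lborel (\<lambda>y. LINT x|lborel. norm (case (y, x) of (y, x) \<Rightarrow> k (x - y) * f y))"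
      using f by simp
    show "AE y in lborel. integrable lborel (\<lambda>x. case (y, x) of (y, x) \<Rightarrow> k (x - y) * f y)"
      using integrable_translate(1)[OF k] by simp
  qed measurable
  show "integrable lborel (\<lambda>x. LINT y|lborel. k (x - y) * f y)"
    using lborel_pair.integrable_snd[OF int] .
  have int2: "integrable (lborel \<Otimes>\<^sub>M lborel) (\<lambda>(y, x). cis (\<xi> \<bullet> x) * (k (x - y) * f y))"
    by (rule Bochner_Integration.integrable_bound[OF int]) (auto simp: norm_mult)
  have "fourier (\<lambda>x. LINT y|lborel. k (x - y) * f y) \<xi> =
      (LINT x|lborel. LINT y|lborel. cis (\<xi> \<bullet> x) * (k (x - y) * f y))"
    unfolding fourier_def by simp
  also have "\<dots> = (LINT y|lborel. LINT x|lborel. cis (\<xi> \<bullet> x) * (k (x - y) * f y))"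
    by (rule lborel_pair.Fubini_integral) (use int2 in simp)
  also have "\<dots> = (LINT y|lborel. fourier k \<xi> * (cis (\<xi> \<bullet> y) * f y))"
  proof (rule Bochner_Integration.integral_cong[OF refl])
    fix y
    have "(LINT x|lborel. cis (\<xi> \<bullet> x) * (k (x - y) * f y)) =
       (LINT x|lborel. (\<lambda>x. cis (\<xi> \<bullet> x) * k x) (x - y) * (cis (\<xi> \<bullet> y) * f y))"
      by (intro Bochner_Integration.integral_cong refl)
         (simp add: inner_diff_right cis_divide[symmetric])
    also have "\<dots> = fourier k \<xi> * (cis (\<xi> \<bullet> y) * f y)"
      unfolding integral_mult_left_zero fourier_def
      by (subst integrable_translate(2)[OF integrable_cis_mult[OF k]]) simp
    finally show "(LINT x|lborel. cis (\<xi> \<bullet> x) * (k (x - y) * f y)) = fourier k \<xi> * (cis (\<xi> \<bullet> y) * f y)" .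
  qed
  finally show "fourier (\<lambda>x. LINT y|lborel. k (x - y) * f y) \<xi> = fourier k \<xi> * fourier f \<xi>"
    unfolding fourier_def by simp
qed

text \<open>
  Jumps of the kernel on a null set do no harm, since the translates of the kernel still converge for
  almost every argument of \<open>f\<close> and are dominated.
\<close>

lemma convolution_continuous:
  fixes k f :: "'a::euclidean_space \<Rightarrow> complex"
  assumes [measurable]: "k \<in> borel_measurable borel" and kb: "\<And>x. norm (k x) \<le> M"
    and kc: "AE u in lborel. isCont k u" and f: "integrable lborel f"
  shows "continuous_on UNIV (\<lambda>x. LINT y|lborel. k (x - y) * f y)"
    and "norm (LINT y|lborel. k (x - y) * f y) \<le> M * (LINT y|lborel. norm (f y))"
proof -
  have [measurable]: "f \<in> borel_measurable borel"
    using borel_measurable_integrable[OF f] by simp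
  have dom: "integrable lborel (\<lambda>y. M * norm (f y))" using f by simp
  have le: "norm (k (x - y) * f y) \<le> M * norm (f y)" for x y
    by (simp add: norm_mult mult_right_mono kb)
  have "isCont (\<lambda>x. LINT y|lborel. k (x - y) * f y) x" for x
    unfolding continuous_at_sequentially comp_def
  proof (intro allI impI)
    fix X assume X: "X \<longlonglongrightarrow> x"
    show "(\<lambda>n. LINT y|lborel. k (X n - y) * f y) \<longlonglongrightarrow> (LINT y|lborel. k (x - y) * f y)"
    proof (rule integral_dominated_convergence[OF _ _ dom])
      show "AE y in lborel. (\<lambda>n. k (X n - y) * f y) \<longlonglongrightarrow> k (x - y) * f y"
        using AE_lborel_reflect[OF kc, of x]
      proof eventually_elim
        fix y assume "isCont k (x - y)"
        moreover have "(\<lambda>n. X n - y) \<longlonglongrightarrow> x - y" by (intro tendsto_intros X)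
        ultimately show "(\<lambda>n. k (X n - y) * f y) \<longlonglongrightarrow> k (x - y) * f y"
          by (intro tendsto_mult tendsto_const) (rule isCont_tendsto_compose)
      qed
    qed (use le in auto)
  qed
  then show "continuous_on UNIV (\<lambda>x. LINT y|lborel. k (x - y) * f y)"
    by (simp add: continuous_on_eq_continuous_at)
  have "norm (LINT y|lborel. k (x - y) * f y) \<le> (LINT y|lborel. norm (k (x - y) * f y))"
    by (rule integral_norm_bound)
  also have "\<dots> \<le> (LINT y|lborel. M * norm (f y))"
    by (intro Bochner_Integration.integral_mono dom integrable_norm
         Bochner_Integration.integrable_bound[OF dom] le AE_I2) (auto intro: order_trans[OF le abs_ge_self])
  finally show "norm (LINT y|lborel. k (x - y) * f y) \<le> M * (LINT y|lborel. norm (f y))" by simp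
qed

lemma integrable_bounded_support:
  fixes k :: "'a::euclidean_space \<Rightarrow> 'b::{banach, second_countable_topology}"
  assumes [measurable]: "k \<in> borel_measurable borel" and kb: "\<And>x. norm (k x) \<le> M"
    and ks: "\<And>x. R < norm x \<Longrightarrow> k x = 0"
  shows "integrable lborel k"
proof (rule Bochner_Integration.integrable_bound)
  show "integrable lborel (\<lambda>x::'a. M * indicator (cball 0 R) x :: real)"
    using emeasure_lborel_cball_finite[of "0::'a" R] by (intro integrable_mult_right) (simp add: integrable_indicator_iff less_top)
  have "0 \<le> M" using order_trans[OF norm_ge_zero kb[of 0]] .
  then show "AE x in lborel. norm (k x) \<le> norm (M * indicator (cball 0 R) x :: real)"
    by (intro AE_I2) (use kb ks in \<open>auto simp: indicator_def\<close>)
qed simp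

text \<open>
  The comparison of norms needs integrable functions, so \<open>f\<close> is first cut off to balls; Fatou's lemma
  passes to the limit.
\<close>

lemma convolution_L2_bound_borel:
  fixes k f :: "'a::euclidean_space \<Rightarrow> complex"
  assumes [measurable]: "k \<in> borel_measurable borel" and kb: "\<And>x. norm (k x) \<le> M"
    and ks: "\<And>x. R < norm x \<Longrightarrow> k x = 0"
    and kc: "AE u in lborel. isCont k u"
    and kA: "\<And>\<xi>. norm (fourier k \<xi>) \<le> A"
    and [measurable]: "f \<in> borel_measurable borel"
    and f2: "integrable lborel (\<lambda>x. (norm (f x))\<^sup>2)"
  defines "F \<equiv> \<lambda>x. LINT y|lborel. k (x - y) * f y"
  shows "integrable lborel (\<lambda>y. k (x - y) * f y)"
    and "integrable lborel (\<lambda>x. (norm (F x))\<^sup>2)"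
    and "(LINT x|lborel. (norm (F x))\<^sup>2) \<le> A\<^sup>2 * (LINT x|lborel. (norm (f x))\<^sup>2)"
proof -
  have k1: "integrable lborel k" by (rule integrable_bounded_support) (use kb ks in auto)
  have k2: "integrable lborel (\<lambda>x. (norm (k x))\<^sup>2)"
    by (rule integrable_bounded_support[where M="M\<^sup>2" and R=R]) (use kb ks in \<open>auto intro: power_mono\<close>)
  have kf: "integrable lborel (\<lambda>y. k (x - y) * f y)" for x
  proof (rule Bochner_Integration.integrable_bound)
    show "integrable lborel (\<lambda>y. (norm (k (x - y)))\<^sup>2 + (norm (f y))\<^sup>2)"
      using integrable_reflect[OF k2] f2 by auto
    have "norm (k (x - y) * f y) \<le> (norm (k (x - y)))\<^sup>2 + (norm (f y))\<^sup>2" for y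
      using sum_squares_bound[of "norm (k (x - y))" "norm (f y)"] norm_ge_zero[of "k (x - y) * f y"]
      unfolding norm_mult by linarith
    then show "AE y in lborel. norm (k (x - y) * f y) \<le> norm ((norm (k (x - y)))\<^sup>2 + (norm (f y))\<^sup>2)"
      by simp
  qed simp
  then show "integrable lborel (\<lambda>y. k (x - y) * f y)" .
  define g where "g = (\<lambda>n::nat. \<lambda>y. indicator (cball 0 (real n)) y *\<^sub>R f y)"
  have [measurable]: "cball (0::'a) r \<in> sets borel" for r by simp
  have [measurable]: "g n \<in> borel_measurable borel" for n
    unfolding g_def by measurable
  have gf: "norm (g n y) \<le> norm (f y)" for n y
    by (auto simp: g_def indicator_def)
  have g2: "integrable lborel (\<lambda>x. (norm (g n x))\<^sup>2)" for n
    by (rule Bochner_Integration.integrable_bound[OF f2]) (use gf in \<open>auto intro: power_mono\<close>)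
  have g1: "integrable lborel (g n)" for n
  proof (rule Bochner_Integration.integrable_bound)
    have "integrable lborel (\<lambda>x::'a. indicator (cball 0 (real n)) x :: real)"
      using emeasure_lborel_cball_finite[of "0::'a" "real n"] by (simp add: integrable_indicator_iff less_top)
    then show "integrable lborel (\<lambda>x. (norm (f x))\<^sup>2 + indicator (cball 0 (real n)) x)"
      using f2 by auto
    have "norm (f x) \<le> (norm (f x))\<^sup>2 + 1" for x
      using sum_squares_bound[of "norm (f x)" 1] by (smt (verit) norm_ge_zero one_power2)
    then show "AE x in lborel. norm (g n x) \<le> norm ((norm (f x))\<^sup>2 + indicator (cball 0 (real n)) x)"
      by (auto simp: g_def indicator_def)
  qed simp
  define H where "H = (\<lambda>n x. LINT y|lborel. k (x - y) * g n y)"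
  have [measurable]: "H n \<in> borel_measurable borel" for n
    unfolding H_def by measurable
  have Fm [measurable]: "F \<in> borel_measurable borel"
    unfolding F_def by measurable
  have H: "integrable lborel (\<lambda>x. (norm (H n x))\<^sup>2) \<and> (LINT x|lborel. (norm (H n x))\<^sup>2) \<le> A\<^sup>2 * (LINT x|lborel. (norm (f x))\<^sup>2)" for n
  proof -
    have le: "norm (fourier (H n) \<xi>) \<le> A * norm (fourier (g n) \<xi>)" for \<xi>
      unfolding H_def convolution_integrable_fourier(2)[OF k1 g1] norm_mult
      by (intro mult_right_mono kA) auto
    have "integrable lborel (H n)"
      unfolding H_def by (rule convolution_integrable_fourier(1)[OF k1 g1])
    moreover have "norm (H n x) \<le> M * (LINT y|lborel. norm (g n y))" for x
      unfolding H_def by (rule convolution_continuous(2)[OF _ kb kc g1]) simp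
    moreover have "continuous_on UNIV (H n)"
      unfolding H_def by (rule convolution_continuous(1)[OF _ kb kc g1]) simp
    ultimately have *: "integrable lborel (\<lambda>x. (norm (H n x))\<^sup>2)"
        "(LINT x|lborel. (norm (H n x))\<^sup>2) \<le> A\<^sup>2 * (LINT x|lborel. (norm (g n x))\<^sup>2)"
      using L2_bound_of_fourier_bound[OF g1 g2 _ _ _ le] by blast+
    have "(LINT x|lborel. (norm (g n x))\<^sup>2) \<le> (LINT x|lborel. (norm (f x))\<^sup>2)"
      by (intro Bochner_Integration.integral_mono g2 f2 power_mono gf) auto
    then have "A\<^sup>2 * (LINT x|lborel. (norm (g n x))\<^sup>2) \<le> A\<^sup>2 * (LINT x|lborel. (norm (f x))\<^sup>2)"
      by (intro mult_left_mono) auto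
    then show ?thesis using * by (auto intro: order_trans)
  qed
  have lim: "(\<lambda>n. H n x) \<longlonglongrightarrow> F x" for x
    unfolding H_def F_def
  proof (rule integral_dominated_convergence)
    show "AE y in lborel. (\<lambda>n. k (x - y) * g n y) \<longlonglongrightarrow> k (x - y) * f y"
    proof (intro AE_I2 tendsto_intros)
      fix y
      have "\<forall>\<^sub>F n in sequentially. g n y = f y"
        using eventually_ge_at_top[of "nat \<lceil>norm y\<rceil>"]
        by eventually_elim (auto simp: g_def indicator_def nat_le_iff ceiling_le_iff)
      then show "(\<lambda>n. g n y) \<longlonglongrightarrow> f y" by (rule tendsto_eventually)
    qed
    show "integrable lborel (\<lambda>y. norm (k (x - y) * f y))" using kf by (rule integrable_norm)
    show "AE y in lborel. norm (k (x - y) * g n y) \<le> norm (k (x - y) * f y)" for n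
      by (auto simp: norm_mult intro!: mult_left_mono gf)
  qed auto
  define S where "S = A\<^sup>2 * (LINT x|lborel. (norm (f x))\<^sup>2)"
  have S0: "0 \<le> S" by (simp add: S_def integral_nonneg_AE)
  have "(\<integral>\<^sup>+x. ennreal ((norm (F x))\<^sup>2) \<partial>lborel) = (\<integral>\<^sup>+x. liminf (\<lambda>n. ennreal ((norm (H n x))\<^sup>2)) \<partial>lborel)"
  proof (rule nn_integral_cong)
    fix x
    have "(\<lambda>n. ennreal ((norm (H n x))\<^sup>2)) \<longlonglongrightarrow> ennreal ((norm (F x))\<^sup>2)"
      by (intro tendsto_intros lim)
    from lim_imp_Liminf[OF _ this]
    show "ennreal ((norm (F x))\<^sup>2) = liminf (\<lambda>n. ennreal ((norm (H n x))\<^sup>2))" by simp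
  qed
  also have "\<dots> \<le> liminf (\<lambda>n. \<integral>\<^sup>+x. ennreal ((norm (H n x))\<^sup>2) \<partial>lborel)"
    by (rule nn_integral_liminf) simp
  also have "\<dots> \<le> ennreal S"
  proof -
    have "(\<integral>\<^sup>+x. ennreal ((norm (H n x))\<^sup>2) \<partial>lborel) \<le> ennreal S" for n
      using H[of n] by (subst nn_integral_eq_integral) (auto simp: S_def intro: ennreal_leI)
    then show ?thesis by (intro Liminf_le) auto
  qed
  finally have nn: "(\<integral>\<^sup>+x. ennreal ((norm (F x))\<^sup>2) \<partial>lborel) \<le> ennreal S" .
  show i: "integrable lborel (\<lambda>x. (norm (F x))\<^sup>2)"
    by (rule integrableI_bounded) (use nn in \<open>auto simp: less_top[symmetric] top_unique intro: le_less_trans\<close>)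
  show "(LINT x|lborel. (norm (F x))\<^sup>2) \<le> A\<^sup>2 * (LINT x|lborel. (norm (f x))\<^sup>2)"
    using nn S0 by (subst (asm) nn_integral_eq_integral[OF i]) (auto simp: S_def)
qed

lemma lebesgue_ex_borel_complex:
  fixes f :: "'a::euclidean_space \<Rightarrow> complex"
  assumes [measurable]: "f \<in> borel_measurable lebesgue"
  obtains g where "g \<in> borel_measurable borel" "AE x in lborel. f x = g x"
proof -
  have "(\<lambda>x. Re (f x)) \<in> borel_measurable lebesgue" "(\<lambda>x. Im (f x)) \<in> borel_measurable lebesgue"
    by measurable
  then obtain u v where u: "u \<in> borel_measurable lborel" "AE x in lborel. Re (f x) = u x"
    and v: "v \<in> borel_measurable lborel" "AE x in lborel. Im (f x) = v x"
    by (metis completion_ex_borel_measurable_real)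
  have [measurable]: "u \<in> borel_measurable borel" "v \<in> borel_measurable borel" using u v by auto
  have "AE x in lborel. f x = of_real (u x) + \<i> * of_real (v x)"
    using u(2) v(2) by eventually_elim (simp add: complex_eq_iff)
  moreover have "(\<lambda>x. of_real (u x) + \<i> * of_real (v x)) \<in> borel_measurable borel" by measurable
  ultimately show ?thesis using that by blast
qed

lemma lebesgue_integral_AE_borel:
  fixes f g :: "'a::euclidean_space \<Rightarrow> 'b::{banach, second_countable_topology}"
  assumes fl: "f \<in> borel_measurable lebesgue"
    and g [measurable]: "g \<in> borel_measurable borel" and eq: "AE x in lborel. f x = g x"
  shows "integrable lebesgue f \<longleftrightarrow> integrable lborel g" and "(LINT x|lebesgue. f x) = (LINT x|lborel. g x)"
proof -
  have eq': "AE x in lebesgue. f x = g x" by (rule AE_completion[OF eq])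
  have gl: "g \<in> borel_measurable lebesgue" by (rule measurable_completion) simp
  show "integrable lebesgue f \<longleftrightarrow> integrable lborel g"
    using integrable_cong_AE[OF fl gl eq'] by (simp add: integrable_completion)
  show "(LINT x|lebesgue. f x) = (LINT x|lborel. g x)"
    using integral_cong_AE[OF fl gl eq'] by (simp add: integral_completion)
qed

theorem convolution_L2_bound:
  fixes k f :: "'a::euclidean_space \<Rightarrow> complex"
  assumes km [measurable]: "k \<in> borel_measurable borel" and kb: "\<And>x. norm (k x) \<le> M"
    and ks: "\<And>x. R < norm x \<Longrightarrow> k x = 0"
    and kc: "AE u in lborel. isCont k u"
    and kA: "\<And>\<xi>. norm (fourier k \<xi>) \<le> A"
    and f: "L2_fun f"
  shows "integrable lebesgue (\<lambda>y. k (x - y) * f y)"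
    and "L2_fun (convolution k f)"
    and "L2_norm (convolution k f) \<le> A * L2_norm f"
proof -
  have fm: "f \<in> borel_measurable lebesgue" and f2: "integrable lebesgue (\<lambda>x. (norm (f x))\<^sup>2)"
    using f by (auto simp: L2_fun_def)
  obtain g where g [measurable]: "g \<in> borel_measurable borel" and fg: "AE x in lborel. f x = g x"
    using lebesgue_ex_borel_complex[OF fm] .
  have fg2: "AE x in lborel. (norm (f x))\<^sup>2 = (norm (g x))\<^sup>2" using fg by eventually_elim simp
  note sq = lebesgue_integral_AE_borel[OF _ _ fg2]
  have fm2: "(\<lambda>x. (norm (f x))\<^sup>2) \<in> borel_measurable lebesgue" using fm by measurable
  have g2: "integrable lborel (\<lambda>x. (norm (g x))\<^sup>2)" using f2 sq(1)[OF fm2] by simp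
  note main = convolution_L2_bound_borel[OF km kb ks kc kA g g2]
  have kfg: "AE y in lborel. k (x - y) * f y = k (x - y) * g y" for x using fg by eventually_elim simp
  have "(\<lambda>y. k (x - y)) \<in> borel_measurable lebesgue" for x
    by (rule measurable_completion) simp
  then have kfm: "(\<lambda>y. k (x - y) * f y) \<in> borel_measurable lebesgue" for x
    using fm by measurable
  note kfg' = lebesgue_integral_AE_borel[OF kfm _ kfg]
  show "integrable lebesgue (\<lambda>y. k (x - y) * f y)"
    by (subst kfg'(1)) (use main(1) in auto)
  have conv: "convolution k f = (\<lambda>x. LINT y|lborel. k (x - y) * g y)"
    unfolding convolution_def by (intro ext kfg'(2)) simp
  have cm [measurable]: "convolution k f \<in> borel_measurable borel" unfolding conv by measurable
  have c2: "integrable lborel (\<lambda>x. (norm (convolution k f x))\<^sup>2)"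
    using main(2) unfolding conv .
  show "L2_fun (convolution k f)"
    unfolding L2_fun_def using c2 measurable_completion[of "convolution k f" lborel borel]
    by (simp add: integrable_completion)
  have A: "A \<ge> 0" using order_trans[OF norm_ge_zero kA] .
  have "L2_norm (convolution k f) = sqrt (LINT x|lborel. (norm (convolution k f x))\<^sup>2)"
    unfolding L2_norm_def by (simp add: integral_completion)
  also have "\<dots> \<le> sqrt (A\<^sup>2 * (LINT x|lborel. (norm (g x))\<^sup>2))"
    using main(3) unfolding conv by (rule real_sqrt_le_mono)
  also have "\<dots> = A * L2_norm f"
    unfolding L2_norm_def using A sq(2)[OF fm2] by (simp add: real_sqrt_mult)
  finally show "L2_norm (convolution k f) \<le> A * L2_norm f" .
qed

section \<open>Oscillatory integrals in one variable\<close>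

lemma even_half_line_integral:
  fixes f :: "real \<Rightarrow> real"
  assumes [measurable]: "f \<in> borel_measurable borel" "S \<in> sets borel"
    and nonneg: "\<And>x. 0 \<le> f x" and S: "S \<subseteq> {0..}" and I: "(f has_integral I) S"
  shows "has_bochner_integral lborel (\<lambda>x. indicator S \<bar>x\<bar> * f \<bar>x\<bar>) (2 * I)"
proof -
  have "((\<lambda>x. indicator S x * f x) has_integral I) UNIV"
    using I unfolding has_integral_restrict_UNIV[of S f, symmetric]
    by (rule has_integral_eq[rotated]) auto
  then have nn: "(\<integral>\<^sup>+x. ennreal (indicator S x * f x) \<partial>lborel) = ennreal I"
    by (intro nn_integral_has_integral_lborel) (auto simp: nonneg)
  have "0 \<le> I" using has_integral_nonneg[OF I] nonneg by auto
  with nn have 1: "has_bochner_integral lborel (\<lambda>x. indicator S x * f x) I"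
    by (intro has_bochner_integral_nn_integral) (auto simp: nonneg)
  from this[THEN iffD1[OF lborel_has_bochner_integral_real_affine_iff[of "-1" _ _ 0], rotated]]
  have 2: "has_bochner_integral lborel (\<lambda>x. indicator S (- x) * f (- x)) I" by simp
  have sum: "has_bochner_integral lborel (\<lambda>x. indicator S x * f x + indicator S (- x) * f (- x)) (2 * I)"
    using has_bochner_integral_add[OF 1 2] by simp
  have "AE x in lborel. indicator S x * f x + indicator S (- x) * f (- x) = indicator S \<bar>x\<bar> * f \<bar>x\<bar>"
    using AE_lborel_singleton[of "0::real"]
  proof eventually_elim
    fix x :: real assume "x \<noteq> 0"
    then consider "x > 0" | "x < 0" by linarith
    then show "indicator S x * f x + indicator S (- x) * f (- x) = indicator S \<bar>x\<bar> * f \<bar>x\<bar>"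
      using S by cases (auto simp: indicator_def)
  qed
  from has_bochner_integral_cong_AE[THEN iffD1, OF _ _ this sum] show ?thesis by simp
qed

lemma tail_integral:
  fixes a \<theta> :: real
  assumes "a > 0" "\<theta> > 0"
  shows "has_bochner_integral lborel (\<lambda>x. indicator {a..} \<bar>x\<bar> * \<bar>x\<bar> powr (- (1 + \<theta>))) (2 * (a powr (- \<theta>) / \<theta>))"
proof (rule even_half_line_integral)
  show "((\<lambda>x. x powr (- (1 + \<theta>))) has_integral a powr (- \<theta>) / \<theta>) {a..}"
    using has_integral_powr_to_inf[of "- (1 + \<theta>)" a] assms by simp
qed (use assms in auto)

lemma origin_integral:
  fixes a \<theta> :: real
  assumes "a > 0" "\<theta> > 0"
  shows "has_bochner_integral lborel (\<lambda>x. indicator {0..a} \<bar>x\<bar> * \<bar>x\<bar> powr (\<theta> - 1)) (2 * (a powr \<theta> / \<theta>))"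
proof (rule even_half_line_integral)
  show "((\<lambda>x. x powr (\<theta> - 1)) has_integral a powr \<theta> / \<theta>) {0..a}"
    using has_integral_powr_from_0[of "\<theta> - 1" a] assms by simp
qed (use assms in auto)

lemma norm_cis_minus_one: "norm (cis t - 1) \<le> \<bar>t\<bar>"
  using iexp_approx1[of t 0] by (simp add: cis_conv_exp)

text \<open>
  The size and Hoelder bounds of a one-dimensional Calderon-Zygmund kernel.
\<close>

definition cz_bound :: "real \<Rightarrow> real \<Rightarrow> (real \<Rightarrow> complex) \<Rightarrow> bool" where
  "cz_bound \<theta> M g \<longleftrightarrow> (\<forall>x. x \<noteq> 0 \<longrightarrow> norm (g x) \<le> M / \<bar>x\<bar>) \<and>
    (\<forall>x h. h \<noteq> 0 \<and> 2 * \<bar>h\<bar> \<le> \<bar>x\<bar> \<longrightarrow> norm (g (x + h) - g x) \<le> M * \<bar>h\<bar> powr \<theta> / \<bar>x\<bar> powr (1 + \<theta>))"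

definition wave :: "real \<Rightarrow> real \<Rightarrow> real \<Rightarrow> real \<Rightarrow> complex" where
  "wave \<epsilon> N \<xi> x = indicator (shell \<epsilon> N) x * cis (\<xi> * x)"

text \<open>
  The part of the shell on which the phase does not exceed a full turn.  At frequency 0 this is the
  whole shell, and nothing oscillates.
\<close>

definition core :: "real \<Rightarrow> real \<Rightarrow> real \<Rightarrow> real \<Rightarrow> complex" where
  "core \<epsilon> N \<xi> x = indicator {x \<in> shell \<epsilon> N. \<bar>\<xi> * x\<bar> \<le> 2 * pi} x"

definition osc :: "real \<Rightarrow> real \<Rightarrow> real \<Rightarrow> real \<Rightarrow> complex" where
  "osc \<epsilon> N \<xi> x = wave \<epsilon> N \<xi> x - core \<epsilon> N \<xi> x"

lemma shell_borel [measurable]: "shell \<epsilon> N \<in> sets borel"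
  unfolding shell_def by measurable

lemma wave_measurable [measurable]: "wave \<epsilon> N \<xi> \<in> borel_measurable borel"
  unfolding wave_def by measurable

lemma core_measurable [measurable]: "core \<epsilon> N \<xi> \<in> borel_measurable borel"
  unfolding core_def by measurable

lemma osc_measurable [measurable]: "osc \<epsilon> N \<xi> \<in> borel_measurable borel"
  unfolding osc_def by measurable

definition osc_const :: "real \<Rightarrow> real" where
  "osc_const \<theta> = 1 / \<theta> + 6 + 4 * pi"

text \<open>
  The shift by \<open>h = pi / \<xi>\<close> changes the sign of the character, so twice the integral equals the
  integral of \<open>G x - G (x + h)\<close>, where \<open>G\<close> is \<open>g\<close> restricted to \<open>L\<close>.  If both points lie in \<open>L\<close>, the
  Hoelder bound applies, because \<open>L\<close> consists of points with \<open>\<bar>x\<bar> > 2 * \<bar>h\<bar>\<close>.  If only one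
  does, then \<open>x\<close> lies within \<open>\<bar>h\<bar>\<close> of one of the six boundary points, and the value of
  \<open>g\<close> at the point in \<open>L\<close> is at most \<open>M / \<bar>h\<bar>\<close>.
\<close>

lemma shift_oscillation:
  fixes g :: "real \<Rightarrow> complex" and \<xi> \<epsilon> N :: real
  assumes [measurable]: "g \<in> borel_measurable borel" and \<theta>: "\<theta> > 0" and M: "M \<ge> 0"
    and g: "cz_bound \<theta> M g" and \<xi>: "\<xi> \<noteq> 0" and \<epsilon>: "\<epsilon> > 0"
  defines "L \<equiv> {x \<in> shell \<epsilon> N. 2 * pi < \<bar>\<xi> * x\<bar>}"
  shows "norm (LINT x|lborel. cis (\<xi> * x) * (indicator L x * g x)) \<le> (1 / \<theta> + 6) * M"
proof -
  have size: "norm (g x) \<le> M / \<bar>x\<bar>" if "x \<noteq> 0" for x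
    using g that unfolding cz_bound_def by blast
  have smooth: "norm (g (x + h) - g x) \<le> M * \<bar>h\<bar> powr \<theta> / \<bar>x\<bar> powr (1 + \<theta>)" if "h \<noteq> 0" "2 * \<bar>h\<bar> \<le> \<bar>x\<bar>" for x h
    using g that unfolding cz_bound_def by blast
  have [measurable]: "L \<in> sets borel" unfolding L_def by measurable
  define h where "h = pi / \<xi>"
  have h: "h \<noteq> 0" "\<bar>h\<bar> > 0" using \<xi> by (auto simp: h_def)
  have L_iff: "x \<in> L \<longleftrightarrow> \<epsilon> \<le> \<bar>x\<bar> \<and> \<bar>x\<bar> \<le> N \<and> 2 * \<bar>h\<bar> < \<bar>x\<bar>" for x
    using \<xi> by (auto simp: L_def shell_def h_def abs_mult field_simps)
  define G where "G = (\<lambda>x. indicator L x * g x :: complex)"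
  have [measurable]: "G \<in> borel_measurable borel" unfolding G_def by measurable
  have G_le: "norm (G x) \<le> M / \<bar>h\<bar>" for x
  proof (cases "x \<in> L")
    case True
    then have "\<bar>h\<bar> \<le> \<bar>x\<bar>" "x \<noteq> 0" using h by (auto simp: L_iff)
    then have "M / \<bar>x\<bar> \<le> M / \<bar>h\<bar>" using M h by (intro divide_left_mono) auto
    then show ?thesis using size[OF \<open>x \<noteq> 0\<close>] True by (simp add: G_def)
  qed (use M in \<open>simp add: G_def\<close>)
  have Gint: "integrable lborel (\<lambda>x. cis (\<xi> * x) * G x)"
    by (rule integrable_bounded_support[of _ "M / \<bar>h\<bar>" N])
       (use G_le in \<open>auto simp: norm_mult G_def L_iff indicator_def\<close>)
  have Gint': "integrable lborel (\<lambda>x. cis (\<xi> * (x + h)) * G (x + h))"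
    and trans: "(LINT x|lborel. cis (\<xi> * (x + h)) * G (x + h)) = (LINT x|lborel. cis (\<xi> * x) * G x)"
    using integrable_translate[OF Gint, of "- h"] by simp_all
  have shift: "cis (\<xi> * (x + h)) = - cis (\<xi> * x)" for x
    using \<xi> by (simp add: h_def distrib_left flip: cis_mult)
  have Gint2: "integrable lborel (\<lambda>x. cis (\<xi> * x) * (G x - G (x + h)))"
    using Bochner_Integration.integrable_add[OF Gint Gint'] unfolding shift by (simp add: algebra_simps)
  have "2 * (LINT x|lborel. cis (\<xi> * x) * G x) =
      (LINT x|lborel. cis (\<xi> * x) * G x) + (LINT x|lborel. cis (\<xi> * (x + h)) * G (x + h))"
    unfolding trans by simp
  also have "\<dots> = (LINT x|lborel. cis (\<xi> * x) * (G x - G (x + h)))"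
    unfolding Bochner_Integration.integral_add[OF Gint Gint', symmetric] unfolding shift
    by (intro Bochner_Integration.integral_cong refl) (simp add: algebra_simps)
  finally have two: "2 * (LINT x|lborel. cis (\<xi> * x) * G x) = (LINT x|lborel. cis (\<xi> * x) * (G x - G (x + h)))" .
  \<comment> \<open>All points \<open>x\<close> such that exactly one of \<open>x\<close> and \<open>x + h\<close> lies in \<open>L\<close> belong to \<open>D\<close>.\<close>
  define D where "D = (\<Union>\<rho>\<in>{\<epsilon>, N, 2 * \<bar>h\<bar>, - \<epsilon>, - N, - (2 * \<bar>h\<bar>)}. cball \<rho> \<bar>h\<bar>)"
  have D_iff: "x \<in> D \<longleftrightarrow> (\<exists>\<rho>\<in>{\<epsilon>, N, 2 * \<bar>h\<bar>, - \<epsilon>, - N, - (2 * \<bar>h\<bar>)}. \<bar>x - \<rho>\<bar> \<le> \<bar>h\<bar>)" for x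
    by (simp add: D_def dist_real_def abs_minus_commute)
  have Dc: "x \<in> D" if "\<bar>\<bar>x\<bar> - \<rho>\<bar> \<le> \<bar>h\<bar>" "\<rho> = \<epsilon> \<or> \<rho> = N \<or> \<rho> = 2 * \<bar>h\<bar>" for x \<rho>
  proof -
    have "\<bar>x - \<rho>\<bar> \<le> \<bar>h\<bar> \<or> \<bar>x - (- \<rho>)\<bar> \<le> \<bar>h\<bar>" using that(1) by linarith
    then show ?thesis unfolding D_iff using that(2) by blast
  qed
  have Dm: "D \<in> fmeasurable lborel" and Dmeas: "measure lborel D \<le> 12 * \<bar>h\<bar>"
  proof -
    have m: "cball \<rho> \<bar>h\<bar> \<in> fmeasurable lborel" "measure lborel (cball \<rho> \<bar>h\<bar>) = 2 * \<bar>h\<bar>" for \<rho> :: real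
      by (auto simp: cball_eq_atLeastAtMost fmeasurable_def)
    show "D \<in> fmeasurable lborel" unfolding D_def by (intro fmeasurable.finite_UN m) auto
    have "measure lborel D \<le> (\<Sum>\<rho>\<in>{\<epsilon>, N, 2 * \<bar>h\<bar>, - \<epsilon>, - N, - (2 * \<bar>h\<bar>)}. measure lborel (cball \<rho> \<bar>h\<bar>))"
      unfolding D_def by (intro measure_UNION_le) auto
    also have "\<dots> = card {\<epsilon>, N, 2 * \<bar>h\<bar>, - \<epsilon>, - N, - (2 * \<bar>h\<bar>)} * (2 * \<bar>h\<bar>)"
      unfolding m(2) by simp
    also have "\<dots> \<le> 6 * (2 * \<bar>h\<bar>)"
    proof (intro mult_right_mono)
      have "card {\<epsilon>, N, 2 * \<bar>h\<bar>, - \<epsilon>, - N, - (2 * \<bar>h\<bar>)} \<le> length [\<epsilon>, N, 2 * \<bar>h\<bar>, - \<epsilon>, - N, - (2 * \<bar>h\<bar>)]"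
        by (metis card_length list.simps(15) list.set(1))
      then show "real (card {\<epsilon>, N, 2 * \<bar>h\<bar>, - \<epsilon>, - N, - (2 * \<bar>h\<bar>)}) \<le> 6" by simp
    qed simp
    finally show "measure lborel D \<le> 12 * \<bar>h\<bar>" by simp
  qed
  define T where "T = (\<lambda>x. M * \<bar>h\<bar> powr \<theta> * (indicator {2 * \<bar>h\<bar>..} \<bar>x\<bar> * \<bar>x\<bar> powr (- (1 + \<theta>))))"
  have T0: "0 \<le> T x" for x using M by (simp add: T_def)
  have Tint: "has_bochner_integral lborel T (M * \<bar>h\<bar> powr \<theta> * (2 * ((2 * \<bar>h\<bar>) powr (- \<theta>) / \<theta>)))"
    unfolding T_def using h \<theta> by (intro has_bochner_integral_mult_right tail_integral) auto
  have Dint: "has_bochner_integral lborel (\<lambda>x. (M / \<bar>h\<bar>) * indicator D x) ((M / \<bar>h\<bar>) * measure lborel D)"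
    using Dm by (intro has_bochner_integral_mult_right has_bochner_integral_real_indicator) (auto simp: fmeasurable_def)
  have bound: "norm (cis (\<xi> * x) * (G x - G (x + h))) \<le> T x + (M / \<bar>h\<bar>) * indicator D x" for x
  proof -
    consider "x \<in> L" "x + h \<in> L" | "x \<in> L" "x + h \<notin> L" | "x \<notin> L" "x + h \<in> L" | "x \<notin> L" "x + h \<notin> L" by blast
    then show ?thesis
    proof cases
      case 1
      then have x: "2 * \<bar>h\<bar> \<le> \<bar>x\<bar>" by (simp add: L_iff)
      then have "norm (g (x + h) - g x) \<le> T x"
        using smooth[OF h(1) x] x unfolding T_def powr_minus_divide by simp
      moreover have "0 \<le> (M / \<bar>h\<bar>) * indicator D x" using M by simp
      moreover have "norm (cis (\<xi> * x) * (G x - G (x + h))) = norm (g (x + h) - g x)"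
        using 1 by (simp add: norm_mult G_def norm_minus_commute)
      ultimately show ?thesis by linarith
    next
      case 2
      have "x \<in> D"
        using Dc[of x \<epsilon>] Dc[of x N] Dc[of x "2 * \<bar>h\<bar>"] 2 unfolding L_iff by (smt (verit))
      moreover have "G (x + h) = 0" using 2 by (simp add: G_def)
      ultimately show ?thesis using G_le[of x] T0[of x] by (simp add: norm_mult)
    next
      case 3
      have "x \<in> D"
        using Dc[of x \<epsilon>] Dc[of x N] Dc[of x "2 * \<bar>h\<bar>"] 3 unfolding L_iff by (smt (verit))
      moreover have "G x = 0" using 3 by (simp add: G_def)
      ultimately show ?thesis using G_le[of "x + h"] T0[of x] by (simp add: norm_mult)
    next
      case 4
      then show ?thesis using T0[of x] M by (simp add: G_def)
    qed
  qed
  note sum = has_bochner_integral_add[OF Tint Dint]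
  have "norm (2 * (LINT x|lborel. cis (\<xi> * x) * G x)) \<le>
      (LINT x|lborel. T x + (M / \<bar>h\<bar>) * indicator D x)"
    unfolding two
    by (rule order_trans[OF integral_norm_bound], rule Bochner_Integration.integral_mono)
       (use sum Gint2 bound in \<open>auto simp: has_bochner_integral_iff intro!: integrable_norm\<close>)
  also have "\<dots> = M * \<bar>h\<bar> powr \<theta> * (2 * ((2 * \<bar>h\<bar>) powr (- \<theta>) / \<theta>)) + (M / \<bar>h\<bar>) * measure lborel D"
    using sum by (rule has_bochner_integral_integral_eq)
  also have "\<dots> \<le> 2 * M / \<theta> + 12 * M"
  proof (intro add_mono)
    have "\<bar>h\<bar> powr \<theta> * (2 * \<bar>h\<bar>) powr (- \<theta>) = 2 powr (- \<theta>)"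
      using h by (simp add: powr_mult powr_minus field_simps)
    also have "\<dots> \<le> 1" using powr_mono[of "- \<theta>" 0 2] \<theta> by simp
    finally have "(2 * M / \<theta>) * (\<bar>h\<bar> powr \<theta> * (2 * \<bar>h\<bar>) powr (- \<theta>)) \<le> (2 * M / \<theta>) * 1"
      using M \<theta> by (intro mult_left_mono) auto
    then show "M * \<bar>h\<bar> powr \<theta> * (2 * ((2 * \<bar>h\<bar>) powr (- \<theta>) / \<theta>)) \<le> 2 * M / \<theta>"
      by (simp add: mult_ac)
    have "(M / \<bar>h\<bar>) * measure lborel D \<le> (M / \<bar>h\<bar>) * (12 * \<bar>h\<bar>)"
      using M Dmeas by (intro mult_left_mono) auto
    then show "(M / \<bar>h\<bar>) * measure lborel D \<le> 12 * M" using h by simp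
  qed
  finally have "norm (LINT x|lborel. cis (\<xi> * x) * G x) \<le> M / \<theta> + 6 * M"
    unfolding norm_mult by simp
  then show ?thesis by (simp add: G_def distrib_right)
qed

text \<open>
  On the core the factor \<open>cis (\<xi> * x) - 1\<close> is at most \<open>\<bar>\<xi> * x\<bar>\<close>, which compensates the
  singularity \<open>1 / \<bar>x\<bar>\<close>; off the core the shift argument applies.
\<close>

lemma osc_integral_bound:
  fixes g :: "real \<Rightarrow> complex" and \<xi> \<epsilon> N :: real
  assumes [measurable]: "g \<in> borel_measurable borel" and \<theta>: "\<theta> > 0" and M: "M \<ge> 0"
    and g: "cz_bound \<theta> M g" and \<epsilon>: "\<epsilon> > 0"
  shows "norm (LINT x|lborel. osc \<epsilon> N \<xi> x * g x) \<le> osc_const \<theta> * M"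
proof (cases "\<xi> = 0")
  case True
  then have "osc \<epsilon> N \<xi> x = 0" for x
    by (auto simp: osc_def wave_def core_def indicator_def)
  then show ?thesis using M \<theta> by (simp add: osc_const_def)
next
  case \<xi>: False
  have size: "norm (g x) \<le> M / \<bar>x\<bar>" if "x \<noteq> 0" for x
    using g that unfolding cz_bound_def by blast
  define L where "L = {x \<in> shell \<epsilon> N. 2 * pi < \<bar>\<xi> * x\<bar>}"
  have [measurable]: "L \<in> sets borel" unfolding L_def by measurable
  let ?P = "\<lambda>x. cis (\<xi> * x) * (indicator L x * g x)"
  let ?Q = "\<lambda>x. (cis (\<xi> * x) - 1) * (core \<epsilon> N \<xi> x * g x)"
  have split: "osc \<epsilon> N \<xi> x * g x = ?P x + ?Q x" for x
    by (auto simp: osc_def wave_def core_def L_def indicator_def algebra_simps)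
  have g_le: "norm (g x) \<le> M / \<epsilon>" if "x \<in> shell \<epsilon> N" for x
  proof -
    have "x \<noteq> 0" "\<epsilon> \<le> \<bar>x\<bar>" using that \<epsilon> by (auto simp: shell_def)
    moreover from this have "M / \<bar>x\<bar> \<le> M / \<epsilon>" using M \<epsilon> by (intro divide_left_mono) auto
    ultimately show ?thesis using size[of x] by simp
  qed
  have Pint: "integrable lborel ?P"
    by (rule integrable_bounded_support[of _ "M / \<epsilon>" N])
       (use M \<epsilon> g_le in \<open>auto simp: norm_mult L_def shell_def indicator_def\<close>)
  define B where "B = cball (0::real) (2 * pi / \<bar>\<xi>\<bar>)"
  have Bm: "B \<in> fmeasurable lborel" "measure lborel B = 4 * pi / \<bar>\<xi>\<bar>"
    by (auto simp: B_def cball_eq_atLeastAtMost fmeasurable_def)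
  have Bint: "has_bochner_integral lborel (\<lambda>x. (M * \<bar>\<xi>\<bar>) * indicator B x) ((M * \<bar>\<xi>\<bar>) * measure lborel B)"
    using Bm by (intro has_bochner_integral_mult_right has_bochner_integral_real_indicator) (auto simp: fmeasurable_def)
  have Qle: "norm (?Q x) \<le> (M * \<bar>\<xi>\<bar>) * indicator B x" for x
  proof (cases "x \<in> shell \<epsilon> N \<and> \<bar>\<xi> * x\<bar> \<le> 2 * pi")
    case True
    then have x: "x \<noteq> 0" "x \<in> B" using \<epsilon> \<xi> by (auto simp: shell_def B_def abs_mult field_simps)
    have "norm (cis (\<xi> * x) - 1) * norm (g x) \<le> \<bar>\<xi> * x\<bar> * (M / \<bar>x\<bar>)"
      by (intro mult_mono norm_cis_minus_one size x) auto
    also have "\<dots> = M * \<bar>\<xi>\<bar>" using x by (simp add: abs_mult)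
    finally show ?thesis using True x by (simp add: norm_mult core_def)
  qed (use M in \<open>auto simp: core_def\<close>)
  have Qint: "integrable lborel ?Q"
    by (rule Bochner_Integration.integrable_bound[OF Bint[unfolded has_bochner_integral_iff, THEN conjunct1]])
       (use order_trans[OF Qle abs_ge_self] in \<open>auto simp del: abs_mult\<close>)
  have "norm (LINT x|lborel. ?Q x) \<le> (LINT x|lborel. (M * \<bar>\<xi>\<bar>) * indicator B x)"
    by (rule order_trans[OF integral_norm_bound], rule Bochner_Integration.integral_mono)
       (use Qint Bint Qle in \<open>auto simp: has_bochner_integral_iff intro!: integrable_norm\<close>)
  also have "\<dots> = 4 * pi * M"
    using has_bochner_integral_integral_eq[OF Bint] Bm \<xi> by simp
  finally have Q: "norm (LINT x|lborel. ?Q x) \<le> 4 * pi * M" .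
  have P: "norm (LINT x|lborel. ?P x) \<le> (1 / \<theta> + 6) * M"
    unfolding L_def by (rule shift_oscillation) (use \<theta> M g \<xi> \<epsilon> in auto)
  have "norm (LINT x|lborel. osc \<epsilon> N \<xi> x * g x) = norm ((LINT x|lborel. ?P x) + (LINT x|lborel. ?Q x))"
    unfolding split Bochner_Integration.integral_add[OF Pint Qint] ..
  also have "\<dots> \<le> (1 / \<theta> + 6) * M + 4 * pi * M"
    by (rule order_trans[OF norm_triangle_ineq add_mono[OF P Q]])
  finally show ?thesis by (simp add: osc_const_def algebra_simps)
qed

section \<open>Iterated integrals of bounded functions with bounded support\<close>

definition compact2 :: "(real \<Rightarrow> real \<Rightarrow> complex) \<Rightarrow> bool" where
  "compact2 G \<longleftrightarrow> (\<lambda>(x, y). G x y) \<in> borel_measurable borel \<and>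
    (\<exists>M R. \<forall>x y. norm (G x y) \<le> M \<and> (R < \<bar>x\<bar> \<or> R < \<bar>y\<bar> \<longrightarrow> G x y = 0))"

definition compact3 :: "(real \<Rightarrow> real \<Rightarrow> real \<Rightarrow> complex) \<Rightarrow> bool" where
  "compact3 H \<longleftrightarrow> (\<lambda>(x, y, z). H x y z) \<in> borel_measurable borel \<and>
    (\<exists>M R. \<forall>x y z. norm (H x y z) \<le> M \<and> (R < \<bar>x\<bar> \<or> R < \<bar>y\<bar> \<or> R < \<bar>z\<bar> \<longrightarrow> H x y z = 0))"

lemma compact2I:
  assumes "(\<lambda>(x, y). G x y) \<in> borel_measurable borel" "\<And>x y. norm (G x y) \<le> M"
    and "\<And>x y. R < \<bar>x\<bar> \<or> R < \<bar>y\<bar> \<Longrightarrow> G x y = 0"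
  shows "compact2 G"
  unfolding compact2_def using assms by blast

lemma compact3I:
  assumes "(\<lambda>(x, y, z). H x y z) \<in> borel_measurable borel" "\<And>x y z. norm (H x y z) \<le> M"
    and "\<And>x y z. R < \<bar>x\<bar> \<or> R < \<bar>y\<bar> \<or> R < \<bar>z\<bar> \<Longrightarrow> H x y z = 0"
  shows "compact3 H"
  unfolding compact3_def using assms by blast

lemma norm_integral_bounded_support:
  fixes f :: "real \<Rightarrow> complex"
  assumes "f \<in> borel_measurable borel" "\<And>x. norm (f x) \<le> M" "\<And>x. R < \<bar>x\<bar> \<Longrightarrow> f x = 0"
  shows "norm (LINT x|lborel. f x) \<le> M * (2 * \<bar>R\<bar>)"
proof -
  have M: "0 \<le> M" using order_trans[OF norm_ge_zero assms(2)] .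
  have I: "has_bochner_integral lborel (\<lambda>x. M * indicator {- \<bar>R\<bar>..\<bar>R\<bar>} x) (M * measure lborel {- \<bar>R\<bar>..\<bar>R\<bar>})"
    by (intro has_bochner_integral_mult_right has_bochner_integral_real_indicator) auto
  have "norm (LINT x|lborel. f x) \<le> (LINT x|lborel. M * indicator {- \<bar>R\<bar>..\<bar>R\<bar>} x)"
  proof (rule order_trans[OF integral_norm_bound], rule Bochner_Integration.integral_mono)
    show "integrable lborel (\<lambda>x. norm (f x))"
      by (intro integrable_norm integrable_bounded_support[of _ M R]) (use assms in auto)
    show "norm (f x) \<le> M * indicator {- \<bar>R\<bar>..\<bar>R\<bar>} x" for x
      using assms(2)[of x] assms(3)[of x] M by (cases "R < \<bar>x\<bar>") (auto simp: indicator_def)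
  qed (use I in \<open>simp add: has_bochner_integral_iff\<close>)
  also have "\<dots> = M * (2 * \<bar>R\<bar>)"
    using has_bochner_integral_integral_eq[OF I] by simp
  finally show ?thesis .
qed

lemma compact2_integrable:
  assumes "compact2 G"
  shows "integrable lborel (G x)" and "integrable lborel (\<lambda>x. LINT y|lborel. G x y)"
    and "integrable (lborel \<Otimes>\<^sub>M lborel) (\<lambda>(x, y). G x y)"
proof -
  from assms obtain M R where [measurable]: "(\<lambda>(x, y). G x y) \<in> borel_measurable borel"
    and M: "\<And>x y. norm (G x y) \<le> M" and R: "\<And>x y. R < \<bar>x\<bar> \<or> R < \<bar>y\<bar> \<Longrightarrow> G x y = 0"
    unfolding compact2_def by blast
  have [measurable]: "(\<lambda>(x, y). G x y) \<in> borel_measurable (borel \<Otimes>\<^sub>M borel)"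
    by (simp add: borel_prod)
  have [measurable]: "G x \<in> borel_measurable borel" for x by measurable
  show "integrable lborel (G x)" for x
    by (rule integrable_bounded_support[of _ M R]) (use M R in auto)
  show int: "integrable lborel (\<lambda>x. LINT y|lborel. G x y)"
  proof (rule integrable_bounded_support[of _ "M * (2 * \<bar>R\<bar>)" R])
    show "norm (LINT y|lborel. G x y) \<le> M * (2 * \<bar>R\<bar>)" for x
      by (rule norm_integral_bounded_support) (use M R in auto)
    show "(LINT y|lborel. G x y) = 0" if "R < norm x" for x
      using R[of x] that by simp
  qed measurable
  show "integrable (lborel \<Otimes>\<^sub>M lborel) (\<lambda>(x, y). G x y)"
  proof -
    have "integrable lborel (\<lambda>(x, y). G x y)"
    proof (rule integrable_bounded_support[of _ M "\<bar>R\<bar> + \<bar>R\<bar>"])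
      show "(case p of (x, y) \<Rightarrow> G x y) = 0" if "\<bar>R\<bar> + \<bar>R\<bar> < norm p" for p
      proof -
        have "R < \<bar>fst p\<bar> \<or> R < \<bar>snd p\<bar>"
          using that norm_Pair_le[of "fst p" "snd p"] by (simp only: prod.collapse real_norm_def) linarith
        from R[OF this] show ?thesis by (simp add: case_prod_unfold)
      qed
    qed (use M in auto)
    then show ?thesis by (simp add: lborel_prod)
  qed
qed

lemma compact2_swap:
  assumes "compact2 G"
  shows "(LINT x|lborel. LINT y|lborel. G x y) = (LINT y|lborel. LINT x|lborel. G x y)"
  by (rule lborel_pair.Fubini_integral[symmetric]) (use compact2_integrable(3)[OF assms] in simp)

lemma compact3_slices:
  assumes "compact3 H"
  shows "compact2 (H x)" and "compact2 (\<lambda>x z. H x y z)"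
    and "compact2 (\<lambda>x y. LINT z|lborel. H x y z)" and "compact3 (\<lambda>x z y. H x y z)"
proof -
  from assms obtain M R where [measurable]: "(\<lambda>(x, y, z). H x y z) \<in> borel_measurable borel"
    and M: "\<And>x y z. norm (H x y z) \<le> M" and R: "\<And>x y z. R < \<bar>x\<bar> \<or> R < \<bar>y\<bar> \<or> R < \<bar>z\<bar> \<Longrightarrow> H x y z = 0"
    unfolding compact3_def by metis
  have Hm [measurable (raw)]: "(\<lambda>w. H (f w) (g w) (h w)) \<in> borel_measurable N"
    if "f \<in> borel_measurable N" "g \<in> borel_measurable N" "h \<in> borel_measurable N" for f g h and N :: "'b measure"
  proof -
    have "(\<lambda>w. (\<lambda>(x, y, z). H x y z) (f w, g w, h w)) \<in> borel_measurable N"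
      using that by measurable
    then show ?thesis by simp
  qed
  show "compact2 (H x)"
  proof (rule compact2I)
    show "(\<lambda>(y, z). H x y z) \<in> borel_measurable borel"
      unfolding borel_prod[symmetric] by measurable
  qed (use M R in blast)+
  show "compact2 (\<lambda>x z. H x y z)"
  proof (rule compact2I)
    show "(\<lambda>(x, z). H x y z) \<in> borel_measurable borel"
      unfolding borel_prod[symmetric] by measurable
  qed (use M R in blast)+
  show "compact3 (\<lambda>x z y. H x y z)"
  proof (rule compact3I)
    show "(\<lambda>(x, z, y). H x y z) \<in> borel_measurable borel"
      unfolding borel_prod[symmetric] by measurable
  qed (use M R in blast)+
  show "compact2 (\<lambda>x y. LINT z|lborel. H x y z)"
  proof (rule compact2I)
    show "(\<lambda>(x, y). LINT z|lborel. H x y z) \<in> borel_measurable borel"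
      unfolding borel_prod[symmetric] by measurable
    show "norm (LINT z|lborel. H x y z) \<le> M * (2 * \<bar>R\<bar>)" for x y
      by (rule norm_integral_bounded_support) (use M R in auto)
    show "(LINT z|lborel. H x y z) = 0" if "R < \<bar>x\<bar> \<or> R < \<bar>y\<bar>" for x y
    proof -
      have "H x y z = 0" for z using that R by blast
      then show ?thesis by simp
    qed
  qed
qed

text \<open>
  The orders of integration in which the terms of the expanded multiplier are estimated.
\<close>

lemma compact3_integral_orders:
  assumes H: "compact3 H"
  shows "(LINT x|lborel. LINT y|lborel. LINT z|lborel. H x y z) = (LINT x|lborel. LINT z|lborel. LINT y|lborel. H x y z)"
    and "(LINT x|lborel. LINT y|lborel. LINT z|lborel. H x y z) = (LINT y|lborel. LINT x|lborel. LINT z|lborel. H x y z)"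
    and "(LINT x|lborel. LINT y|lborel. LINT z|lborel. H x y z) = (LINT y|lborel. LINT z|lborel. LINT x|lborel. H x y z)"
    and "(LINT x|lborel. LINT y|lborel. LINT z|lborel. H x y z) = (LINT z|lborel. LINT x|lborel. LINT y|lborel. H x y z)"
proof -
  show 132: "(LINT x|lborel. LINT y|lborel. LINT z|lborel. H x y z) = (LINT x|lborel. LINT z|lborel. LINT y|lborel. H x y z)"
    by (simp add: compact2_swap[OF compact3_slices(1)[OF H]])
  show 213: "(LINT x|lborel. LINT y|lborel. LINT z|lborel. H x y z) = (LINT y|lborel. LINT x|lborel. LINT z|lborel. H x y z)"
    by (rule compact2_swap[OF compact3_slices(3)[OF H]])
  show "(LINT x|lborel. LINT y|lborel. LINT z|lborel. H x y z) = (LINT y|lborel. LINT z|lborel. LINT x|lborel. H x y z)"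
    unfolding 213 by (simp add: compact2_swap[OF compact3_slices(2)[OF H]])
  show "(LINT x|lborel. LINT y|lborel. LINT z|lborel. H x y z) = (LINT z|lborel. LINT x|lborel. LINT y|lborel. H x y z)"
    unfolding 132 by (rule compact2_swap[OF compact3_slices(3)[OF compact3_slices(4)[OF H]]])
qed

lemma compact3_integral_add:
  assumes H: "compact3 H" and H': "compact3 H'"
  shows "compact3 (\<lambda>x y z. H x y z + H' x y z)"
    and "(LINT x|lborel. LINT y|lborel. LINT z|lborel. H x y z + H' x y z) =
      (LINT x|lborel. LINT y|lborel. LINT z|lborel. H x y z) + (LINT x|lborel. LINT y|lborel. LINT z|lborel. H' x y z)"
proof -
  from H obtain M R where [measurable]: "(\<lambda>(x, y, z). H x y z) \<in> borel_measurable borel"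
    and M: "\<And>x y z. norm (H x y z) \<le> M" and R: "\<And>x y z. R < \<bar>x\<bar> \<or> R < \<bar>y\<bar> \<or> R < \<bar>z\<bar> \<Longrightarrow> H x y z = 0"
    unfolding compact3_def by metis
  from H' obtain M' R' where [measurable]: "(\<lambda>(x, y, z). H' x y z) \<in> borel_measurable borel"
    and M': "\<And>x y z. norm (H' x y z) \<le> M'" and R': "\<And>x y z. R' < \<bar>x\<bar> \<or> R' < \<bar>y\<bar> \<or> R' < \<bar>z\<bar> \<Longrightarrow> H' x y z = 0"
    unfolding compact3_def by metis
  show "compact3 (\<lambda>x y z. H x y z + H' x y z)"
  proof (rule compact3I)
    have "(\<lambda>p. (case p of (x, y, z) \<Rightarrow> H x y z) + (case p of (x, y, z) \<Rightarrow> H' x y z)) \<in> borel_measurable borel"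
      by measurable
    then show "(\<lambda>(x, y, z). H x y z + H' x y z) \<in> borel_measurable borel"
      by (simp add: case_prod_unfold)
    show "norm (H x y z + H' x y z) \<le> M + M'" for x y z
      by (rule norm_triangle_mono[OF M M'])
    show "H x y z + H' x y z = 0" if "max R R' < \<bar>x\<bar> \<or> max R R' < \<bar>y\<bar> \<or> max R R' < \<bar>z\<bar>" for x y z
      using that R[of x y z] R'[of x y z] by auto
  qed
  have 1: "(LINT z|lborel. H x y z + H' x y z) = (LINT z|lborel. H x y z) + (LINT z|lborel. H' x y z)" for x y
    by (intro Bochner_Integration.integral_add compact2_integrable(1)[of "H x"] compact2_integrable(1)[of "H' x"]
        compact3_slices(1) H H')
  have 2: "(LINT y|lborel. (LINT z|lborel. H x y z) + (LINT z|lborel. H' x y z)) =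
     (LINT y|lborel. LINT z|lborel. H x y z) + (LINT y|lborel. LINT z|lborel. H' x y z)" for x
    by (intro Bochner_Integration.integral_add compact2_integrable(2) compact3_slices(1) H H')
  show "(LINT x|lborel. LINT y|lborel. LINT z|lborel. H x y z + H' x y z) =
      (LINT x|lborel. LINT y|lborel. LINT z|lborel. H x y z) + (LINT x|lborel. LINT y|lborel. LINT z|lborel. H' x y z)"
    unfolding 1 2 by (intro Bochner_Integration.integral_add compact2_integrable(2) compact3_slices(3) H H')
qed

section \<open>Two oscillating variables\<close>

definition zygmund_weight :: "real \<Rightarrow> real \<Rightarrow> real" where
  "zygmund_weight \<theta> t = (t + 1 / t) powr (- \<theta>)"

text \<open>
  The scale \<open>s\<close> depends on the other two variables.  The bounds below do not involve it, since
  \<open>dz / \<bar>z\<bar>\<close> is invariant under dilations.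
\<close>

definition log_integrable_bound :: "real \<Rightarrow> real \<Rightarrow> (real \<Rightarrow> complex) \<Rightarrow> bool" where
  "log_integrable_bound \<theta> C g \<longleftrightarrow> (\<exists>s>0. \<forall>z. z \<noteq> 0 \<longrightarrow> norm (g z) \<le> C * (zygmund_weight \<theta> (s * \<bar>z\<bar>) / \<bar>z\<bar>))"

text \<open>
  The weight is at most \<open>(s * \<bar>z\<bar>) powr \<theta>\<close> and at most \<open>(s * \<bar>z\<bar>) powr (- \<theta>)\<close>.  The first
  makes the integral converge at the origin and the second at infinity, with crossover at \<open>1 / s\<close>;
  each of the four half-line integrals equals \<open>1 / \<theta>\<close>.
\<close>

lemma log_integrable_integral:
  fixes g w :: "real \<Rightarrow> complex"
  assumes \<theta>: "\<theta> > 0" and C: "C \<ge> 0" and g: "log_integrable_bound \<theta> C g"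
    and [measurable]: "g \<in> borel_measurable borel" "w \<in> borel_measurable borel"
    and w: "\<And>z. norm (w z) \<le> 1"
  shows "integrable lborel (\<lambda>z. w z * g z)" and "norm (LINT z|lborel. w z * g z) \<le> 4 / \<theta> * C"
proof -
  from g obtain s where s: "s > 0" and gs: "\<And>z. z \<noteq> 0 \<Longrightarrow> norm (g z) \<le> C * (zygmund_weight \<theta> (s * \<bar>z\<bar>) / \<bar>z\<bar>)"
    unfolding log_integrable_bound_def by auto
  let ?a = "1 / s"
  let ?P = "\<lambda>z. s powr \<theta> * (indicator {0..?a} \<bar>z\<bar> * \<bar>z\<bar> powr (\<theta> - 1))"
  let ?Q = "\<lambda>z. s powr (- \<theta>) * (indicator {?a..} \<bar>z\<bar> * \<bar>z\<bar> powr (- (1 + \<theta>)))"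
  have I: "has_bochner_integral lborel (\<lambda>z. C * (?P z + ?Q z))
     (C * (s powr \<theta> * (2 * (?a powr \<theta> / \<theta>)) + s powr (- \<theta>) * (2 * (?a powr (- \<theta>) / \<theta>))))"
    by (intro has_bochner_integral_mult_right has_bochner_integral_add origin_integral tail_integral)
       (use s \<theta> in auto)
  have weight: "zygmund_weight \<theta> (s * \<bar>z\<bar>) / \<bar>z\<bar> \<le> ?P z + ?Q z" if z: "z \<noteq> 0" for z
  proof -
    define t where "t = s * \<bar>z\<bar>"
    have t: "t > 0" using s z by (simp add: t_def)
    show ?thesis
    proof (cases "\<bar>z\<bar> \<le> ?a")
      case True
      have "zygmund_weight \<theta> t \<le> (1 / t) powr (- \<theta>)"
        unfolding zygmund_weight_def using t \<theta> by (intro powr_mono2') auto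
      also have "\<dots> = s powr \<theta> * \<bar>z\<bar> powr \<theta>"
        unfolding t_def using s z by (simp add: powr_minus powr_divide powr_mult)
      finally have "zygmund_weight \<theta> t / \<bar>z\<bar> \<le> s powr \<theta> * \<bar>z\<bar> powr \<theta> / \<bar>z\<bar>"
        by (rule divide_right_mono) simp
      also have "\<dots> = ?P z" using True z by (simp add: powr_diff)
      also have "\<dots> \<le> ?P z + ?Q z" by simp
      finally show ?thesis unfolding t_def .
    next
      case False
      have "zygmund_weight \<theta> t \<le> t powr (- \<theta>)"
        unfolding zygmund_weight_def using t \<theta> by (intro powr_mono2') auto
      also have "\<dots> = s powr (- \<theta>) * \<bar>z\<bar> powr (- \<theta>)"
        unfolding t_def using s z by (simp add: powr_mult)
      finally have "zygmund_weight \<theta> t / \<bar>z\<bar> \<le> s powr (- \<theta>) * \<bar>z\<bar> powr (- \<theta>) / \<bar>z\<bar>"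
        by (rule divide_right_mono) simp
      also have "\<dots> = ?Q z"
      proof -
        have "- (1 + \<theta>) = - \<theta> - 1" by simp
        then have "\<bar>z\<bar> powr (- (1 + \<theta>)) = \<bar>z\<bar> powr (- \<theta> - 1)" by (simp only:)
        also have "\<dots> = \<bar>z\<bar> powr (- \<theta>) / \<bar>z\<bar>" using z by (simp only: powr_diff) simp
        finally show ?thesis using False by simp
      qed
      also have "\<dots> \<le> ?P z + ?Q z" by simp
      finally show ?thesis unfolding t_def .
    qed
  qed
  have le: "AE z in lborel. norm (w z * g z) \<le> C * (?P z + ?Q z)"
    using AE_lborel_singleton[of "0::real"]
  proof eventually_elim
    fix z :: real assume z: "z \<noteq> 0"
    have "norm (w z * g z) \<le> 1 * norm (g z)"
      unfolding norm_mult by (intro mult_right_mono w) auto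
    also have "\<dots> \<le> C * (zygmund_weight \<theta> (s * \<bar>z\<bar>) / \<bar>z\<bar>)" using gs[OF z] by simp
    also have "\<dots> \<le> C * (?P z + ?Q z)" by (intro mult_left_mono weight z C)
    finally show "norm (w z * g z) \<le> C * (?P z + ?Q z)" .
  qed
  note I1 = I[unfolded has_bochner_integral_iff, THEN conjunct1]
  show int: "integrable lborel (\<lambda>z. w z * g z)"
    by (rule Bochner_Integration.integrable_bound[OF I1]) (use le in \<open>auto elim!: eventually_mono\<close>)
  have "norm (LINT z|lborel. w z * g z) \<le> (LINT z|lborel. C * (?P z + ?Q z))"
    by (rule order_trans[OF integral_norm_bound], rule integral_mono_AE)
       (use int I1 le in \<open>auto intro: integrable_norm\<close>)
  also have "\<dots> = C * (s powr \<theta> * (2 * (?a powr \<theta> / \<theta>)) + s powr (- \<theta>) * (2 * (?a powr (- \<theta>) / \<theta>)))"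
    by (rule has_bochner_integral_integral_eq[OF I])
  also have "\<dots> = 4 / \<theta> * C"
    using s by (simp add: powr_divide powr_minus field_simps)
  finally show "norm (LINT z|lborel. w z * g z) \<le> 4 / \<theta> * C" .
qed

text \<open>
  The bounds of the kernel and of its differences in the first two variables, as functions of the
  third one.  The constants are bracketed as in \<open>cz_bound\<close>, applied first in the second variable and
  then in the first.
\<close>

definition mixed_bounds :: "real \<Rightarrow> real \<Rightarrow> real \<Rightarrow> (real \<times> real \<times> real \<Rightarrow> complex) \<Rightarrow> bool" where
  "mixed_bounds \<theta>1 \<theta>2 C L \<longleftrightarrow>
    (\<forall>x y. x \<noteq> 0 \<and> y \<noteq> 0 \<longrightarrow> log_integrable_bound \<theta>2 ((C / \<bar>x\<bar>) / \<bar>y\<bar>) (\<lambda>z. L (x, y, z))) \<and>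
    (\<forall>x y h. h \<noteq> 0 \<and> 2 * \<bar>h\<bar> \<le> \<bar>x\<bar> \<and> y \<noteq> 0 \<longrightarrow>
      log_integrable_bound \<theta>2 ((C * \<bar>h\<bar> powr \<theta>1 / \<bar>x\<bar> powr (1 + \<theta>1)) / \<bar>y\<bar>)
        (\<lambda>z. L (x + h, y, z) - L (x, y, z))) \<and>
    (\<forall>x y k. x \<noteq> 0 \<and> k \<noteq> 0 \<and> 2 * \<bar>k\<bar> \<le> \<bar>y\<bar> \<longrightarrow>
      log_integrable_bound \<theta>2 ((C / \<bar>x\<bar>) * \<bar>k\<bar> powr \<theta>1 / \<bar>y\<bar> powr (1 + \<theta>1))
        (\<lambda>z. L (x, y + k, z) - L (x, y, z))) \<and>
    (\<forall>x y h k. h \<noteq> 0 \<and> 2 * \<bar>h\<bar> \<le> \<bar>x\<bar> \<and> k \<noteq> 0 \<and> 2 * \<bar>k\<bar> \<le> \<bar>y\<bar> \<longrightarrow>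
      log_integrable_bound \<theta>2 ((C * \<bar>h\<bar> powr \<theta>1 / \<bar>x\<bar> powr (1 + \<theta>1)) * \<bar>k\<bar> powr \<theta>1 / \<bar>y\<bar> powr (1 + \<theta>1))
        (\<lambda>z. (L (x + h, y + k, z) - L (x, y + k, z)) - (L (x + h, y, z) - L (x, y, z))))"

text \<open>
  After the integration over \<open>z\<close>, the function \<open>G x y\<close> satisfies product Hoelder bounds.
  For fixed \<open>x\<close> the function \<open>G x\<close>, and likewise the difference of \<open>G (x + h)\<close> and \<open>G x\<close>, is a one-variable
  kernel in \<open>y\<close>.  So the integral over \<open>y\<close> is bounded as a function of \<open>x\<close>, and so are its
  differences: it is a one-variable kernel in \<open>x\<close>.
\<close>

lemma two_oscillations_bound:
  fixes L :: "real \<times> real \<times> real \<Rightarrow> complex" and w :: "real \<Rightarrow> complex"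
  assumes \<theta>: "\<theta>1 > 0" "\<theta>2 > 0" and C: "C \<ge> 0" and L: "mixed_bounds \<theta>1 \<theta>2 C L"
    and [measurable]: "L \<in> borel_measurable borel" and wm [measurable]: "w \<in> borel_measurable borel"
    and w: "\<And>z. norm (w z) \<le> 1" and \<epsilon>: "\<epsilon>1 > 0" "\<epsilon>2 > 0"
  shows "norm (LINT x|lborel. osc \<epsilon>1 N1 \<xi> x * (LINT y|lborel. osc \<epsilon>2 N2 \<eta> y * (LINT z|lborel. w z * L (x, y, z))))
    \<le> (osc_const \<theta>1)\<^sup>2 * (4 / \<theta>2 * C)"
proof -
  define c where "c = osc_const \<theta>1"
  have c: "c \<ge> 0" using \<theta> by (simp add: c_def osc_const_def)
  define D where "D = 4 / \<theta>2 * C"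
  have D: "D \<ge> 0" using C \<theta> by (simp add: D_def)
  define G where "G = (\<lambda>x y. LINT z|lborel. w z * L (x, y, z))"
  have [measurable]: "(\<lambda>x. G x y) \<in> borel_measurable borel" "G x \<in> borel_measurable borel" for x y
    unfolding G_def by measurable
  have Gm [measurable]: "(\<lambda>(x, y). G x y) \<in> borel_measurable (borel \<Otimes>\<^sub>M borel)"
    unfolding G_def by measurable
  note LI = log_integrable_integral[where w = w, OF \<theta>(2) _ _ _ wm w]
  have L1: "log_integrable_bound \<theta>2 ((C / \<bar>x\<bar>) / \<bar>y\<bar>) (\<lambda>z. L (x, y, z))" if "x \<noteq> 0" "y \<noteq> 0" for x y
    using L that unfolding mixed_bounds_def by blast
  have int: "integrable lborel (\<lambda>z. w z * L (x, y, z))" if "x \<noteq> 0" "y \<noteq> 0" for x y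
    by (rule LI(1)[OF _ L1[OF that]]) (use C in auto)
  have G1: "norm (G x y) \<le> (D / \<bar>x\<bar>) / \<bar>y\<bar>" if "x \<noteq> 0" "y \<noteq> 0" for x y
    using LI(2)[OF _ L1[OF that]] C by (simp add: G_def D_def)
  have nz: "x + h \<noteq> 0" "x \<noteq> 0" if "h \<noteq> 0" "2 * \<bar>h\<bar> \<le> \<bar>x\<bar>" for x h :: real using that by auto
  have G2: "norm (G (x + h) y - G x y) \<le> (D * \<bar>h\<bar> powr \<theta>1 / \<bar>x\<bar> powr (1 + \<theta>1)) / \<bar>y\<bar>"
    if "h \<noteq> 0" "2 * \<bar>h\<bar> \<le> \<bar>x\<bar>" "y \<noteq> 0" for x y h
  proof -
    have "log_integrable_bound \<theta>2 ((C * \<bar>h\<bar> powr \<theta>1 / \<bar>x\<bar> powr (1 + \<theta>1)) / \<bar>y\<bar>) (\<lambda>z. L (x + h, y, z) - L (x, y, z))"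
      using L that unfolding mixed_bounds_def by blast
    from LI(2)[OF _ this] have "norm (LINT z|lborel. w z * (L (x + h, y, z) - L (x, y, z))) \<le> 4 / \<theta>2 * ((C * \<bar>h\<bar> powr \<theta>1 / \<bar>x\<bar> powr (1 + \<theta>1)) / \<bar>y\<bar>)"
      using C by simp
    also have "(LINT z|lborel. w z * (L (x + h, y, z) - L (x, y, z))) = G (x + h) y - G x y"
      unfolding G_def right_diff_distrib
      by (intro Bochner_Integration.integral_diff int[OF nz(1)[OF that(1,2)] that(3)] int[OF nz(2)[OF that(1,2)] that(3)])
    finally show ?thesis by (simp add: D_def)
  qed
  have G3: "norm (G x (y + k) - G x y) \<le> (D / \<bar>x\<bar>) * \<bar>k\<bar> powr \<theta>1 / \<bar>y\<bar> powr (1 + \<theta>1)"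
    if "x \<noteq> 0" "k \<noteq> 0" "2 * \<bar>k\<bar> \<le> \<bar>y\<bar>" for x y k
  proof -
    have "log_integrable_bound \<theta>2 ((C / \<bar>x\<bar>) * \<bar>k\<bar> powr \<theta>1 / \<bar>y\<bar> powr (1 + \<theta>1)) (\<lambda>z. L (x, y + k, z) - L (x, y, z))"
      using L that unfolding mixed_bounds_def by blast
    from LI(2)[OF _ this] have "norm (LINT z|lborel. w z * (L (x, y + k, z) - L (x, y, z))) \<le> 4 / \<theta>2 * ((C / \<bar>x\<bar>) * \<bar>k\<bar> powr \<theta>1 / \<bar>y\<bar> powr (1 + \<theta>1))"
      using C by simp
    also have "(LINT z|lborel. w z * (L (x, y + k, z) - L (x, y, z))) = G x (y + k) - G x y"
      unfolding G_def right_diff_distrib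
      by (intro Bochner_Integration.integral_diff int[OF that(1) nz(1)[OF that(2,3)]] int[OF that(1) nz(2)[OF that(2,3)]])
    finally show ?thesis by (simp add: D_def)
  qed
  have G4: "norm ((G (x + h) (y + k) - G x (y + k)) - (G (x + h) y - G x y)) \<le>
     (D * \<bar>h\<bar> powr \<theta>1 / \<bar>x\<bar> powr (1 + \<theta>1)) * \<bar>k\<bar> powr \<theta>1 / \<bar>y\<bar> powr (1 + \<theta>1)"
    if "h \<noteq> 0" "2 * \<bar>h\<bar> \<le> \<bar>x\<bar>" "k \<noteq> 0" "2 * \<bar>k\<bar> \<le> \<bar>y\<bar>" for x y h k
  proof -
    note nzs = nz[OF that(1,2)] nz[OF that(3,4)]
    have "log_integrable_bound \<theta>2 ((C * \<bar>h\<bar> powr \<theta>1 / \<bar>x\<bar> powr (1 + \<theta>1)) * \<bar>k\<bar> powr \<theta>1 / \<bar>y\<bar> powr (1 + \<theta>1))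
        (\<lambda>z. (L (x + h, y + k, z) - L (x, y + k, z)) - (L (x + h, y, z) - L (x, y, z)))"
      using L that unfolding mixed_bounds_def by blast
    from LI(2)[OF _ this] have "norm (LINT z|lborel. w z * ((L (x + h, y + k, z) - L (x, y + k, z)) - (L (x + h, y, z) - L (x, y, z)))) \<le>
       4 / \<theta>2 * ((C * \<bar>h\<bar> powr \<theta>1 / \<bar>x\<bar> powr (1 + \<theta>1)) * \<bar>k\<bar> powr \<theta>1 / \<bar>y\<bar> powr (1 + \<theta>1))"
      using C by simp
    also have "(LINT z|lborel. w z * ((L (x + h, y + k, z) - L (x, y + k, z)) - (L (x + h, y, z) - L (x, y, z)))) =
       (G (x + h) (y + k) - G x (y + k)) - (G (x + h) y - G x y)"
      unfolding G_def right_diff_distrib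
      using int[OF nzs(1) nzs(3)] int[OF nzs(1) nzs(4)] int[OF nzs(2) nzs(3)] int[OF nzs(2) nzs(4)] by simp
    finally show ?thesis by (simp add: D_def)
  qed
  define u where "u = (\<lambda>x. LINT y|lborel. osc \<epsilon>2 N2 \<eta> y * G x y)"
  have [measurable]: "u \<in> borel_measurable borel" unfolding u_def by measurable
  have oscint: "integrable lborel (\<lambda>y. osc \<epsilon>2 N2 \<eta> y * G x y)" if x: "x \<noteq> 0" for x
  proof (rule integrable_bounded_support[of _ "2 * ((D / \<bar>x\<bar>) / \<epsilon>2)" N2])
    show "norm (osc \<epsilon>2 N2 \<eta> y * G x y) \<le> 2 * ((D / \<bar>x\<bar>) / \<epsilon>2)" for y
    proof (cases "y \<in> shell \<epsilon>2 N2")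
      case True
      then have y: "y \<noteq> 0" "\<epsilon>2 \<le> \<bar>y\<bar>" using \<epsilon> by (auto simp: shell_def)
      have "norm (G x y) \<le> (D / \<bar>x\<bar>) / \<bar>y\<bar>" by (rule G1[OF x y(1)])
      also have "\<dots> \<le> (D / \<bar>x\<bar>) / \<epsilon>2" using y \<epsilon> D by (intro divide_left_mono) auto
      finally have G: "norm (G x y) \<le> (D / \<bar>x\<bar>) / \<epsilon>2" .
      have "norm (osc \<epsilon>2 N2 \<eta> y) \<le> norm (wave \<epsilon>2 N2 \<eta> y) + norm (core \<epsilon>2 N2 \<eta> y)"
        unfolding osc_def by (rule norm_triangle_ineq4)
      also have "\<dots> \<le> 1 + 1"
        by (intro add_mono) (auto simp: wave_def core_def indicator_def)
      finally show ?thesis unfolding norm_mult by (intro mult_mono G) auto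
    next
      case False
      then have "osc \<epsilon>2 N2 \<eta> y = 0" by (simp add: osc_def wave_def core_def)
      then show ?thesis using D \<epsilon> by simp
    qed
    show "osc \<epsilon>2 N2 \<eta> y * G x y = 0" if "N2 < norm y" for y
      using that by (simp add: osc_def wave_def core_def shell_def)
  qed measurable
  have "cz_bound \<theta>1 (c * D) u"
    unfolding cz_bound_def
  proof (intro conjI allI impI)
    fix x :: real assume x: "x \<noteq> 0"
    have "cz_bound \<theta>1 (D / \<bar>x\<bar>) (G x)"
      unfolding cz_bound_def using G1 G3 x by blast
    from osc_integral_bound[OF _ \<theta>(1) _ this \<epsilon>(2), of N2 \<eta>]
    show "norm (u x) \<le> c * D / \<bar>x\<bar>" using D by (simp add: u_def c_def)
  next
    fix x h :: real assume h: "h \<noteq> 0 \<and> 2 * \<bar>h\<bar> \<le> \<bar>x\<bar>"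
    have "cz_bound \<theta>1 (D * \<bar>h\<bar> powr \<theta>1 / \<bar>x\<bar> powr (1 + \<theta>1)) (\<lambda>y. G (x + h) y - G x y)"
      unfolding cz_bound_def using G2 G4 h by blast
    from osc_integral_bound[OF _ \<theta>(1) _ this \<epsilon>(2), of N2 \<eta>]
    have "norm (LINT y|lborel. osc \<epsilon>2 N2 \<eta> y * (G (x + h) y - G x y)) \<le> c * (D * \<bar>h\<bar> powr \<theta>1 / \<bar>x\<bar> powr (1 + \<theta>1))"
      using D by (simp add: c_def)
    also have "(LINT y|lborel. osc \<epsilon>2 N2 \<eta> y * (G (x + h) y - G x y)) = u (x + h) - u x"
      unfolding u_def right_diff_distrib
      using h by (intro Bochner_Integration.integral_diff oscint nz(1)[of h x] nz(2)[of h x]) auto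
    finally show "norm (u (x + h) - u x) \<le> c * D * \<bar>h\<bar> powr \<theta>1 / \<bar>x\<bar> powr (1 + \<theta>1)"
      by (simp add: mult.assoc)
  qed
  moreover have cD: "0 \<le> c * D" using c D by simp
  ultimately have "norm (LINT x|lborel. osc \<epsilon>1 N1 \<xi> x * u x) \<le> c * (c * D)"
    unfolding c_def by (intro osc_integral_bound \<theta> \<epsilon>) auto
  then show ?thesis
    by (simp add: u_def G_def c_def D_def power2_eq_square mult_ac)
qed

section \<open>The multiplier\<close>

definition shell_weight :: "real \<Rightarrow> real \<Rightarrow> (real \<Rightarrow> complex) \<Rightarrow> bool" where
  "shell_weight \<epsilon> N w \<longleftrightarrow> w \<in> borel_measurable borel \<and> (\<forall>x. norm (w x) \<le> 2) \<and> (\<forall>x. x \<notin> shell \<epsilon> N \<longrightarrow> w x = 0)"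

lemma norm_wave_core_le_1: "norm (wave \<epsilon> N \<xi> x) \<le> 1" "norm (core \<epsilon> N \<xi> x) \<le> 1"
  by (auto simp: wave_def core_def indicator_def)

lemma shell_weights: "shell_weight \<epsilon> N (wave \<epsilon> N \<xi>)" "shell_weight \<epsilon> N (core \<epsilon> N \<xi>)" "shell_weight \<epsilon> N (osc \<epsilon> N \<xi>)"
proof -
  show "shell_weight \<epsilon> N (wave \<epsilon> N \<xi>)" "shell_weight \<epsilon> N (core \<epsilon> N \<xi>)"
    by (auto simp: shell_weight_def wave_def core_def indicator_def)
  have "norm (osc \<epsilon> N \<xi> x) \<le> 1 + 1" for x
    unfolding osc_def by (rule order_trans[OF norm_triangle_ineq4 add_mono[OF norm_wave_core_le_1]])
  then show "shell_weight \<epsilon> N (osc \<epsilon> N \<xi>)"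
    by (auto simp: shell_weight_def osc_def wave_def core_def)
qed

definition tensor_kernel ::
  "(real \<times> real \<times> real \<Rightarrow> complex) \<Rightarrow> (real \<Rightarrow> complex) \<Rightarrow> (real \<Rightarrow> complex) \<Rightarrow> (real \<Rightarrow> complex) \<Rightarrow>
    real \<Rightarrow> real \<Rightarrow> real \<Rightarrow> complex" where
  "tensor_kernel K w1 w2 w3 x y z = w1 x * (w2 y * (w3 z * K (x, y, z)))"

lemma compact3_tensor_kernel:
  fixes K :: "real \<times> real \<times> real \<Rightarrow> complex"
  assumes [measurable]: "K \<in> borel_measurable borel" and C: "C \<ge> 0"
    and K: "\<And>x y z. x \<noteq> 0 \<Longrightarrow> y \<noteq> 0 \<Longrightarrow> z \<noteq> 0 \<Longrightarrow> norm (K (x, y, z)) \<le> C / (\<bar>x\<bar> * \<bar>y\<bar> * \<bar>z\<bar>)"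
    and \<epsilon>: "\<epsilon>1 > 0" "\<epsilon>2 > 0" "\<epsilon>3 > 0"
    and w: "shell_weight \<epsilon>1 N1 w1" "shell_weight \<epsilon>2 N2 w2" "shell_weight \<epsilon>3 N3 w3"
  shows "compact3 (tensor_kernel K w1 w2 w3)"
proof (rule compact3I)
  have [measurable]: "w1 \<in> borel_measurable borel" "w2 \<in> borel_measurable borel" "w3 \<in> borel_measurable borel"
    using w by (auto simp: shell_weight_def)
  show "(\<lambda>(x, y, z). tensor_kernel K w1 w2 w3 x y z) \<in> borel_measurable borel"
    unfolding tensor_kernel_def borel_prod[symmetric] by measurable
  have bd: "norm (w1 x) \<le> 2" "norm (w2 x) \<le> 2" "norm (w3 x) \<le> 2" for x
    using w by (auto simp: shell_weight_def)
  have zero: "tensor_kernel K w1 w2 w3 x y z = 0"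
    if "\<not> (x \<in> shell \<epsilon>1 N1 \<and> y \<in> shell \<epsilon>2 N2 \<and> z \<in> shell \<epsilon>3 N3)" for x y z
    using w that by (auto simp: shell_weight_def tensor_kernel_def)
  show "norm (tensor_kernel K w1 w2 w3 x y z) \<le> 2 * (2 * (2 * (C / (\<epsilon>1 * \<epsilon>2 * \<epsilon>3))))" for x y z
  proof (cases "x \<in> shell \<epsilon>1 N1 \<and> y \<in> shell \<epsilon>2 N2 \<and> z \<in> shell \<epsilon>3 N3")
    case True
    then have le: "\<epsilon>1 \<le> \<bar>x\<bar>" "\<epsilon>2 \<le> \<bar>y\<bar>" "\<epsilon>3 \<le> \<bar>z\<bar>" by (auto simp: shell_def)
    have "\<epsilon>1 * \<epsilon>2 * \<epsilon>3 \<le> \<bar>x\<bar> * \<bar>y\<bar> * \<bar>z\<bar>"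
      using le \<epsilon> by (intro mult_mono) auto
    then have "C / (\<bar>x\<bar> * \<bar>y\<bar> * \<bar>z\<bar>) \<le> C / (\<epsilon>1 * \<epsilon>2 * \<epsilon>3)"
      using \<epsilon> le C by (intro divide_left_mono mult_pos_pos) auto
    moreover have "norm (K (x, y, z)) \<le> C / (\<bar>x\<bar> * \<bar>y\<bar> * \<bar>z\<bar>)"
      using le \<epsilon> by (intro K) auto
    ultimately have "norm (K (x, y, z)) \<le> C / (\<epsilon>1 * \<epsilon>2 * \<epsilon>3)" by linarith
    then show ?thesis
      unfolding tensor_kernel_def norm_mult by (intro mult_mono bd) (auto intro!: mult_nonneg_nonneg)
  next
    case False
    then show ?thesis using zero C \<epsilon> by auto
  qed
  show "tensor_kernel K w1 w2 w3 x y z = 0"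
    if "max N1 (max N2 N3) < \<bar>x\<bar> \<or> max N1 (max N2 N3) < \<bar>y\<bar> \<or> max N1 (max N2 N3) < \<bar>z\<bar>" for x y z
    using that by (intro zero) (auto simp: shell_def)
qed

definition multiplier_const :: "real \<Rightarrow> real \<Rightarrow> real \<Rightarrow> real" where
  "multiplier_const \<theta>1 \<theta>2 C = C + 3 * (osc_const \<theta>1 * C) + 3 * ((osc_const \<theta>1)\<^sup>2 * (4 / \<theta>2 * C))"

text \<open>
  With \<open>P = core\<close>, \<open>Q = osc\<close> and \<open>E = wave = P + Q\<close>, the product \<open>EEE\<close> is
  \<open>PPP + QPP + PQP + PPQ + QQE + QPQ + PQQ\<close>.  Keeping \<open>E\<close> whole in the fifth term merges
  two of the eight terms of the full expansion.
\<close>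

lemma multiplier_bound:
  fixes K :: "real \<times> real \<times> real \<Rightarrow> complex" and \<xi>1 \<xi>2 \<xi>3 \<epsilon>1 \<epsilon>2 \<epsilon>3 N1 N2 N3 :: real
  assumes \<theta>: "\<theta>1 > 0" "\<theta>2 > 0" and C: "C \<ge> 0" and \<epsilon>: "\<epsilon>1 > 0" "\<epsilon>2 > 0" "\<epsilon>3 > 0"
    and Km [measurable]: "K \<in> borel_measurable borel"
    and size: "\<And>x y z. x \<noteq> 0 \<Longrightarrow> y \<noteq> 0 \<Longrightarrow> z \<noteq> 0 \<Longrightarrow> norm (K (x, y, z)) \<le> C / (\<bar>x\<bar> * \<bar>y\<bar> * \<bar>z\<bar>)"
    and m12: "mixed_bounds \<theta>1 \<theta>2 C K"
    and m13: "mixed_bounds \<theta>1 \<theta>2 C (\<lambda>(x, z, y). K (x, y, z))"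
    and m23: "mixed_bounds \<theta>1 \<theta>2 C (\<lambda>(y, z, x). K (x, y, z))"
  defines "P1 \<equiv> core \<epsilon>1 N1 \<xi>1" and "P2 \<equiv> core \<epsilon>2 N2 \<xi>2" and "P3 \<equiv> core \<epsilon>3 N3 \<xi>3"
  assumes canc_a: "norm (LINT x|lborel. P1 x * (LINT y|lborel. P2 y * (LINT z|lborel. P3 z * K (x, y, z)))) \<le> C"
    and canc_b: "cz_bound \<theta>1 C (\<lambda>z. LINT x|lborel. P1 x * (LINT y|lborel. P2 y * K (x, y, z)))"
    and canc_c: "cz_bound \<theta>1 C (\<lambda>x. LINT y|lborel. P2 y * (LINT z|lborel. P3 z * K (x, y, z)))"
    and canc_d: "cz_bound \<theta>1 C (\<lambda>y. LINT x|lborel. P1 x * (LINT z|lborel. P3 z * K (x, y, z)))"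
  shows "norm (LINT x|lborel. wave \<epsilon>1 N1 \<xi>1 x * (LINT y|lborel. wave \<epsilon>2 N2 \<xi>2 y *
      (LINT z|lborel. wave \<epsilon>3 N3 \<xi>3 z * K (x, y, z)))) \<le> multiplier_const \<theta>1 \<theta>2 C"
proof -
  define Q1 where "Q1 = osc \<epsilon>1 N1 \<xi>1"
  define Q2 where "Q2 = osc \<epsilon>2 N2 \<xi>2"
  define Q3 where "Q3 = osc \<epsilon>3 N3 \<xi>3"
  define E1 where "E1 = wave \<epsilon>1 N1 \<xi>1"
  define E2 where "E2 = wave \<epsilon>2 N2 \<xi>2"
  define E3 where "E3 = wave \<epsilon>3 N3 \<xi>3"
  note defs = P1_def P2_def P3_def Q1_def Q2_def Q3_def E1_def E2_def E3_def
  have [measurable]: "P1 \<in> borel_measurable borel" "P2 \<in> borel_measurable borel" "P3 \<in> borel_measurable borel"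
    "Q1 \<in> borel_measurable borel" "Q2 \<in> borel_measurable borel" "Q3 \<in> borel_measurable borel"
    "E1 \<in> borel_measurable borel" "E2 \<in> borel_measurable borel" "E3 \<in> borel_measurable borel"
    unfolding defs by measurable
  have perm: "(\<lambda>(x, z, y). K (x, y, z)) \<in> borel_measurable borel" "(\<lambda>(y, z, x). K (x, y, z)) \<in> borel_measurable borel"
    unfolding borel_prod[symmetric] by measurable
  have sw: "shell_weight \<epsilon>1 N1 w1" if "w1 \<in> {P1, Q1, E1}" for w1
    using that shell_weights unfolding defs by auto
  have sw2: "shell_weight \<epsilon>2 N2 w2" if "w2 \<in> {P2, Q2, E2}" for w2
    using that shell_weights unfolding defs by auto
  have sw3: "shell_weight \<epsilon>3 N3 w3" if "w3 \<in> {P3, Q3, E3}" for w3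
    using that shell_weights unfolding defs by auto
  have comp: "compact3 (tensor_kernel K w1 w2 w3)"
    if "w1 \<in> {P1, Q1, E1}" "w2 \<in> {P2, Q2, E2}" "w3 \<in> {P3, Q3, E3}" for w1 w2 w3
    by (rule compact3_tensor_kernel[OF Km C size \<epsilon> sw[OF that(1)] sw2[OF that(2)] sw3[OF that(3)]])
  define T where "T = (\<lambda>w1 w2 w3. LINT x|lborel. LINT y|lborel. LINT z|lborel. tensor_kernel K w1 w2 w3 x y z)"
  have T123: "T w1 w2 w3 = (LINT x|lborel. w1 x * (LINT y|lborel. w2 y * (LINT z|lborel. w3 z * K (x, y, z))))"
    for w1 w2 w3 unfolding T_def tensor_kernel_def by (simp only: integral_mult_right_zero)
  have EQ: "E1 x = P1 x + Q1 x" "E2 x = P2 x + Q2 x" "E3 x = P3 x + Q3 x" for x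
    unfolding defs osc_def by auto
  have expand: "tensor_kernel K E1 E2 E3 x y z =
      tensor_kernel K P1 P2 P3 x y z + (tensor_kernel K Q1 P2 P3 x y z + (tensor_kernel K P1 Q2 P3 x y z +
      (tensor_kernel K P1 P2 Q3 x y z + (tensor_kernel K Q1 Q2 E3 x y z + (tensor_kernel K Q1 P2 Q3 x y z +
       tensor_kernel K P1 Q2 Q3 x y z)))))" for x y z
    unfolding tensor_kernel_def EQ by (simp add: algebra_simps)
  have T_sum: "T E1 E2 E3 = T P1 P2 P3 + (T Q1 P2 P3 + (T P1 Q2 P3 + (T P1 P2 Q3 + (T Q1 Q2 E3 + (T Q1 P2 Q3 + T P1 Q2 Q3)))))"
    unfolding T_def expand
    by (simp add: compact3_integral_add comp del: Bochner_Integration.integral_add)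
  have PPP: "norm (T P1 P2 P3) \<le> C" using canc_a unfolding T123 .
  have QPP: "norm (T Q1 P2 P3) \<le> osc_const \<theta>1 * C"
    unfolding T123 Q1_def by (rule osc_integral_bound[OF _ \<theta>(1) C canc_c \<epsilon>(1)]) measurable
  have PQP: "norm (T P1 Q2 P3) \<le> osc_const \<theta>1 * C"
  proof -
    have "T P1 Q2 P3 = (LINT y|lborel. LINT x|lborel. LINT z|lborel. tensor_kernel K P1 Q2 P3 x y z)"
      unfolding T_def by (rule compact3_integral_orders(2)[OF comp]) auto
    also have "\<dots> = (LINT y|lborel. Q2 y * (LINT x|lborel. P1 x * (LINT z|lborel. P3 z * K (x, y, z))))"
      unfolding tensor_kernel_def mult.left_commute[of "P1 _" "Q2 _"] by (simp only: integral_mult_right_zero)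
    finally show ?thesis
      unfolding Q2_def by (simp only:) (rule osc_integral_bound[OF _ \<theta>(1) C canc_d \<epsilon>(2)], measurable)
  qed
  have PPQ: "norm (T P1 P2 Q3) \<le> osc_const \<theta>1 * C"
  proof -
    have "T P1 P2 Q3 = (LINT z|lborel. LINT x|lborel. LINT y|lborel. tensor_kernel K P1 P2 Q3 x y z)"
      unfolding T_def by (rule compact3_integral_orders(4)[OF comp]) auto
    also have "\<dots> = (LINT z|lborel. LINT x|lborel. LINT y|lborel. Q3 z * (P1 x * (P2 y * K (x, y, z))))"
      by (simp only: tensor_kernel_def mult_ac)
    also have "\<dots> = (LINT z|lborel. Q3 z * (LINT x|lborel. P1 x * (LINT y|lborel. P2 y * K (x, y, z))))"
      by (simp only: integral_mult_right_zero)
    finally show ?thesis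
      unfolding Q3_def by (simp only:) (rule osc_integral_bound[OF _ \<theta>(1) C canc_b \<epsilon>(3)], measurable)
  qed
  have le1: "norm (P1 x) \<le> 1" "norm (P2 x) \<le> 1" "norm (E3 x) \<le> 1" for x
    unfolding defs by (rule norm_wave_core_le_1)+
  have QQE: "norm (T Q1 Q2 E3) \<le> (osc_const \<theta>1)\<^sup>2 * (4 / \<theta>2 * C)"
    unfolding T123 Q1_def Q2_def by (rule two_oscillations_bound[OF \<theta> C m12]) (use le1 \<epsilon> in auto)
  have QPQ: "norm (T Q1 P2 Q3) \<le> (osc_const \<theta>1)\<^sup>2 * (4 / \<theta>2 * C)"
  proof -
    have "T Q1 P2 Q3 = (LINT x|lborel. LINT z|lborel. LINT y|lborel. tensor_kernel K Q1 P2 Q3 x y z)"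
      unfolding T_def by (rule compact3_integral_orders(1)[OF comp]) auto
    also have "\<dots> = (LINT x|lborel. LINT z|lborel. LINT y|lborel. Q1 x * (Q3 z * (P2 y * K (x, y, z))))"
      by (simp only: tensor_kernel_def mult_ac)
    also have "\<dots> = (LINT x|lborel. Q1 x * (LINT z|lborel. Q3 z * (LINT y|lborel. P2 y * (\<lambda>(x, z, y). K (x, y, z)) (x, z, y))))"
      by (simp only: integral_mult_right_zero prod.case)
    finally show ?thesis
      unfolding Q1_def Q3_def by (simp only:) (rule two_oscillations_bound[OF \<theta> C m13 perm(1)], use le1 \<epsilon> in auto)
  qed
  have PQQ: "norm (T P1 Q2 Q3) \<le> (osc_const \<theta>1)\<^sup>2 * (4 / \<theta>2 * C)"
  proof -
    have "T P1 Q2 Q3 = (LINT y|lborel. LINT z|lborel. LINT x|lborel. tensor_kernel K P1 Q2 Q3 x y z)"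
      unfolding T_def by (rule compact3_integral_orders(3)[OF comp]) auto
    also have "\<dots> = (LINT y|lborel. LINT z|lborel. LINT x|lborel. Q2 y * (Q3 z * (P1 x * K (x, y, z))))"
      by (simp only: tensor_kernel_def mult_ac)
    also have "\<dots> = (LINT y|lborel. Q2 y * (LINT z|lborel. Q3 z * (LINT x|lborel. P1 x * (\<lambda>(y, z, x). K (x, y, z)) (y, z, x))))"
      by (simp only: integral_mult_right_zero prod.case)
    finally show ?thesis
      unfolding Q2_def Q3_def by (simp only:) (rule two_oscillations_bound[OF \<theta> C m23 perm(2)], use le1 \<epsilon> in auto)
  qed
  have "norm (T E1 E2 E3) \<le> C + (osc_const \<theta>1 * C + (osc_const \<theta>1 * C + (osc_const \<theta>1 * C +
     ((osc_const \<theta>1)\<^sup>2 * (4 / \<theta>2 * C) + ((osc_const \<theta>1)\<^sup>2 * (4 / \<theta>2 * C) + (osc_const \<theta>1)\<^sup>2 * (4 / \<theta>2 * C))))))"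
    unfolding T_sum by (intro norm_triangle_mono PPP QPP PQP PPQ QQE QPQ PQQ)
  also have "\<dots> = multiplier_const \<theta>1 \<theta>2 C" by (simp add: multiplier_const_def)
  finally show ?thesis unfolding T123 E1_def E2_def E3_def .
qed

section \<open>Consequences of the regularity condition\<close>

definition increment :: "real \<Rightarrow> nat \<Rightarrow> real \<Rightarrow> real \<Rightarrow> real" where
  "increment \<theta> \<alpha> h x = \<bar>h\<bar> powr (real \<alpha> * \<theta>) / \<bar>x\<bar> powr (real \<alpha> * \<theta> + 1)"

lemma increment_simps:
  "h \<noteq> 0 \<Longrightarrow> increment \<theta> 0 h x = 1 / \<bar>x\<bar>"
  "increment \<theta> 1 h x = \<bar>h\<bar> powr \<theta> / \<bar>x\<bar> powr (1 + \<theta>)"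
  "increment \<theta> (Suc 0) h x = \<bar>h\<bar> powr \<theta> / \<bar>x\<bar> powr (1 + \<theta>)"
  by (cases "x = 0"; simp add: increment_def add.commute)+

text \<open>
  The last factor of the regularity bound.  It is a \<open>zygmund_weight\<close> in each of the three variables
  (\<open>decay_eq\<close>), because that weight is invariant under \<open>t \<mapsto> 1 / t\<close>.
\<close>

definition decay :: "real \<Rightarrow> real \<Rightarrow> real \<Rightarrow> real \<Rightarrow> real" where
  "decay \<theta> x y z = (\<bar>x * y / z\<bar> + \<bar>z / (x * y)\<bar>) powr (- \<theta>)"

lemma regularityD:
  assumes "regularity C \<theta>1 \<theta>2 K"
    and "\<alpha> \<in> {0, 1}" "\<beta> \<in> {0, 1}" "\<gamma> \<in> {0, 1}" "\<beta> + \<gamma> \<le> 1 \<or> \<alpha> + \<gamma> \<le> 1"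
    and "h1 \<noteq> 0" "2 * \<bar>h1\<bar> \<le> \<bar>x1\<bar>" "h2 \<noteq> 0" "2 * \<bar>h2\<bar> \<le> \<bar>x2\<bar>" "h3 \<noteq> 0" "2 * \<bar>h3\<bar> \<le> \<bar>x3\<bar>"
  shows "norm (Delta1 \<alpha> h1 (Delta2 \<beta> h2 (Delta3 \<gamma> h3 K)) (x1, x2, x3)) \<le>
    C * increment \<theta>1 \<alpha> h1 x1 * increment \<theta>1 \<beta> h2 x2 * increment \<theta>1 \<gamma> h3 x3 * decay \<theta>2 x1 x2 x3"
proof -
  have "\<alpha> \<le> 1" "\<beta> \<le> 1" using assms(2,3) by auto
  then have cond: "(\<alpha> \<le> 1 \<and> \<beta> + \<gamma> \<le> 1) \<or> (\<alpha> + \<gamma> \<le> 1 \<and> \<beta> \<le> 1)" using assms(5) by blast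
  have "norm (Delta1 \<alpha> h1 (Delta2 \<beta> h2 (Delta3 \<gamma> h3 K)) (x1, x2, x3)) \<le>
     C * \<bar>h1\<bar> powr (real \<alpha> * \<theta>1) * \<bar>h2\<bar> powr (real \<beta> * \<theta>1) * \<bar>h3\<bar> powr (real \<gamma> * \<theta>1) /
          (\<bar>x1\<bar> powr (real \<alpha> * \<theta>1 + 1) * \<bar>x2\<bar> powr (real \<beta> * \<theta>1 + 1) * \<bar>x3\<bar> powr (real \<gamma> * \<theta>1 + 1) *
           (\<bar>x1 * x2 / x3\<bar> + \<bar>x3 / (x1 * x2)\<bar>) powr \<theta>2)"
    using assms(1)[unfolded regularity_def, rule_format, OF assms(2-4) cond, of h1 x1 h2 x2 h3 x3] assms(6-) by auto
  then show ?thesis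
    by (simp add: increment_def decay_def powr_minus divide_inverse mult_ac)
qed

text \<open>
  In a variable without a difference, the increment can be any admissible number, and half of the
  variable is chosen.  These are the seven admissible triples in terms of \<open>K\<close> itself.
\<close>

lemma regularity_bounds:
  assumes R: "regularity C \<theta>1 \<theta>2 K"
  shows "\<And>x y z. x \<noteq> 0 \<Longrightarrow> y \<noteq> 0 \<Longrightarrow> z \<noteq> 0 \<Longrightarrow>
      norm (K (x, y, z)) \<le> C * (1 / \<bar>x\<bar>) * (1 / \<bar>y\<bar>) * (1 / \<bar>z\<bar>) * decay \<theta>2 x y z"
    and "\<And>x y z h. h \<noteq> 0 \<Longrightarrow> 2 * \<bar>h\<bar> \<le> \<bar>x\<bar> \<Longrightarrow> y \<noteq> 0 \<Longrightarrow> z \<noteq> 0 \<Longrightarrow>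
      norm (K (x + h, y, z) - K (x, y, z)) \<le> C * increment \<theta>1 1 h x * (1 / \<bar>y\<bar>) * (1 / \<bar>z\<bar>) * decay \<theta>2 x y z"
    and "\<And>x y z h. x \<noteq> 0 \<Longrightarrow> h \<noteq> 0 \<Longrightarrow> 2 * \<bar>h\<bar> \<le> \<bar>y\<bar> \<Longrightarrow> z \<noteq> 0 \<Longrightarrow>
      norm (K (x, y + h, z) - K (x, y, z)) \<le> C * (1 / \<bar>x\<bar>) * increment \<theta>1 1 h y * (1 / \<bar>z\<bar>) * decay \<theta>2 x y z"
    and "\<And>x y z h. x \<noteq> 0 \<Longrightarrow> y \<noteq> 0 \<Longrightarrow> h \<noteq> 0 \<Longrightarrow> 2 * \<bar>h\<bar> \<le> \<bar>z\<bar> \<Longrightarrow>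
      norm (K (x, y, z + h) - K (x, y, z)) \<le> C * (1 / \<bar>x\<bar>) * (1 / \<bar>y\<bar>) * increment \<theta>1 1 h z * decay \<theta>2 x y z"
    and "\<And>x y z h k. h \<noteq> 0 \<Longrightarrow> 2 * \<bar>h\<bar> \<le> \<bar>x\<bar> \<Longrightarrow> k \<noteq> 0 \<Longrightarrow> 2 * \<bar>k\<bar> \<le> \<bar>y\<bar> \<Longrightarrow> z \<noteq> 0 \<Longrightarrow>
      norm ((K (x + h, y + k, z) - K (x, y + k, z)) - (K (x + h, y, z) - K (x, y, z)))
      \<le> C * increment \<theta>1 1 h x * increment \<theta>1 1 k y * (1 / \<bar>z\<bar>) * decay \<theta>2 x y z"
    and "\<And>x y z h k. h \<noteq> 0 \<Longrightarrow> 2 * \<bar>h\<bar> \<le> \<bar>x\<bar> \<Longrightarrow> y \<noteq> 0 \<Longrightarrow> k \<noteq> 0 \<Longrightarrow> 2 * \<bar>k\<bar> \<le> \<bar>z\<bar> \<Longrightarrow>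
      norm ((K (x + h, y, z + k) - K (x, y, z + k)) - (K (x + h, y, z) - K (x, y, z)))
      \<le> C * increment \<theta>1 1 h x * (1 / \<bar>y\<bar>) * increment \<theta>1 1 k z * decay \<theta>2 x y z"
    and "\<And>x y z h k. x \<noteq> 0 \<Longrightarrow> h \<noteq> 0 \<Longrightarrow> 2 * \<bar>h\<bar> \<le> \<bar>y\<bar> \<Longrightarrow> k \<noteq> 0 \<Longrightarrow> 2 * \<bar>k\<bar> \<le> \<bar>z\<bar> \<Longrightarrow>
      norm ((K (x, y + h, z + k) - K (x, y, z + k)) - (K (x, y + h, z) - K (x, y, z)))
      \<le> C * (1 / \<bar>x\<bar>) * increment \<theta>1 1 h y * increment \<theta>1 1 k z * decay \<theta>2 x y z"
proof -
  note D = Delta1_def Delta2_def Delta3_def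
  fix x y z :: real
  {
    assume "x \<noteq> 0" "y \<noteq> 0" "z \<noteq> 0"
    then show "norm (K (x, y, z)) \<le> C * (1 / \<bar>x\<bar>) * (1 / \<bar>y\<bar>) * (1 / \<bar>z\<bar>) * decay \<theta>2 x y z"
      using regularityD[OF R, of 0 0 0 "x / 2" x "y / 2" y "z / 2" z] by (simp add: D increment_simps)
  }
  fix h
  {
    assume "h \<noteq> 0" "2 * \<bar>h\<bar> \<le> \<bar>x\<bar>" "y \<noteq> 0" "z \<noteq> 0"
    then show "norm (K (x + h, y, z) - K (x, y, z)) \<le> C * increment \<theta>1 1 h x * (1 / \<bar>y\<bar>) * (1 / \<bar>z\<bar>) * decay \<theta>2 x y z"
      using regularityD[OF R, of 1 0 0 h x "y / 2" y "z / 2" z] by (simp add: D increment_simps)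
  }
  {
    assume "x \<noteq> 0" "h \<noteq> 0" "2 * \<bar>h\<bar> \<le> \<bar>y\<bar>" "z \<noteq> 0"
    then show "norm (K (x, y + h, z) - K (x, y, z)) \<le> C * (1 / \<bar>x\<bar>) * increment \<theta>1 1 h y * (1 / \<bar>z\<bar>) * decay \<theta>2 x y z"
      using regularityD[OF R, of 0 1 0 "x / 2" x h y "z / 2" z] by (simp add: D increment_simps norm_minus_commute)
  }
  {
    assume "x \<noteq> 0" "y \<noteq> 0" "h \<noteq> 0" "2 * \<bar>h\<bar> \<le> \<bar>z\<bar>"
    then show "norm (K (x, y, z + h) - K (x, y, z)) \<le> C * (1 / \<bar>x\<bar>) * (1 / \<bar>y\<bar>) * increment \<theta>1 1 h z * decay \<theta>2 x y z"
      using regularityD[OF R, of 0 0 1 "x / 2" x "y / 2" y h z] by (simp add: D increment_simps norm_minus_commute)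
  }
  fix k
  {
    assume "h \<noteq> 0" "2 * \<bar>h\<bar> \<le> \<bar>x\<bar>" "k \<noteq> 0" "2 * \<bar>k\<bar> \<le> \<bar>y\<bar>" "z \<noteq> 0"
    then have "norm (Delta1 1 h (Delta2 1 k (Delta3 0 (z / 2) K)) (x, y, z)) \<le>
      C * increment \<theta>1 1 h x * increment \<theta>1 1 k y * (1 / \<bar>z\<bar>) * decay \<theta>2 x y z"
      using regularityD[OF R, of 1 1 0 h x k y "z / 2" z] by (simp add: increment_simps(1))
    also have "Delta1 1 h (Delta2 1 k (Delta3 0 (z / 2) K)) (x, y, z) =
       - ((K (x + h, y + k, z) - K (x, y + k, z)) - (K (x + h, y, z) - K (x, y, z)))"
      by (simp add: D)
    finally show "norm ((K (x + h, y + k, z) - K (x, y + k, z)) - (K (x + h, y, z) - K (x, y, z)))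
      \<le> C * increment \<theta>1 1 h x * increment \<theta>1 1 k y * (1 / \<bar>z\<bar>) * decay \<theta>2 x y z"
      unfolding norm_minus_cancel .
  }
  {
    assume "h \<noteq> 0" "2 * \<bar>h\<bar> \<le> \<bar>x\<bar>" "y \<noteq> 0" "k \<noteq> 0" "2 * \<bar>k\<bar> \<le> \<bar>z\<bar>"
    then have "norm (Delta1 1 h (Delta2 0 (y / 2) (Delta3 1 k K)) (x, y, z)) \<le>
      C * increment \<theta>1 1 h x * (1 / \<bar>y\<bar>) * increment \<theta>1 1 k z * decay \<theta>2 x y z"
      using regularityD[OF R, of 1 0 1 h x "y / 2" y k z] by (simp add: increment_simps(1))
    also have "Delta1 1 h (Delta2 0 (y / 2) (Delta3 1 k K)) (x, y, z) =
       - ((K (x + h, y, z + k) - K (x, y, z + k)) - (K (x + h, y, z) - K (x, y, z)))"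
      by (simp add: D)
    finally show "norm ((K (x + h, y, z + k) - K (x, y, z + k)) - (K (x + h, y, z) - K (x, y, z)))
      \<le> C * increment \<theta>1 1 h x * (1 / \<bar>y\<bar>) * increment \<theta>1 1 k z * decay \<theta>2 x y z"
      unfolding norm_minus_cancel .
  }
  {
    assume "x \<noteq> 0" "h \<noteq> 0" "2 * \<bar>h\<bar> \<le> \<bar>y\<bar>" "k \<noteq> 0" "2 * \<bar>k\<bar> \<le> \<bar>z\<bar>"
    then have "norm (Delta1 0 (x / 2) (Delta2 1 h (Delta3 1 k K)) (x, y, z)) \<le>
      C * (1 / \<bar>x\<bar>) * increment \<theta>1 1 h y * increment \<theta>1 1 k z * decay \<theta>2 x y z"
      using regularityD[OF R, of 0 1 1 "x / 2" x h y k z] by (simp add: increment_simps(1))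
    also have "Delta1 0 (x / 2) (Delta2 1 h (Delta3 1 k K)) (x, y, z) =
       - ((K (x, y + h, z + k) - K (x, y, z + k)) - (K (x, y + h, z) - K (x, y, z)))"
      by (simp add: D)
    finally show "norm ((K (x, y + h, z + k) - K (x, y, z + k)) - (K (x, y + h, z) - K (x, y, z)))
      \<le> C * (1 / \<bar>x\<bar>) * increment \<theta>1 1 h y * increment \<theta>1 1 k z * decay \<theta>2 x y z"
      unfolding norm_minus_cancel .
  }
qed

lemma decay_eq:
  assumes "x \<noteq> 0" "y \<noteq> 0" "z \<noteq> 0"
  shows "decay \<theta> x y z = zygmund_weight \<theta> (1 / \<bar>x * y\<bar> * \<bar>z\<bar>)"
    and "decay \<theta> x y z = zygmund_weight \<theta> (\<bar>x / z\<bar> * \<bar>y\<bar>)"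
    and "decay \<theta> x y z = zygmund_weight \<theta> (\<bar>y / z\<bar> * \<bar>x\<bar>)"
  using assms by (simp_all add: decay_def zygmund_weight_def abs_mult mult_ac add.commute)

lemma decay_le_1:
  assumes "\<theta> > 0" "x \<noteq> 0" "y \<noteq> 0" "z \<noteq> 0"
  shows "decay \<theta> x y z \<le> 1"
proof -
  define t where "t = \<bar>x * y / z\<bar>"
  have t: "t > 0" using assms by (simp add: t_def)
  have "\<bar>z / (x * y)\<bar> = 1 / t" by (simp add: t_def)
  moreover have "1 \<le> t + 1 / t"
  proof -
    have "1 \<le> t \<or> 1 \<le> 1 / t" "0 < 1 / t" using t by auto
    then show ?thesis using t by linarith
  qed
  ultimately show ?thesis
    unfolding decay_def t_def[symmetric] using assms(1) powr_mono2'[of "- \<theta>" 1 "t + 1 / t"] by simp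
qed

lemma regularity_nonneg:
  assumes "regularity C \<theta>1 \<theta>2 K"
  shows "C \<ge> 0"
proof -
  have "0 \<le> norm (K (1, 1, 1))" by simp
  also have "\<dots> \<le> C * decay \<theta>2 1 1 1" using regularity_bounds(1)[OF assms, of 1 1 1] by simp
  finally show ?thesis by (simp add: decay_def zero_le_mult_iff)
qed

definition off_planes :: "(real \<times> real \<times> real) set" where
  "off_planes = {p. fst p \<noteq> 0 \<and> fst (snd p) \<noteq> 0 \<and> snd (snd p) \<noteq> 0}"

lemma open_off_planes: "open off_planes"
  unfolding off_planes_def
  by (intro open_Collect_conj open_Collect_neq continuous_intros)

text \<open>
  The first differences in the three variables add up to \<open>K q - K p\<close>, and each is at most a power of
  the increment, with a factor that stays bounded as \<open>q\<close> tends to \<open>p\<close>.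
\<close>

lemma regularity_isCont:
  assumes R: "regularity C \<theta>1 \<theta>2 K" and \<theta>: "\<theta>1 > 0" "\<theta>2 > 0" and p: "p \<in> off_planes"
  shows "isCont K p"
proof -
  obtain x y z where p_eq: "p = (x, y, z)" by (metis prod_cases3)
  have nz: "x \<noteq> 0" "y \<noteq> 0" "z \<noteq> 0" using p by (auto simp: p_eq off_planes_def)
  have C: "C \<ge> 0" by (rule regularity_nonneg[OF R])
  have drop: "C * a * decay \<theta>2 u v w \<le> C * a" if "0 \<le> a" "u \<noteq> 0" "v \<noteq> 0" "w \<noteq> 0" for a u v w
    using mult_left_mono[OF decay_le_1[OF \<theta>(2) that(2-4)], of "C * a"] C that by simp
  have half: "\<bar>b\<bar> / 2 \<le> \<bar>b'\<bar> \<and> b' \<noteq> 0" if "2 * \<bar>b' - b\<bar> \<le> \<bar>b\<bar>" "b \<noteq> 0" for b b' :: real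
  proof -
    have "B / 2 \<le> B'" if "B \<le> B' + d" "2 * d \<le> B" for B B' d :: real
      using that by linarith
    from this[OF _ that(1), of "\<bar>b'\<bar>"] have "\<bar>b\<bar> / 2 \<le> \<bar>b'\<bar>" by linarith
    then show ?thesis using that(2) by auto
  qed
  have s1: "norm (K (x', y', z') - K (x, y', z')) \<le> C * (increment \<theta>1 1 (x' - x) x * (2 / \<bar>y\<bar>) * (2 / \<bar>z\<bar>))"
    if "2 * \<bar>x' - x\<bar> \<le> \<bar>x\<bar>" "2 * \<bar>y' - y\<bar> \<le> \<bar>y\<bar>" "2 * \<bar>z' - z\<bar> \<le> \<bar>z\<bar>" for x' y' z'
  proof (cases "x' = x")
    case False
    have y': "\<bar>y\<bar> / 2 \<le> \<bar>y'\<bar>" "\<bar>z\<bar> / 2 \<le> \<bar>z'\<bar>" and nz': "y' \<noteq> 0" "z' \<noteq> 0" using half[OF that(2) nz(2)] half[OF that(3) nz(3)] by auto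
    have i: "0 \<le> increment \<theta>1 1 (x' - x) x" by (simp add: increment_def)
    have "norm (K (x', y', z') - K (x, y', z')) \<le> C * (increment \<theta>1 1 (x' - x) x * (1 / \<bar>y'\<bar>) * (1 / \<bar>z'\<bar>)) * decay \<theta>2 x y' z'"
      using regularity_bounds(2)[OF R, of "x' - x" x y' z'] False that nz' by (simp add: mult.assoc)
    also have "\<dots> \<le> C * (increment \<theta>1 1 (x' - x) x * (1 / \<bar>y'\<bar>) * (1 / \<bar>z'\<bar>))"
      using i nz nz' by (intro drop) auto
    also have "\<dots> \<le> C * (increment \<theta>1 1 (x' - x) x * (1 / (\<bar>y\<bar> / 2)) * (1 / (\<bar>z\<bar> / 2)))"
      using i y' nz nz' C by (intro mult_left_mono mult_mono divide_left_mono) auto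
    finally show ?thesis by simp
  qed (use C in \<open>simp add: increment_def\<close>)
  have s2: "norm (K (x, y', z') - K (x, y, z')) \<le> C * ((1 / \<bar>x\<bar>) * increment \<theta>1 1 (y' - y) y * (2 / \<bar>z\<bar>))"
    if "2 * \<bar>y' - y\<bar> \<le> \<bar>y\<bar>" "2 * \<bar>z' - z\<bar> \<le> \<bar>z\<bar>" for y' z'
  proof (cases "y' = y")
    case False
    have y': "\<bar>z\<bar> / 2 \<le> \<bar>z'\<bar>" and nz': "z' \<noteq> 0" using half[OF that(2) nz(3)] by auto
    have i: "0 \<le> increment \<theta>1 1 (y' - y) y" by (simp add: increment_def)
    have "norm (K (x, y', z') - K (x, y, z')) \<le> C * ((1 / \<bar>x\<bar>) * increment \<theta>1 1 (y' - y) y * (1 / \<bar>z'\<bar>)) * decay \<theta>2 x y z'"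
      using regularity_bounds(3)[OF R, of x "y' - y" y z'] False that nz nz' by (simp add: mult.assoc)
    also have "\<dots> \<le> C * ((1 / \<bar>x\<bar>) * increment \<theta>1 1 (y' - y) y * (1 / \<bar>z'\<bar>))"
      using i nz nz' by (intro drop) auto
    also have "\<dots> \<le> C * ((1 / \<bar>x\<bar>) * increment \<theta>1 1 (y' - y) y * (1 / (\<bar>z\<bar> / 2)))"
      using i y' nz nz' C by (intro mult_left_mono mult_mono divide_left_mono) auto
    finally show ?thesis by simp
  qed (use C in \<open>simp add: increment_def\<close>)
  have s3: "norm (K (x, y, z') - K (x, y, z)) \<le> C * ((1 / \<bar>x\<bar>) * (1 / \<bar>y\<bar>) * increment \<theta>1 1 (z' - z) z)"
    if "2 * \<bar>z' - z\<bar> \<le> \<bar>z\<bar>" for z'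
  proof (cases "z' = z")
    case False
    have i: "0 \<le> increment \<theta>1 1 (z' - z) z" by (simp add: increment_def)
    have "norm (K (x, y, z') - K (x, y, z)) \<le> C * ((1 / \<bar>x\<bar>) * (1 / \<bar>y\<bar>) * increment \<theta>1 1 (z' - z) z) * decay \<theta>2 x y z"
      using regularity_bounds(4)[OF R, of x y "z' - z" z] False that nz by (simp add: mult.assoc)
    also have "\<dots> \<le> C * ((1 / \<bar>x\<bar>) * (1 / \<bar>y\<bar>) * increment \<theta>1 1 (z' - z) z)"
      using i nz by (intro drop) auto
    finally show ?thesis .
  qed (use C in \<open>simp add: increment_def\<close>)
  define \<Phi> where "\<Phi> = (\<lambda>q. C * (increment \<theta>1 1 (fst q - x) x * (2 / \<bar>y\<bar>) * (2 / \<bar>z\<bar>)) +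
     C * ((1 / \<bar>x\<bar>) * increment \<theta>1 1 (fst (snd q) - y) y * (2 / \<bar>z\<bar>)) +
     C * ((1 / \<bar>x\<bar>) * (1 / \<bar>y\<bar>) * increment \<theta>1 1 (snd (snd q) - z) z))"
  have lim: "((\<lambda>q. fst q - x) \<longlongrightarrow> 0) (at p)" "((\<lambda>q. fst (snd q) - y) \<longlongrightarrow> 0) (at p)" "((\<lambda>q. snd (snd q) - z) \<longlongrightarrow> 0) (at p)"
    unfolding p_eq by (rule LIM_zero, auto intro!: tendsto_eq_intros)+
  have near: "\<forall>\<^sub>F q in at p. 2 * \<bar>f q\<bar> \<le> \<bar>a\<bar>" if "(f \<longlongrightarrow> 0) (at p)" "a \<noteq> 0" for f and a :: real
  proof -
    have "\<forall>\<^sub>F q in at p. dist (f q) 0 < \<bar>a\<bar> / 2" using that by (intro tendstoD) auto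
    then show ?thesis by eventually_elim (simp add: dist_real_def)
  qed
  have "\<forall>\<^sub>F q in at p. norm (K q - K p) \<le> \<Phi> q"
    using near[OF lim(1) nz(1)] near[OF lim(2) nz(2)] near[OF lim(3) nz(3)]
  proof eventually_elim
    fix q assume q: "2 * \<bar>fst q - x\<bar> \<le> \<bar>x\<bar>" "2 * \<bar>fst (snd q) - y\<bar> \<le> \<bar>y\<bar>" "2 * \<bar>snd (snd q) - z\<bar> \<le> \<bar>z\<bar>"
    have "K q - K p = (K (fst q, fst (snd q), snd (snd q)) - K (x, fst (snd q), snd (snd q))) +
      (K (x, fst (snd q), snd (snd q)) - K (x, y, snd (snd q))) + (K (x, y, snd (snd q)) - K (x, y, z))"
      by (simp add: p_eq)
    then show "norm (K q - K p) \<le> \<Phi> q"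
      unfolding \<Phi>_def by (simp only:) (intro norm_triangle_mono s1 s2 s3 q)
  qed
  moreover have "(\<Phi> \<longlongrightarrow> 0) (at p)"
  proof -
    have inc: "((\<lambda>q. increment \<theta>1 1 (f q) a) \<longlongrightarrow> 0) (at p)" if "(f \<longlongrightarrow> 0) (at p)" for f a
    proof -
      have "((\<lambda>q. \<bar>f q\<bar> powr \<theta>1) \<longlongrightarrow> 0) (at p)"
        using that \<theta> by (intro tendsto_zero_powrI[OF tendsto_rabs_zero tendsto_const]) auto
      then have "((\<lambda>q. \<bar>f q\<bar> powr \<theta>1 / \<bar>a\<bar> powr (1 + \<theta>1)) \<longlongrightarrow> 0) (at p)"
        by (rule tendsto_divide_zero)
      then show ?thesis by (simp add: increment_simps)
    qed
    have "(\<Phi> \<longlongrightarrow> C * (0 * (2 / \<bar>y\<bar>) * (2 / \<bar>z\<bar>)) + C * ((1 / \<bar>x\<bar>) * 0 * (2 / \<bar>z\<bar>)) + C * ((1 / \<bar>x\<bar>) * (1 / \<bar>y\<bar>) * 0)) (at p)"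
      unfolding \<Phi>_def by (intro tendsto_intros inc lim)
    then show ?thesis by simp
  qed
  ultimately have "((\<lambda>q. K q - K p) \<longlongrightarrow> 0) (at p)" by (rule Lim_null_comparison)
  then show ?thesis unfolding isCont_def by (rule LIM_zero_cancel)
qed

text \<open>
  The values of \<open>K\<close> on the coordinate planes are arbitrary.  Replacing them by 0 makes the kernel Borel
  measurable and changes neither the truncated kernel nor any integral over shells.
\<close>

definition zero_on_planes :: "(real \<times> real \<times> real \<Rightarrow> complex) \<Rightarrow> real \<times> real \<times> real \<Rightarrow> complex" where
  "zero_on_planes K p = indicator off_planes p *\<^sub>R K p"

lemma zero_on_planes_eq [simp]:
  "x \<noteq> 0 \<Longrightarrow> y \<noteq> 0 \<Longrightarrow> z \<noteq> 0 \<Longrightarrow> zero_on_planes K (x, y, z) = K (x, y, z)"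
  by (simp add: zero_on_planes_def off_planes_def)

lemma zero_on_planes_measurable:
  assumes "regularity C \<theta>1 \<theta>2 K" "\<theta>1 > 0" "\<theta>2 > 0"
  shows "zero_on_planes K \<in> borel_measurable borel"
  unfolding zero_on_planes_def
  using regularity_isCont[OF assms] open_off_planes
  by (intro borel_measurable_continuous_on_indicator continuous_at_imp_continuous_on) auto

lemma regularity_mixed_bounds:
  assumes R: "regularity C \<theta>1 \<theta>2 K"
  shows "mixed_bounds \<theta>1 \<theta>2 C (zero_on_planes K)"
    and "mixed_bounds \<theta>1 \<theta>2 C (\<lambda>(x, z, y). zero_on_planes K (x, y, z))"
    and "mixed_bounds \<theta>1 \<theta>2 C (\<lambda>(y, z, x). zero_on_planes K (x, y, z))"
proof -
  note rb = regularity_bounds[OF R]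
  have nz: "x + h \<noteq> 0" "x \<noteq> 0" if "h \<noteq> 0" "2 * \<bar>h\<bar> \<le> \<bar>x\<bar>" for x h :: real using that by auto
  have LI: "log_integrable_bound \<theta>2 D g" if "s > 0" "\<And>z. z \<noteq> 0 \<Longrightarrow> norm (g z) \<le> D * (1 / \<bar>z\<bar>) * zygmund_weight \<theta>2 (s * \<bar>z\<bar>)" for s D g
    unfolding log_integrable_bound_def using that by (intro exI[of _ s]) auto
  show "mixed_bounds \<theta>1 \<theta>2 C (zero_on_planes K)"
    unfolding mixed_bounds_def
  proof (intro conjI allI impI; elim conjE)
    fix x y :: real assume "x \<noteq> 0" "y \<noteq> 0"
    then show "log_integrable_bound \<theta>2 (C / \<bar>x\<bar> / \<bar>y\<bar>) (\<lambda>z. zero_on_planes K (x, y, z))"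
      using rb(1)[of x y] by (intro LI[of "1 / \<bar>x * y\<bar>"]) (simp_all add: decay_eq(1))
  next
    fix x y h :: real assume *: "h \<noteq> 0" "2 * \<bar>h\<bar> \<le> \<bar>x\<bar>" "y \<noteq> 0"
    note n = nz[OF *(1,2)]
    show "log_integrable_bound \<theta>2 (C * \<bar>h\<bar> powr \<theta>1 / \<bar>x\<bar> powr (1 + \<theta>1) / \<bar>y\<bar>)
          (\<lambda>z. zero_on_planes K (x + h, y, z) - zero_on_planes K (x, y, z))"
      using rb(2)[OF *] * n by (intro LI[of "1 / \<bar>x * y\<bar>"]) (simp_all add: decay_eq(1) increment_simps)
  next
    fix x y k :: real assume *: "x \<noteq> 0" "k \<noteq> 0" "2 * \<bar>k\<bar> \<le> \<bar>y\<bar>"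
    note n = nz[OF *(2,3)]
    show "log_integrable_bound \<theta>2 (C / \<bar>x\<bar> * \<bar>k\<bar> powr \<theta>1 / \<bar>y\<bar> powr (1 + \<theta>1))
          (\<lambda>z. zero_on_planes K (x, y + k, z) - zero_on_planes K (x, y, z))"
      using rb(3)[OF *] * n by (intro LI[of "1 / \<bar>x * y\<bar>"]) (simp_all add: decay_eq(1) increment_simps)
  next
    fix x y h k :: real assume *: "h \<noteq> 0" "2 * \<bar>h\<bar> \<le> \<bar>x\<bar>" "k \<noteq> 0" "2 * \<bar>k\<bar> \<le> \<bar>y\<bar>"
    note n = nz[OF *(1,2)] nz[OF *(3,4)]
    show "log_integrable_bound \<theta>2 (C * \<bar>h\<bar> powr \<theta>1 / \<bar>x\<bar> powr (1 + \<theta>1) * \<bar>k\<bar> powr \<theta>1 / \<bar>y\<bar> powr (1 + \<theta>1))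
          (\<lambda>z. zero_on_planes K (x + h, y + k, z) - zero_on_planes K (x, y + k, z) -
             (zero_on_planes K (x + h, y, z) - zero_on_planes K (x, y, z)))"
      using rb(5)[OF *] * n by (intro LI[of "1 / \<bar>x * y\<bar>"]) (simp_all add: decay_eq(1) increment_simps)
  qed
  show "mixed_bounds \<theta>1 \<theta>2 C (\<lambda>(x, z, y). zero_on_planes K (x, y, z))"
    unfolding mixed_bounds_def prod.case
  proof (intro conjI allI impI; elim conjE)
    fix x z :: real assume "x \<noteq> 0" "z \<noteq> 0"
    then show "log_integrable_bound \<theta>2 (C / \<bar>x\<bar> / \<bar>z\<bar>) (\<lambda>y. zero_on_planes K (x, y, z))"
      using rb(1)[of x _ z] by (intro LI[of "\<bar>x / z\<bar>"]) (simp_all add: decay_eq(2) mult_ac)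
  next
    fix x z h :: real assume *: "h \<noteq> 0" "2 * \<bar>h\<bar> \<le> \<bar>x\<bar>" "z \<noteq> 0"
    note n = nz[OF *(1,2)]
    show "log_integrable_bound \<theta>2 (C * \<bar>h\<bar> powr \<theta>1 / \<bar>x\<bar> powr (1 + \<theta>1) / \<bar>z\<bar>)
          (\<lambda>y. zero_on_planes K (x + h, y, z) - zero_on_planes K (x, y, z))"
      using rb(2)[OF *(1,2) _ *(3)] * n by (intro LI[of "\<bar>x / z\<bar>"]) (simp_all add: decay_eq(2) increment_simps mult_ac)
  next
    fix x z k :: real assume *: "x \<noteq> 0" "k \<noteq> 0" "2 * \<bar>k\<bar> \<le> \<bar>z\<bar>"
    note n = nz[OF *(2,3)]
    show "log_integrable_bound \<theta>2 (C / \<bar>x\<bar> * \<bar>k\<bar> powr \<theta>1 / \<bar>z\<bar> powr (1 + \<theta>1))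
          (\<lambda>y. zero_on_planes K (x, y, z + k) - zero_on_planes K (x, y, z))"
      using rb(4)[OF *(1) _ *(2,3)] * n by (intro LI[of "\<bar>x / z\<bar>"]) (simp_all add: decay_eq(2) increment_simps mult_ac)
  next
    fix x z h k :: real assume *: "h \<noteq> 0" "2 * \<bar>h\<bar> \<le> \<bar>x\<bar>" "k \<noteq> 0" "2 * \<bar>k\<bar> \<le> \<bar>z\<bar>"
    note n = nz[OF *(1,2)] nz[OF *(3,4)]
    show "log_integrable_bound \<theta>2 (C * \<bar>h\<bar> powr \<theta>1 / \<bar>x\<bar> powr (1 + \<theta>1) * \<bar>k\<bar> powr \<theta>1 / \<bar>z\<bar> powr (1 + \<theta>1))
          (\<lambda>y. zero_on_planes K (x + h, y, z + k) - zero_on_planes K (x, y, z + k) -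
             (zero_on_planes K (x + h, y, z) - zero_on_planes K (x, y, z)))"
      using rb(6)[OF *(1,2) _ *(3,4)] * n by (intro LI[of "\<bar>x / z\<bar>"]) (simp_all add: decay_eq(2) increment_simps mult_ac)
  qed
  show "mixed_bounds \<theta>1 \<theta>2 C (\<lambda>(y, z, x). zero_on_planes K (x, y, z))"
    unfolding mixed_bounds_def prod.case
  proof (intro conjI allI impI; elim conjE)
    fix y z :: real assume "y \<noteq> 0" "z \<noteq> 0"
    then show "log_integrable_bound \<theta>2 (C / \<bar>y\<bar> / \<bar>z\<bar>) (\<lambda>x. zero_on_planes K (x, y, z))"
      using rb(1)[of _ y z] by (intro LI[of "\<bar>y / z\<bar>"]) (simp_all add: decay_eq(3) mult_ac)
  next
    fix y z h :: real assume *: "h \<noteq> 0" "2 * \<bar>h\<bar> \<le> \<bar>y\<bar>" "z \<noteq> 0"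
    note n = nz[OF *(1,2)]
    show "log_integrable_bound \<theta>2 (C * \<bar>h\<bar> powr \<theta>1 / \<bar>y\<bar> powr (1 + \<theta>1) / \<bar>z\<bar>)
          (\<lambda>x. zero_on_planes K (x, y + h, z) - zero_on_planes K (x, y, z))"
      using rb(3)[OF _ *] * n by (intro LI[of "\<bar>y / z\<bar>"]) (simp_all add: decay_eq(3) increment_simps mult_ac)
  next
    fix y z k :: real assume *: "y \<noteq> 0" "k \<noteq> 0" "2 * \<bar>k\<bar> \<le> \<bar>z\<bar>"
    note n = nz[OF *(2,3)]
    show "log_integrable_bound \<theta>2 (C / \<bar>y\<bar> * \<bar>k\<bar> powr \<theta>1 / \<bar>z\<bar> powr (1 + \<theta>1))
          (\<lambda>x. zero_on_planes K (x, y, z + k) - zero_on_planes K (x, y, z))"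
      using rb(4)[OF _ *] * n by (intro LI[of "\<bar>y / z\<bar>"]) (simp_all add: decay_eq(3) increment_simps mult_ac)
  next
    fix y z h k :: real assume *: "h \<noteq> 0" "2 * \<bar>h\<bar> \<le> \<bar>y\<bar>" "k \<noteq> 0" "2 * \<bar>k\<bar> \<le> \<bar>z\<bar>"
    note n = nz[OF *(1,2)] nz[OF *(3,4)]
    show "log_integrable_bound \<theta>2 (C * \<bar>h\<bar> powr \<theta>1 / \<bar>y\<bar> powr (1 + \<theta>1) * \<bar>k\<bar> powr \<theta>1 / \<bar>z\<bar> powr (1 + \<theta>1))
          (\<lambda>x. zero_on_planes K (x, y + h, z + k) - zero_on_planes K (x, y, z + k) -
             (zero_on_planes K (x, y + h, z) - zero_on_planes K (x, y, z)))"
      using rb(7)[OF _ *] * n by (intro LI[of "\<bar>y / z\<bar>"]) (simp_all add: decay_eq(3) increment_simps mult_ac)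
  qed
qed

section \<open>Consequences of the cancellation conditions\<close>

lemma core_eq_indicator_shell:
  assumes "0 < \<epsilon>" "\<epsilon> \<le> N"
  obtains r where "r > 0" "core \<epsilon> N \<xi> = (\<lambda>x. indicator (shell \<epsilon> r) x)"
proof (cases "\<xi> = 0")
  case True
  then have "core \<epsilon> N \<xi> = (\<lambda>x. indicator (shell \<epsilon> N) x)"
    by (auto simp: core_def indicator_def fun_eq_iff)
  then show ?thesis using assms by (intro that[of N]) auto
next
  case False
  then have "core \<epsilon> N \<xi> = (\<lambda>x. indicator (shell \<epsilon> (min N (2 * pi / \<bar>\<xi>\<bar>))) x)"
    by (auto simp: core_def indicator_def fun_eq_iff shell_def abs_mult field_simps)
  then show ?thesis using that[of "min N (2 * pi / \<bar>\<xi>\<bar>)"] assms False by auto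
qed

definition weighted_integral2 :: "(real \<Rightarrow> complex) \<Rightarrow> (real \<Rightarrow> complex) \<Rightarrow> (real \<times> real \<Rightarrow> complex) \<Rightarrow> complex" where
  "weighted_integral2 v w F = (LINT y|lborel. v y * (LINT z|lborel. w z * F (y, z)))"

lemma weighted_integral2_diff:
  fixes F G :: "real \<times> real \<Rightarrow> complex"
  assumes v: "shell_weight \<epsilon>2 N2 v" and w: "shell_weight \<epsilon>3 N3 w" and \<epsilon>: "\<epsilon>2 > 0" "\<epsilon>3 > 0"
    and F [measurable]: "F \<in> borel_measurable borel" and G [measurable]: "G \<in> borel_measurable borel"
    and Fb: "\<And>y z. y \<noteq> 0 \<Longrightarrow> z \<noteq> 0 \<Longrightarrow> norm (F (y, z)) \<le> M / (\<bar>y\<bar> * \<bar>z\<bar>)"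
    and Gb: "\<And>y z. y \<noteq> 0 \<Longrightarrow> z \<noteq> 0 \<Longrightarrow> norm (G (y, z)) \<le> M' / (\<bar>y\<bar> * \<bar>z\<bar>)"
  shows "weighted_integral2 v w (\<lambda>p. F p - G p) = weighted_integral2 v w F - weighted_integral2 v w G"
proof -
  have c: "compact2 (\<lambda>y z. v y * (w z * F (y, z)))"
    if [measurable]: "F \<in> borel_measurable borel" and Fb: "\<And>y z. y \<noteq> 0 \<Longrightarrow> z \<noteq> 0 \<Longrightarrow> norm (F (y, z)) \<le> M / (\<bar>y\<bar> * \<bar>z\<bar>)"
    for F :: "real \<times> real \<Rightarrow> complex" and M
  proof (rule compact2I)
    have M: "M \<ge> 0" using order_trans[OF norm_ge_zero Fb[of 1 1]] by simp
    have [measurable]: "v \<in> borel_measurable borel" "w \<in> borel_measurable borel"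
      using v w by (auto simp: shell_weight_def)
    show "(\<lambda>(y, z). v y * (w z * F (y, z))) \<in> borel_measurable borel"
      unfolding borel_prod[symmetric] by measurable
    have bd: "norm (v x) \<le> 2" "norm (w x) \<le> 2" for x
      using v w by (auto simp: shell_weight_def)
    have zero: "v y * (w z * F (y, z)) = 0" if "\<not> (y \<in> shell \<epsilon>2 N2 \<and> z \<in> shell \<epsilon>3 N3)" for y z
      using v w that by (auto simp: shell_weight_def)
    show "norm (v y * (w z * F (y, z))) \<le> 2 * (2 * (M / (\<epsilon>2 * \<epsilon>3)))" for y z
    proof (cases "y \<in> shell \<epsilon>2 N2 \<and> z \<in> shell \<epsilon>3 N3")
      case True
      then have le: "\<epsilon>2 \<le> \<bar>y\<bar>" "\<epsilon>3 \<le> \<bar>z\<bar>" by (auto simp: shell_def)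
      have "norm (F (y, z)) \<le> M / (\<bar>y\<bar> * \<bar>z\<bar>)"
        using le \<epsilon> by (intro Fb) auto
      also have "\<dots> \<le> M / (\<epsilon>2 * \<epsilon>3)"
        using \<epsilon> le M by (intro divide_left_mono mult_mono mult_pos_pos) auto
      finally show ?thesis
        unfolding norm_mult by (intro mult_mono bd) (auto intro!: mult_nonneg_nonneg)
    next
      case False
      then have "v y * (w z * F (y, z)) = 0" by (rule zero)
      show ?thesis unfolding \<open>v y * (w z * F (y, z)) = 0\<close> using M \<epsilon> by simp
    qed
    show "v y * (w z * F (y, z)) = 0" if "max N2 N3 < \<bar>y\<bar> \<or> max N2 N3 < \<bar>z\<bar>" for y z
      using that by (intro zero) (auto simp: shell_def)
  qed
  note cF = c[OF F Fb] and cG = c[OF G Gb]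
  have expand: "weighted_integral2 v w H = (LINT y|lborel. LINT z|lborel. v y * (w z * H (y, z)))" for H
    by (simp add: weighted_integral2_def)
  have inner: "(LINT z|lborel. v y * (w z * F (y, z)) - v y * (w z * G (y, z))) =
      (LINT z|lborel. v y * (w z * F (y, z))) - (LINT z|lborel. v y * (w z * G (y, z)))" for y
    by (rule Bochner_Integration.integral_diff[OF compact2_integrable(1)[OF cF] compact2_integrable(1)[OF cG]])
  show ?thesis
    unfolding expand right_diff_distrib inner
    by (rule Bochner_Integration.integral_diff[OF compact2_integrable(2)[OF cF] compact2_integrable(2)[OF cG]])
qed

lemma set_lebesgue_integral_shell:
  fixes f g :: "real \<Rightarrow> complex"
  assumes [measurable]: "g \<in> borel_measurable borel" and eq: "\<And>x. x \<in> shell \<delta> r \<Longrightarrow> f x = g x"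
  shows "(LINT x:shell \<delta> r|lebesgue. f x) = (LINT x|lborel. indicator (shell \<delta> r) x * g x)"
proof -
  have "(LINT x:shell \<delta> r|lebesgue. f x) = (LINT x|lebesgue. indicator (shell \<delta> r) x * g x)"
    unfolding set_lebesgue_integral_def
    by (intro Bochner_Integration.integral_cong refl) (auto simp: indicator_def eq)
  also have "\<dots> = (LINT x|lborel. indicator (shell \<delta> r) x * g x)"
    by (rule integral_completion) measurable
  finally show ?thesis .
qed

lemma iterated_shell_integral:
  fixes F :: "real \<times> real \<Rightarrow> complex"
  assumes [measurable]: "F \<in> borel_measurable borel" and \<delta>: "\<delta>2 > 0" "\<delta>3 > 0"
    and eq: "\<And>y z. y \<noteq> 0 \<Longrightarrow> z \<noteq> 0 \<Longrightarrow> D y z = F (y, z)"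
  shows "(LINT y:shell \<delta>2 r2|lebesgue. LINT z:shell \<delta>3 r3|lebesgue. D y z) =
    weighted_integral2 (\<lambda>y. indicator (shell \<delta>2 r2) y) (\<lambda>z. indicator (shell \<delta>3 r3) z) F"
  unfolding weighted_integral2_def
proof (rule set_lebesgue_integral_shell)
  show "(\<lambda>y. LINT z|lborel. indicator (shell \<delta>3 r3) z * F (y, z)) \<in> borel_measurable borel"
    by measurable
  show "(LINT z:shell \<delta>3 r3|lebesgue. D y z) = (LINT z|lborel. indicator (shell \<delta>3 r3) z * F (y, z))"
    if "y \<in> shell \<delta>2 r2" for y
    using that \<delta> by (intro set_lebesgue_integral_shell eq) (auto simp: shell_def)
qed

lemma shell_weight_indicator: "shell_weight \<delta> r (\<lambda>x. indicator (shell \<delta> r) x)"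
  by (auto simp: shell_weight_def indicator_def)

text \<open>
  The conditions \<open>cancellation_b\<close>, \<open>cancellation_c\<close> and \<open>cancellation_d\<close> have the same form up to the roles of the variables: \<open>L x\<close> is the
  kernel as a function of the two variables that are integrated.  The value \<open>\<alpha> = 0\<close> gives the size of
  the integral and \<open>\<alpha> = 1\<close> its Hoelder bound.
\<close>

lemma cz_bound_of_cancellation:
  fixes L :: "real \<Rightarrow> real \<times> real \<Rightarrow> complex"
  assumes sw: "shell_weight \<epsilon>2 N2 v" "shell_weight \<epsilon>3 N3 w" and \<epsilon>: "\<epsilon>2 > 0" "\<epsilon>3 > 0"
    and Lm: "\<And>x. L x \<in> borel_measurable borel"
    and size: "\<And>x y z. x \<noteq> 0 \<Longrightarrow> y \<noteq> 0 \<Longrightarrow> z \<noteq> 0 \<Longrightarrow> norm (L x (y, z)) \<le> C / \<bar>x\<bar> / (\<bar>y\<bar> * \<bar>z\<bar>)"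
    and canc: "\<And>(\<alpha>::nat) x h. \<alpha> \<in> {0, 1} \<Longrightarrow> h \<noteq> 0 \<Longrightarrow> 2 * \<bar>h\<bar> \<le> \<bar>x\<bar> \<Longrightarrow>
      norm (weighted_integral2 v w (\<lambda>p. of_nat \<alpha> * L (x + h) p - L x p)) \<le>
        C * \<bar>h\<bar> powr (real \<alpha> * \<theta>) / \<bar>x\<bar> powr (real \<alpha> * \<theta> + 1)"
  shows "cz_bound \<theta> C (\<lambda>x. weighted_integral2 v w (L x))"
  unfolding cz_bound_def
proof (intro conjI allI impI; (elim conjE)?)
  fix x :: real assume x: "x \<noteq> 0"
  have "weighted_integral2 v w (\<lambda>p. - L x p) = - weighted_integral2 v w (L x)"
    unfolding weighted_integral2_def by simp
  then show "norm (weighted_integral2 v w (L x)) \<le> C / \<bar>x\<bar>"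
    using canc[of 0 "x / 2" x] x by simp
next
  fix x h :: real assume h: "h \<noteq> 0" "2 * \<bar>h\<bar> \<le> \<bar>x\<bar>"
  then have nz: "x \<noteq> 0" "x + h \<noteq> 0" by auto
  have "weighted_integral2 v w (\<lambda>p. L (x + h) p - L x p) = weighted_integral2 v w (L (x + h)) - weighted_integral2 v w (L x)"
    by (rule weighted_integral2_diff[OF sw \<epsilon> Lm Lm size[OF nz(2)] size[OF nz(1)]])
  then show "norm (weighted_integral2 v w (L (x + h)) - weighted_integral2 v w (L x)) \<le> C * \<bar>h\<bar> powr \<theta> / \<bar>x\<bar> powr (1 + \<theta>)"
    using canc[of 1 h x] h by (simp add: add.commute)
qed

section \<open>The truncated kernel\<close>

lemma compact3_integral_triple:
  assumes H: "compact3 H"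
  shows "(LINT p|lborel. H (fst p) (fst (snd p)) (snd (snd p))) = (LINT x|lborel. LINT y|lborel. LINT z|lborel. H x y z)"
proof -
  from H obtain M R where Hm: "(\<lambda>(x, y, z). H x y z) \<in> borel_measurable borel"
    and M: "\<And>x y z. norm (H x y z) \<le> M" and R: "\<And>x y z. R < \<bar>x\<bar> \<or> R < \<bar>y\<bar> \<or> R < \<bar>z\<bar> \<Longrightarrow> H x y z = 0"
    unfolding compact3_def by metis
  have "integrable lborel (\<lambda>p. H (fst p) (fst (snd p)) (snd (snd p)))"
  proof (rule integrable_bounded_support[of _ M "\<bar>R\<bar> + (\<bar>R\<bar> + \<bar>R\<bar>)"])
    show "(\<lambda>p. H (fst p) (fst (snd p)) (snd (snd p))) \<in> borel_measurable borel"
      using Hm by (simp add: case_prod_unfold)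
    show "H (fst p) (fst (snd p)) (snd (snd p)) = 0" if "\<bar>R\<bar> + (\<bar>R\<bar> + \<bar>R\<bar>) < norm p" for p :: "real \<times> real \<times> real"
    proof -
      have "R < \<bar>fst p\<bar> \<or> R < \<bar>fst (snd p)\<bar> \<or> R < \<bar>snd (snd p)\<bar>"
        using that norm_Pair_le[of "fst p" "snd p"] norm_Pair_le[of "fst (snd p)" "snd (snd p)"]
        by (simp only: prod.collapse real_norm_def) linarith
      then show ?thesis by (rule R)
    qed
  qed (rule M)
  then have int: "integrable (lborel \<Otimes>\<^sub>M lborel) (\<lambda>(x, q). H x (fst q) (snd q))"
    by (simp add: lborel_prod case_prod_unfold)
  have "(LINT p|lborel. H (fst p) (fst (snd p)) (snd (snd p))) = (LINT x|lborel. LINT q|lborel. H x (fst q) (snd q))"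
    using lborel_pair.integral_fst[OF int] by (simp add: lborel_prod case_prod_unfold)
  moreover have "(LINT q|lborel. H x (fst q) (snd q)) = (LINT y|lborel. LINT z|lborel. H x y z)" for x
    using lborel_pair.integral_fst[OF compact2_integrable(3)[OF compact3_slices(1)[OF H, of x]]]
    by (simp add: lborel_prod case_prod_unfold)
  ultimately show ?thesis by simp
qed

lemma AE_off_hyperplane:
  fixes b :: "'a::euclidean_space"
  assumes "b \<in> Basis"
  shows "AE p in lborel. p \<bullet> b \<noteq> c"
proof (rule AE_I')
  have "{p. p \<bullet> b = c} \<in> sets borel" by measurable
  then show "{p. p \<bullet> b = c} \<in> null_sets lborel"
    using negligible_standard_hyperplane[OF assms, of c]
    by (simp add: negligible_iff_null_sets null_sets_completion_iff)
qed auto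

context
  fixes C \<theta>1 \<theta>2 :: real and K :: "real \<times> real \<times> real \<Rightarrow> complex"
    and \<epsilon>1 \<epsilon>2 \<epsilon>3 N1 N2 N3 :: real and k
  assumes \<theta>: "0 < \<theta>1" "0 < \<theta>2" and R: "regularity C \<theta>1 \<theta>2 K"
    and \<epsilon>: "0 < \<epsilon>1" "0 < \<epsilon>2" "0 < \<epsilon>3"
  defines "k \<equiv> truncated_kernel (\<epsilon>1, \<epsilon>2, \<epsilon>3) (N1, N2, N3) K"
begin

lemma truncated_kernel_eq:
  "k p = (if fst p \<in> shell \<epsilon>1 N1 \<and> fst (snd p) \<in> shell \<epsilon>2 N2 \<and> snd (snd p) \<in> shell \<epsilon>3 N3 then zero_on_planes K p else 0)"
  using \<epsilon> by (cases p) (auto simp: k_def truncated_kernel_def shell_def)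

lemma truncated_kernel_measurable: "k \<in> borel_measurable borel"
proof -
  have [measurable]: "zero_on_planes K \<in> borel_measurable borel"
    by (rule zero_on_planes_measurable[OF R \<theta>])
  have [measurable]: "(fst :: real \<times> real \<times> real \<Rightarrow> _) \<in> borel_measurable borel"
     "(\<lambda>p :: real \<times> real \<times> real. fst (snd p)) \<in> borel_measurable borel"
     "(\<lambda>p :: real \<times> real \<times> real. snd (snd p)) \<in> borel_measurable borel"
    by (intro borel_measurable_continuous_onI continuous_intros)+
  show ?thesis unfolding truncated_kernel_eq[abs_def] by measurable
qed

lemma kernel_size:
  assumes "x \<noteq> 0" "y \<noteq> 0" "z \<noteq> 0"
  shows "norm (zero_on_planes K (x, y, z)) \<le> C / (\<bar>x\<bar> * \<bar>y\<bar> * \<bar>z\<bar>)"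
proof -
  have "norm (K (x, y, z)) \<le> C * (1 / \<bar>x\<bar>) * (1 / \<bar>y\<bar>) * (1 / \<bar>z\<bar>) * decay \<theta>2 x y z"
    by (rule regularity_bounds(1)[OF R assms])
  also have "\<dots> \<le> C * (1 / \<bar>x\<bar>) * (1 / \<bar>y\<bar>) * (1 / \<bar>z\<bar>) * 1"
    using regularity_nonneg[OF R] by (intro mult_left_mono decay_le_1 \<theta> assms) auto
  finally show ?thesis using assms by simp
qed

lemma truncated_kernel_bounded: "norm (k p) \<le> C / (\<epsilon>1 * \<epsilon>2 * \<epsilon>3)"
proof (cases "fst p \<in> shell \<epsilon>1 N1 \<and> fst (snd p) \<in> shell \<epsilon>2 N2 \<and> snd (snd p) \<in> shell \<epsilon>3 N3")
  case True
  then have le: "\<epsilon>1 \<le> \<bar>fst p\<bar>" "\<epsilon>2 \<le> \<bar>fst (snd p)\<bar>" "\<epsilon>3 \<le> \<bar>snd (snd p)\<bar>" by (auto simp: shell_def)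
  have "norm (k p) = norm (zero_on_planes K (fst p, fst (snd p), snd (snd p)))"
    using True by (simp add: truncated_kernel_eq)
  also have "\<dots> \<le> C / (\<bar>fst p\<bar> * \<bar>fst (snd p)\<bar> * \<bar>snd (snd p)\<bar>)"
    using le \<epsilon> by (intro kernel_size) auto
  also have "\<dots> \<le> C / (\<epsilon>1 * \<epsilon>2 * \<epsilon>3)"
    using \<epsilon> le regularity_nonneg[OF R] by (intro divide_left_mono mult_mono mult_pos_pos) auto
  finally show ?thesis .
qed (use \<epsilon> regularity_nonneg[OF R] in \<open>auto simp: truncated_kernel_eq\<close>)

lemma truncated_kernel_support: "\<bar>N1\<bar> + (\<bar>N2\<bar> + \<bar>N3\<bar>) < norm p \<Longrightarrow> k p = 0"
  using norm_Pair_le[of "fst p" "snd p"] norm_Pair_le[of "fst (snd p)" "snd (snd p)"]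
  by (auto simp: truncated_kernel_eq shell_def)

text \<open>
  Off the twelve planes that bound the truncation, a point has a neighbourhood on which the truncated
  kernel is either \<open>K\<close> or 0.
\<close>

lemma truncated_kernel_AE_isCont: "AE p in lborel. isCont k p"
proof -
  have B: "(1, 0, 0) \<in> (Basis :: (real \<times> real \<times> real) set)" "(0, 1, 0) \<in> (Basis :: (real \<times> real \<times> real) set)"
     "(0, 0, 1) \<in> (Basis :: (real \<times> real \<times> real) set)"
    by (auto simp: Basis_prod_def zero_prod_def image_iff)
  have "AE p in lborel. \<forall>b\<in>{((1, 0, 0), {\<epsilon>1, N1, - \<epsilon>1, - N1}), ((0, 1, 0), {\<epsilon>2, N2, - \<epsilon>2, - N2}), ((0, 0, 1), {\<epsilon>3, N3, - \<epsilon>3, - N3})}.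
     \<forall>c\<in>snd b. (p :: real \<times> real \<times> real) \<bullet> fst b \<noteq> c"
    using B by (intro AE_finite_allI) (auto intro!: AE_off_hyperplane)
  then show ?thesis
  proof eventually_elim
    fix p :: "real \<times> real \<times> real"
    assume A: "\<forall>b\<in>{((1, 0, 0), {\<epsilon>1, N1, - \<epsilon>1, - N1}), ((0, 1, 0), {\<epsilon>2, N2, - \<epsilon>2, - N2}), ((0, 0, 1), {\<epsilon>3, N3, - \<epsilon>3, - N3})}.
     \<forall>c\<in>snd b. p \<bullet> fst b \<noteq> c"
    define x y z where "x = fst p" and "y = fst (snd p)" and "z = snd (snd p)"
    have ne: "\<bar>x\<bar> \<noteq> \<epsilon>1" "\<bar>x\<bar> \<noteq> N1" "\<bar>y\<bar> \<noteq> \<epsilon>2" "\<bar>y\<bar> \<noteq> N2" "\<bar>z\<bar> \<noteq> \<epsilon>3" "\<bar>z\<bar> \<noteq> N3"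
      using A by (auto simp: x_def y_def z_def inner_prod_def abs_if split: if_splits)
    let ?I = "{q. (\<epsilon>1 < \<bar>fst q\<bar> \<and> \<bar>fst q\<bar> < N1) \<and> (\<epsilon>2 < \<bar>fst (snd q)\<bar> \<and> \<bar>fst (snd q)\<bar> < N2) \<and> (\<epsilon>3 < \<bar>snd (snd q)\<bar> \<and> \<bar>snd (snd q)\<bar> < N3)} :: (real \<times> real \<times> real) set"
    let ?O = "{q. \<bar>fst q\<bar> < \<epsilon>1 \<or> N1 < \<bar>fst q\<bar> \<or> \<bar>fst (snd q)\<bar> < \<epsilon>2 \<or> N2 < \<bar>fst (snd q)\<bar> \<or> \<bar>snd (snd q)\<bar> < \<epsilon>3 \<or> N3 < \<bar>snd (snd q)\<bar>} :: (real \<times> real \<times> real) set"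
    have opn: "open ?I" "open ?O"
      by (intro open_Collect_conj open_Collect_disj open_Collect_less continuous_intros)+
    have "p \<in> ?I \<or> p \<in> ?O" using ne by (auto simp: x_def y_def z_def)
    then show "isCont k p"
    proof
      assume p: "p \<in> ?I"
      have "\<forall>\<^sub>F q in nhds p. q \<in> ?I" using opn(1) p by (rule eventually_nhds_in_open)
      then have "\<forall>\<^sub>F q in nhds p. k q = K q"
        by eventually_elim (auto simp: k_def truncated_kernel_def case_prod_unfold)
      then have "isCont k p \<longleftrightarrow> isCont K p" by (rule isCont_cong)
      moreover have "p \<in> off_planes" using p \<epsilon> by (auto simp: off_planes_def)
      ultimately show ?thesis using regularity_isCont[OF R \<theta>] by blast
    next
      assume p: "p \<in> ?O"
      have "\<forall>\<^sub>F q in nhds p. q \<in> ?O" using opn(2) p by (rule eventually_nhds_in_open)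
      then have "\<forall>\<^sub>F q in nhds p. k q = 0"
        by eventually_elim (auto simp: k_def truncated_kernel_def case_prod_unfold)
      then have "isCont k p \<longleftrightarrow> isCont (\<lambda>_. 0 :: complex) p" by (rule isCont_cong)
      then show ?thesis by simp
    qed
  qed
qed

text \<open>
  By \<open>core_eq_indicator_shell\<close>, the cores at the given frequency are indicators of shells.  The cancellation
  conditions are applied with the radii of these shells; their constants do not depend on the radii,
  hence not on the frequency.
\<close>

lemma truncated_kernel_fourier:
  assumes \<epsilon>N: "\<epsilon>1 \<le> N1" "\<epsilon>2 \<le> N2" "\<epsilon>3 \<le> N3"
    and canc: "cancellation_a C K" "cancellation_b C \<theta>1 K" "cancellation_c C \<theta>1 K" "cancellation_d C \<theta>1 K"
  shows "norm (fourier k \<xi>) \<le> multiplier_const \<theta>1 \<theta>2 C"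
proof -
  define K0 where "K0 = zero_on_planes K"
  obtain \<xi>1 \<xi>2 \<xi>3 where \<xi>: "\<xi> = (\<xi>1, \<xi>2, \<xi>3)" by (metis prod_cases3)
  have K0m [measurable]: "K0 \<in> borel_measurable borel"
    unfolding K0_def by (rule zero_on_planes_measurable[OF R \<theta>])
  have size: "norm (K0 (x, y, z)) \<le> C / (\<bar>x\<bar> * \<bar>y\<bar> * \<bar>z\<bar>)" if "x \<noteq> 0" "y \<noteq> 0" "z \<noteq> 0" for x y z
    unfolding K0_def by (rule kernel_size[OF that])
  have K0_eq: "K0 (x, y, z) = K (x, y, z)" if "x \<noteq> 0" "y \<noteq> 0" "z \<noteq> 0" for x y z
    using that by (simp add: K0_def)
  have C: "C \<ge> 0" by (rule regularity_nonneg[OF R])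
  have nz: "x \<noteq> 0" "x + h \<noteq> 0" if "h \<noteq> 0" "2 * \<bar>h\<bar> \<le> \<bar>x\<bar>" for x h :: real using that by auto
  obtain r1 where r1: "r1 > 0" "core \<epsilon>1 N1 \<xi>1 = (\<lambda>x. indicator (shell \<epsilon>1 r1) x)"
    using core_eq_indicator_shell[OF \<epsilon>(1) \<epsilon>N(1)] .
  obtain r2 where r2: "r2 > 0" "core \<epsilon>2 N2 \<xi>2 = (\<lambda>x. indicator (shell \<epsilon>2 r2) x)"
    using core_eq_indicator_shell[OF \<epsilon>(2) \<epsilon>N(2)] .
  obtain r3 where r3: "r3 > 0" "core \<epsilon>3 N3 \<xi>3 = (\<lambda>x. indicator (shell \<epsilon>3 r3) x)"
    using core_eq_indicator_shell[OF \<epsilon>(3) \<epsilon>N(3)] .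
  note r = r1(1) r2(1) r3(1)
  let ?I1 = "\<lambda>x. indicator (shell \<epsilon>1 r1) x :: complex"
  let ?I2 = "\<lambda>x. indicator (shell \<epsilon>2 r2) x :: complex"
  let ?I3 = "\<lambda>x. indicator (shell \<epsilon>3 r3) x :: complex"
  have Lm: "(\<lambda>(y, z). K0 (x, y, z)) \<in> borel_measurable borel" "(\<lambda>(x, z). K0 (x, y, z)) \<in> borel_measurable borel"
      "(\<lambda>(x, y). K0 (x, y, z)) \<in> borel_measurable borel" for x y z
    unfolding borel_prod[symmetric] by measurable
  have a: "norm (LINT x|lborel. ?I1 x * (LINT y|lborel. ?I2 y * (LINT z|lborel. ?I3 z * K0 (x, y, z)))) \<le> C"
  proof -
    have "(LINT x:shell \<epsilon>1 r1|lebesgue. LINT y:shell \<epsilon>2 r2|lebesgue. LINT z:shell \<epsilon>3 r3|lebesgue. K (x, y, z)) =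
      (LINT x|lborel. ?I1 x * (LINT y|lborel. ?I2 y * (LINT z|lborel. ?I3 z * K0 (x, y, z))))"
    proof (rule set_lebesgue_integral_shell)
      fix x assume "x \<in> shell \<epsilon>1 r1"
      then have "x \<noteq> 0" using \<epsilon> by (auto simp: shell_def)
      then show "(LINT y:shell \<epsilon>2 r2|lebesgue. LINT z:shell \<epsilon>3 r3|lebesgue. K (x, y, z)) =
         (LINT y|lborel. ?I2 y * (LINT z|lborel. ?I3 z * K0 (x, y, z)))"
        using iterated_shell_integral[OF Lm(1) \<epsilon>(2,3), of "\<lambda>y z. K (x, y, z)" x r2 r3]
        by (simp add: weighted_integral2_def K0_eq)
    qed measurable
    then show ?thesis using canc(1)[unfolded cancellation_a_def, rule_format, of \<epsilon>1 \<epsilon>2 \<epsilon>3 r1 r2 r3] \<epsilon> r by simp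
  qed
  have c: "cz_bound \<theta>1 C (\<lambda>x. weighted_integral2 ?I2 ?I3 (\<lambda>(y, z). K0 (x, y, z)))"
  proof (rule cz_bound_of_cancellation[OF shell_weight_indicator shell_weight_indicator \<epsilon>(2,3) Lm(1)])
    show "norm (case (y, z) of (y, z) \<Rightarrow> K0 (x, y, z)) \<le> C / \<bar>x\<bar> / (\<bar>y\<bar> * \<bar>z\<bar>)" if "x \<noteq> 0" "y \<noteq> 0" "z \<noteq> 0" for x y z
      using size[OF that] by (simp add: mult.assoc)
    fix \<alpha> :: nat and x h :: real assume *: "\<alpha> \<in> {0, 1}" "h \<noteq> 0" "2 * \<bar>h\<bar> \<le> \<bar>x\<bar>"
    note n = nz[OF *(2,3)]
    have "(LINT y:shell \<epsilon>2 r2|lebesgue. LINT z:shell \<epsilon>3 r3|lebesgue. Delta1 \<alpha> h K (x, y, z)) =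
      weighted_integral2 ?I2 ?I3 (\<lambda>p. of_nat \<alpha> * (case p of (y, z) \<Rightarrow> K0 (x + h, y, z)) - (case p of (y, z) \<Rightarrow> K0 (x, y, z)))"
      by (rule iterated_shell_integral)
         (use Lm \<epsilon> n in \<open>auto simp: Delta1_def K0_eq intro!: borel_measurable_diff borel_measurable_times\<close>)
    then show "norm (weighted_integral2 ?I2 ?I3 (\<lambda>p. of_nat \<alpha> * (case p of (y, z) \<Rightarrow> K0 (x + h, y, z)) - (case p of (y, z) \<Rightarrow> K0 (x, y, z))))
       \<le> C * \<bar>h\<bar> powr (real \<alpha> * \<theta>1) / \<bar>x\<bar> powr (real \<alpha> * \<theta>1 + 1)"
      using canc(3)[unfolded cancellation_c_def, rule_format, OF *(1), of \<epsilon>2 \<epsilon>3 r2 r3 h x] \<epsilon> r * by simp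
  qed
  have d: "cz_bound \<theta>1 C (\<lambda>y. weighted_integral2 ?I1 ?I3 (\<lambda>(x, z). K0 (x, y, z)))"
  proof (rule cz_bound_of_cancellation[OF shell_weight_indicator shell_weight_indicator \<epsilon>(1,3) Lm(2)])
    show "norm (case (x, z) of (x, z) \<Rightarrow> K0 (x, y, z)) \<le> C / \<bar>y\<bar> / (\<bar>x\<bar> * \<bar>z\<bar>)" if "y \<noteq> 0" "x \<noteq> 0" "z \<noteq> 0" for x y z
      using size[OF that(2,1,3)] by (simp add: mult_ac)
    fix \<alpha> :: nat and y h :: real assume *: "\<alpha> \<in> {0, 1}" "h \<noteq> 0" "2 * \<bar>h\<bar> \<le> \<bar>y\<bar>"
    note n = nz[OF *(2,3)]
    have "(LINT x:shell \<epsilon>1 r1|lebesgue. LINT z:shell \<epsilon>3 r3|lebesgue. Delta2 \<alpha> h K (x, y, z)) =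
      weighted_integral2 ?I1 ?I3 (\<lambda>p. of_nat \<alpha> * (case p of (x, z) \<Rightarrow> K0 (x, y + h, z)) - (case p of (x, z) \<Rightarrow> K0 (x, y, z)))"
      by (rule iterated_shell_integral)
         (use Lm \<epsilon> n in \<open>auto simp: Delta2_def K0_eq intro!: borel_measurable_diff borel_measurable_times\<close>)
    then show "norm (weighted_integral2 ?I1 ?I3 (\<lambda>p. of_nat \<alpha> * (case p of (x, z) \<Rightarrow> K0 (x, y + h, z)) - (case p of (x, z) \<Rightarrow> K0 (x, y, z))))
       \<le> C * \<bar>h\<bar> powr (real \<alpha> * \<theta>1) / \<bar>y\<bar> powr (real \<alpha> * \<theta>1 + 1)"
      using canc(4)[unfolded cancellation_d_def, rule_format, OF *(1), of \<epsilon>1 \<epsilon>3 r1 r3 h y] \<epsilon> r * by simp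
  qed
  have b: "cz_bound \<theta>1 C (\<lambda>z. weighted_integral2 ?I1 ?I2 (\<lambda>(x, y). K0 (x, y, z)))"
  proof (rule cz_bound_of_cancellation[OF shell_weight_indicator shell_weight_indicator \<epsilon>(1,2) Lm(3)])
    show "norm (case (x, y) of (x, y) \<Rightarrow> K0 (x, y, z)) \<le> C / \<bar>z\<bar> / (\<bar>x\<bar> * \<bar>y\<bar>)" if "z \<noteq> 0" "x \<noteq> 0" "y \<noteq> 0" for x y z
      using size[OF that(2,3,1)] by (simp add: mult_ac)
    fix \<alpha> :: nat and z h :: real assume *: "\<alpha> \<in> {0, 1}" "h \<noteq> 0" "2 * \<bar>h\<bar> \<le> \<bar>z\<bar>"
    note n = nz[OF *(2,3)]
    have "(LINT x:shell \<epsilon>1 r1|lebesgue. LINT y:shell \<epsilon>2 r2|lebesgue. Delta3 \<alpha> h K (x, y, z)) =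
      weighted_integral2 ?I1 ?I2 (\<lambda>p. of_nat \<alpha> * (case p of (x, y) \<Rightarrow> K0 (x, y, z + h)) - (case p of (x, y) \<Rightarrow> K0 (x, y, z)))"
      by (rule iterated_shell_integral)
         (use Lm \<epsilon> n in \<open>auto simp: Delta3_def K0_eq intro!: borel_measurable_diff borel_measurable_times\<close>)
    then show "norm (weighted_integral2 ?I1 ?I2 (\<lambda>p. of_nat \<alpha> * (case p of (x, y) \<Rightarrow> K0 (x, y, z + h)) - (case p of (x, y) \<Rightarrow> K0 (x, y, z))))
       \<le> C * \<bar>h\<bar> powr (real \<alpha> * \<theta>1) / \<bar>z\<bar> powr (real \<alpha> * \<theta>1 + 1)"
      using canc(2)[unfolded cancellation_b_def, rule_format, OF *(1), of \<epsilon>1 \<epsilon>2 r1 r2 h z] \<epsilon> r * by simp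
  qed
  have bound: "norm (LINT x|lborel. wave \<epsilon>1 N1 \<xi>1 x * (LINT y|lborel. wave \<epsilon>2 N2 \<xi>2 y *
      (LINT z|lborel. wave \<epsilon>3 N3 \<xi>3 z * K0 (x, y, z)))) \<le> multiplier_const \<theta>1 \<theta>2 C"
    by (rule multiplier_bound[OF \<theta> C \<epsilon> K0m size regularity_mixed_bounds[OF R, folded K0_def]])
       (use a b c d in \<open>simp_all add: r1(2) r2(2) r3(2) weighted_integral2_def\<close>)
  let ?T = "tensor_kernel K0 (wave \<epsilon>1 N1 \<xi>1) (wave \<epsilon>2 N2 \<xi>2) (wave \<epsilon>3 N3 \<xi>3)"
  have T: "compact3 ?T"
    by (rule compact3_tensor_kernel[OF K0m C size \<epsilon> shell_weights(1) shell_weights(1) shell_weights(1)])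
  have "fourier k \<xi> = (LINT p|lborel. ?T (fst p) (fst (snd p)) (snd (snd p)))"
    unfolding fourier_def
  proof (rule Bochner_Integration.integral_cong[OF refl])
    fix p :: "real \<times> real \<times> real"
    obtain x y z where p: "p = (x, y, z)" by (metis prod_cases3)
    have "cis (\<xi> \<bullet> p) = cis (\<xi>1 * x) * (cis (\<xi>2 * y) * cis (\<xi>3 * z))"
      by (simp add: \<xi> p cis_mult)
    then show "cis (\<xi> \<bullet> p) * k p = ?T (fst p) (fst (snd p)) (snd (snd p))"
      by (auto simp: truncated_kernel_eq p tensor_kernel_def wave_def indicator_def K0_def[symmetric])
  qed
  also have "\<dots> = (LINT x|lborel. LINT y|lborel. LINT z|lborel. ?T x y z)"
    by (rule compact3_integral_triple[OF T])
  finally show ?thesis using bound by (simp add: tensor_kernel_def)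
qed

end

theorem theorem1p1:
  fixes C \<theta>1 \<theta>2 :: real
  assumes "0 < \<theta>1" "\<theta>1 \<le> 1" "0 < \<theta>2" "\<theta>2 < 1"
  shows "\<exists>A::real. \<forall>K :: real \<times> real \<times> real \<Rightarrow> complex.
    regularity C \<theta>1 \<theta>2 K \<and> cancellation_a C K \<and> cancellation_b C \<theta>1 K \<and>
    cancellation_c C \<theta>1 K \<and> cancellation_d C \<theta>1 K \<longrightarrow>
    (\<forall>\<epsilon>1 \<epsilon>2 \<epsilon>3 N1 N2 N3 :: real.
      0 < \<epsilon>1 \<and> \<epsilon>1 \<le> N1 \<and> 0 < \<epsilon>2 \<and> \<epsilon>2 \<le> N2 \<and> 0 < \<epsilon>3 \<and> \<epsilon>3 \<le> N3 \<longrightarrow>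
      (let k = truncated_kernel (\<epsilon>1, \<epsilon>2, \<epsilon>3) (N1, N2, N3) K in
        \<forall>f. L2_fun f \<longrightarrow>
          (AE x in lebesgue. integrable lebesgue (\<lambda>y. k (x - y) * f y)) \<and>
          L2_fun (convolution k f) \<and>
          L2_norm (convolution k f) \<le> A * L2_norm f))"
proof (intro exI[of _ "multiplier_const \<theta>1 \<theta>2 C"] allI impI; (elim conjE)?)
  fix K :: "real \<times> real \<times> real \<Rightarrow> complex" and \<epsilon>1 \<epsilon>2 \<epsilon>3 N1 N2 N3 :: real
  assume K: "regularity C \<theta>1 \<theta>2 K" "cancellation_a C K" "cancellation_b C \<theta>1 K"
      "cancellation_c C \<theta>1 K" "cancellation_d C \<theta>1 K"
    and \<epsilon>N: "0 < \<epsilon>1" "\<epsilon>1 \<le> N1" "0 < \<epsilon>2" "\<epsilon>2 \<le> N2" "0 < \<epsilon>3" "\<epsilon>3 \<le> N3"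
  note ctx = assms(1,3) K(1) \<epsilon>N(1,3,5)
  note L2 = convolution_L2_bound[OF truncated_kernel_measurable[OF ctx] truncated_kernel_bounded[OF ctx]
      truncated_kernel_support[OF ctx] truncated_kernel_AE_isCont[OF ctx]
      truncated_kernel_fourier[OF ctx \<epsilon>N(2,4,6) K(2-5)]]
  show "let k = truncated_kernel (\<epsilon>1, \<epsilon>2, \<epsilon>3) (N1, N2, N3) K in
        \<forall>f. L2_fun f \<longrightarrow>
          (AE x in lebesgue. integrable lebesgue (\<lambda>y. k (x - y) * f y)) \<and>
          L2_fun (convolution k f) \<and>
          L2_norm (convolution k f) \<le> multiplier_const \<theta>1 \<theta>2 C * L2_norm f"
    unfolding Let_def by (intro allI impI conjI AE_I2 L2)
qed

end
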